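(* Let $p$ be a prime with $p\equiv 1\pmod 4$, let $n=\frac{p-1}{2}$, and let $C$ be the $(n+1)\times(n+1)$ matrix with rows and columns indexed by $0,1,\dots,n$ and entries $$C_{ij}=\left(\frac{j-i}{p}\right),\qquad 0\le i,j\le n,$$ where $\left(\frac{\cdot}{p}\right)$ is the Legendre symbol (with $\left(\frac{0}{p}\right)=0$). Let $\varepsilon$ be the fundamental unit of the ring of integers $\mathcal O$ of $\mathbb{Q}(\sqrt p)$ and $h=h(p)$ the class number of $\mathbb{Q}(\sqrt p)$. Define rational numbers $a,b$ by $$a+b\sqrt p=\begin{cases}\varepsilon^{h}, & p\equiv 1\pmod 8,\\ \varepsilon^{3h}, & p\equiv 5\pmod 8.\end{cases}$$ Then $\det C=-a$.
   Context: The fundamental unit $\varepsilon$ is normalized so that $\varepsilon>1$. Here $\sqrt p$ denotes the positive square root. *)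

theory Defs
  imports
    "HOL-Number_Theory.Residues"
    "HOL-Algebra.Ideal"
    "Jordan_Normal_Form.Determinant"
begin

(* The field Q(sqrt d), embedded in the reals with sqrt d the positive root. *)
definition real_quadratic_field :: "nat \<Rightarrow> real set" where
  "real_quadratic_field d = {x + y * sqrt (real d) | x y. x \<in> \<rat> \<and> y \<in> \<rat>}"

definition ring_of_integers :: "'a::field set \<Rightarrow> 'a ring" where
  "ring_of_integers K =
     \<lparr>carrier = {x \<in> K. algebraic_int x}, monoid.mult = (*), one = 1, zero = 0, add = (+)\<rparr>"

(* For an order in a real quadratic field, whose only roots of unity are 1 and -1:
   the generator of the unit group modulo sign that exceeds 1. *)
definition is_fundamental_unit :: "real ring \<Rightarrow> real \<Rightarrow> bool" where
  "is_fundamental_unit R \<epsilon> \<longleftrightarrow>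
     \<epsilon> \<in> Units R \<and> 1 < \<epsilon> \<and>
     (\<forall>u\<in>Units R. \<exists>k::int. u = \<epsilon> powi k \<or> u = - (\<epsilon> powi k))"

definition nonzero_ideals :: "('a, 'b) ring_scheme \<Rightarrow> 'a set set" where
  "nonzero_ideals R = {I. ideal I R \<and> I \<noteq> {\<zero>\<^bsub>R\<^esub>}}"

(* I ~ J iff a I = b J for some nonzero a, b in R.  For the ring of integers of a number field
   the classes are in bijection with fractional ideals modulo principal ones, since every
   fractional ideal is a nonzero multiple of an integral one. *)
definition ideal_class_rel :: "('a, 'b) ring_scheme \<Rightarrow> ('a set \<times> 'a set) set" where
  "ideal_class_rel R =
     {(I, J). I \<in> nonzero_ideals R \<and> J \<in> nonzero_ideals R \<and>
        (\<exists>a\<in>carrier R - {\<zero>\<^bsub>R\<^esub>}. \<exists>b\<in>carrier R - {\<zero>\<^bsub>R\<^esub>}. a <#\<^bsub>R\<^esub> I = b <#\<^bsub>R\<^esub> J)}"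

definition class_number :: "('a, 'b) ring_scheme \<Rightarrow> nat" where
  "class_number R = card (nonzero_ideals R // ideal_class_rel R)"

end

theory Submission
  imports
    "HOL-Number_Theory.Number_Theory"
    "HOL-Computational_Algebra.Nth_Powers"
    "HOL-Analysis.Complex_Transcendental"
    "HOL-Analysis.Equivalence_Lebesgue_Henstock_Integration"
    "HOL-Real_Asymp.Real_Asymp"
    Defs
begin

text \<open>
  Write \<open>\<chi>\<close> for the Legendre symbol and let \<open>\<zeta> = \<xi>\<^sup>2\<close> be a primitive \<open>p\<close>-th root of unity
  whose Gauss sum is \<open>+\<surd>p\<close>; it need not be the standard one, so the sign of the Gauss sum is irrelevant.
  Expanding \<open>\<chi>(j - i)\<close> by the Gauss sum turns \<open>C\<close> into the bilinear form
  \<open>(U, V) \<mapsto> \<Sum>\<^sub>k \<chi>(k) \<xi>\<^sup>k U(\<zeta>\<^sup>k) V(\<zeta>\<^sup>k) / \<surd>p\<close> on polynomials of degree at most \<open>n\<close>, while the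
  identity matrix becomes \<open>\<Sum>\<^sub>k \<xi>\<^sup>k U(\<zeta>\<^sup>k) V(\<zeta>\<^sup>k) / p\<close>.  In Lagrange bases adapted to the residues (for
  \<open>U\<close>) and the nonresidues (for \<open>V\<close>), both are bordered Cauchy matrices in \<open>\<xi>\<^sup>r\<close> and \<open>\<plusminus>\<xi>\<^sup>s\<close>.  The quotient
  of their determinants is \<open>det C\<close>; the Vandermonde factors cancel, and there remains
  \<open>det C = - (F - 1/F) / 2\<close> with \<open>F\<close> a power of \<open>\<Prod>\<^sub>s (1 - \<zeta>\<^sup>s) / \<surd>p\<close>, \<open>s\<close> running over the nonresidues.

  That product equals \<open>\<surd>p \<epsilon>\<^sup>h\<close> by Dirichlet's class number formula.  The ideals of norm at most \<open>x\<close> are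
  counted twice: their number is \<open>\<Sum>\<^sub>d \<chi>(d) \<lfloor>x/d\<rfloor> \<sim> L(1, \<chi>) x\<close>, and each ideal class contributes
  \<open>\<sim> (2 ln \<epsilon> / \<surd>p) x\<close>, by counting lattice points in a hyperbolic strip that is a fundamental domain
  for the units.  In particular the class number is finite.

  Finally \<open>F\<close> is a unit.  If its norm were 1, then \<open>det C\<close> would be a nonzero rational multiple of
  \<open>\<surd>p\<close>; so the norm is \<open>-1\<close>, the conjugate of \<open>F\<close> is \<open>-1/F\<close>, and \<open>det C = -a\<close>.
\<close>

text \<open>Why \<xi> enters: reversing a polynomial of degree at most n costs a factor
  \<zeta>^(-nk) at \<zeta>^k, and -2n = 1 modulo p makes it \<xi>^k. Pairing Lagrange polynomials at
  residues with Lagrange polynomials at nonresidues leaves at most three terms of each sum: at 1, at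
  the residue of the row and at the nonresidue of the column. The weights are values of 1/(y^3 - y),
  since X^p - 1 has derivative p/X at a p-th root of unity. For \<chi> the two weights are added,
  which produces a factor y + z and leaves y - z below; for the identity they are subtracted, with
  the reverse effect. Hence one Cauchy matrix has nodes z, the other -z, and the determinants of the
  base changes are never computed. The products of 1 + y that arise are quotients of products of 1 -
  y^2 by products of 1 - y. Squaring the root fixes or swaps the two residue classes according to
  \<chi>(2), which is the source of the exponents h and 3h. On the analytic side the obstacle is
  that L(1, \<chi>) converges only conditionally; every passage to the limit rests on a tail bound
  uniform in the parameter.\<close>

section \<open>Quadratic residues and Gauss sums\<close>

(* HOL-Algebra hides the number-theoretic cong_def. *)
lemmas cong_iff_mod_eq = unique_euclidean_semiring_class.cong_def

locale prime_1_mod_4 =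
  fixes p :: nat
  assumes prime_p: "prime p" and p_mod_4: "p mod 4 = 1"
begin

definition chi :: "int \<Rightarrow> int" where "chi a = Legendre a (int p)"

lemma p_ge_5: "p \<ge> 5"
proof -
  have "p \<noteq> 0" "p \<noteq> 1" "p \<noteq> 2" "p \<noteq> 3" "p \<noteq> 4" using prime_p p_mod_4 by (auto intro!: notI)
  thus ?thesis by linarith
qed

lemma prime_int_p: "prime (int p)" using prime_p by simp

lemma p_eq: "p = 4 * ((p - 1) div 4) + 1"
proof -
  have "p = 4 * (p div 4) + 1" using mult_div_mod_eq[of 4 p] p_mod_4 by simp
  hence "p - 1 = 4 * (p div 4)" by simp
  thus ?thesis using \<open>p = 4 * (p div 4) + 1\<close> by simp
qed

lemma odd_p: "odd p" by (subst p_eq) simp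

lemma p_mod_8: "p mod 8 = 1 \<or> p mod 8 = 5"
proof -
  have "p mod 8 mod 4 = 1" using p_mod_4 by (simp add: mod_mod_cancel)
  hence e: "p mod 8 = 4 * (p mod 8 div 4) + 1" using mult_div_mod_eq[of 4 "p mod 8"] by simp
  have "p mod 8 div 4 < 2" by (rule less_mult_imp_div_less) simp
  hence "p mod 8 div 4 = 0 \<or> p mod 8 div 4 = 1" by linarith
  thus ?thesis using e by auto
qed

lemma chi_eq_0_iff: "chi a = 0 \<longleftrightarrow> int p dvd a"
  unfolding chi_def Legendre_def by (auto simp: cong_0_iff)

lemma chi_values: "chi a \<in> {-1, 0, 1}"
  unfolding chi_def Legendre_def by auto

lemma chi_abs_le: "\<bar>chi a\<bar> \<le> 1"
  using chi_values[of a] by auto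

lemma chi_cong: "[a = b] (mod int p) \<Longrightarrow> chi a = chi b"
  unfolding chi_def Legendre_def QuadRes_def cong_iff_mod_eq by simp

lemma chi_mod [simp]: "chi (a mod int p) = chi a"
  by (rule chi_cong) simp

lemma euler: "[chi a = a ^ ((p - 1) div 2)] (mod int p)"
  unfolding chi_def using euler_criterion[of p a] prime_p p_ge_5 by simp

text \<open>Two numbers of absolute value at most 1 differ by at most 2 < p, so a congruence between
  them is an equality.\<close>

lemma chi_eqI: assumes "[chi a = c] (mod int p)" "\<bar>c\<bar> \<le> 1" shows "chi a = c"
proof -
  have "int p dvd chi a - c" using assms(1) by (simp add: cong_iff_dvd_diff)
  moreover have "\<bar>chi a - c\<bar> \<le> 2" using chi_abs_le[of a] assms(2) by linarith
  ultimately have "chi a - c = 0"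
    using p_ge_5 dvd_imp_le_int[of "chi a - c" "int p"] by auto
  thus ?thesis by simp
qed

lemma chi_mult: "chi (a * b) = chi a * chi b"
proof (rule chi_eqI)
  have "[chi a * chi b = a ^ ((p - 1) div 2) * b ^ ((p - 1) div 2)] (mod int p)"
    by (intro cong_mult euler)
  thus "[chi (a * b) = chi a * chi b] (mod int p)"
    using euler[of "a * b"] by (metis cong_sym cong_trans power_mult_distrib)
  show "\<bar>chi a * chi b\<bar> \<le> 1"
    using chi_values[of a] chi_values[of b] by auto
qed

lemma chi_1 [simp]: "chi 1 = 1"
  by (rule chi_eqI) (use euler[of 1] in auto)

lemma chi_0 [simp]: "chi 0 = 0" by (simp add: chi_eq_0_iff)

lemma chi_minus_1: "chi (- 1) = 1"
proof (rule chi_eqI)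
  have "(p - 1) div 2 = 2 * ((p - 1) div 4)" by (subst (1) p_eq) simp
  hence "even ((p - 1) div 2)" by simp
  thus "[chi (- 1) = 1] (mod int p)" using euler[of "-1"] by simp
qed simp

lemma chi_minus: "chi (- a) = chi a"
  using chi_mult[of "-1" a] chi_minus_1 by simp

lemma chi_power: "chi (a ^ k) = chi a ^ k"
  by (induction k) (auto simp: chi_mult)

text \<open>With i a square root of -1 modulo p, (1 + i)^2 = 2i, so 2 and i have the same symbol.
  Euler's criterion at i gives i^(2m) = (-1)^m, where p = 4m + 1.\<close>

lemma chi_2: "chi 2 = (- 1) ^ ((p - 1) div 4)"
proof -
  define m where "m = (p - 1) div 4"
  have pm: "p = 4 * m + 1" unfolding m_def by (rule p_eq)
  have "chi (- 1) \<noteq> 0" "chi (-1) = 1" using chi_minus_1 by auto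
  hence "QuadRes (int p) (- 1)" unfolding chi_def Legendre_def by (auto split: if_splits)
  then obtain i where i: "[i\<^sup>2 = - 1] (mod int p)" unfolding QuadRes_def by auto
  have "[(1 + i)\<^sup>2 = 2 * i] (mod int p)"
  proof -
    have "(1 + i)\<^sup>2 = (1 + i\<^sup>2) + 2 * i" by (simp add: power2_eq_square algebra_simps)
    also have "[\<dots> = (1 + (-1)) + 2 * i] (mod int p)" by (intro cong_add i cong_refl)
    finally show ?thesis by simp
  qed
  hence "chi ((1 + i)\<^sup>2) = chi (2 * i)" by (rule chi_cong)
  hence *: "(chi (1 + i))\<^sup>2 = chi 2 * chi i" by (simp add: chi_power chi_mult)
  have "[chi i = i ^ (2 * m)] (mod int p)" using euler[of i] pm by (simp add: mult.commute)
  moreover have "[i ^ (2 * m) = (-1) ^ m] (mod int p)" 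
    unfolding power_mult by (intro cong_pow i)
  ultimately have ci: "chi i = (-1) ^ m" by (intro chi_eqI) (auto intro: cong_trans simp: power_abs)
  have n2: "chi 2 \<noteq> 0" unfolding chi_eq_0_iff using p_ge_5 zdvd_imp_le[of "int p" 2] by auto
  have "(chi (1 + i))\<^sup>2 \<noteq> 0" using * n2 ci by simp
  hence "(chi (1 + i))\<^sup>2 = 1" using chi_values[of "1 + i"] by auto
  thus ?thesis using * ci n2 chi_values[of 2] unfolding m_def[symmetric]
    by (cases "even m") auto
qed

text \<open>Otherwise squaring would map the nonzero residues onto themselves and hence be
  injective, although 1 and -1 have the same square.\<close>

lemma ex_nonresidue: "\<exists>g. chi g = -1"
proof (rule ccontr)
  assume no: "\<nexists>g. chi g = -1"
  define S where "S = {1..<int p}"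
  have fin: "finite S" unfolding S_def by simp
  have nd: "\<not> int p dvd k" if "k \<in> S" for k
    using that zdvd_imp_le[of "int p" k] unfolding S_def by auto
  have inS: "k mod int p \<in> S" if "\<not> int p dvd k" for k
  proof -
    have "k mod int p \<noteq> 0" using that by (simp add: dvd_eq_mod_eq_0)
    moreover have "0 \<le> k mod int p" "k mod int p < int p" using p_ge_5 by auto
    ultimately show ?thesis unfolding S_def by auto
  qed
  have "S \<subseteq> (\<lambda>y. y\<^sup>2 mod int p) ` S"
  proof
    fix a assume a: "a \<in> S"
    have "chi a = 1" using no chi_values[of a] nd[OF a] chi_eq_0_iff[of a] by auto
    hence "QuadRes (int p) a" unfolding chi_def Legendre_def by (auto split: if_splits)
    then obtain y where y: "[y\<^sup>2 = a] (mod int p)" unfolding QuadRes_def by auto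
    have "\<not> int p dvd y"
      using y nd[OF a] by (metis cong_dvd_iff dvd_power zero_less_numeral dvd_trans)
    moreover have "(y mod int p)\<^sup>2 mod int p = a"
      using y a unfolding cong_iff_mod_eq S_def by (simp add: power_mod)
    ultimately show "a \<in> (\<lambda>y. y\<^sup>2 mod int p) ` S" by (intro image_eqI[OF sym inS])
  qed
  hence "inj_on (\<lambda>y. y\<^sup>2 mod int p) S"
    using fin by (metis (no_types, lifting) card_image_le card_mono eq_card_imp_inj_on finite_imageI le_antisym)
  moreover have "(1::int)\<^sup>2 mod int p = (int p - 1)\<^sup>2 mod int p"
  proof -
    have "(int p - 1)\<^sup>2 = 1\<^sup>2 + int p * (int p - 2)" by (simp add: power2_eq_square algebra_simps)
    thus ?thesis by simp
  qed
  moreover have "1 \<in> S" "int p - 1 \<in> S" using p_ge_5 unfolding S_def by auto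
  ultimately have "1 = int p - 1" by (meson inj_onD)
  thus False using p_ge_5 by simp
qed

section \<open>Complete residue systems, residues and nonresidues\<close>

lemma residues_bij:
  assumes "\<not> int p dvd a"
  shows "bij_betw (\<lambda>k. (a * k + b) mod int p) {0..<int p} {0..<int p}"
proof -
  have pos: "int p > 0" using p_ge_5 by simp
  have inj: "inj_on (\<lambda>k. (a * k + b) mod int p) {0..<int p}"
  proof (rule inj_onI)
    fix x y assume xy: "x \<in> {0..<int p}" "y \<in> {0..<int p}" "(a * x + b) mod int p = (a * y + b) mod int p"
    hence "int p dvd (a * x + b) - (a * y + b)" by (simp add: mod_eq_dvd_iff)
    hence "int p dvd a * (x - y)" by (simp add: algebra_simps)
    hence "int p dvd x - y" using assms prime_int_p by (simp add: prime_dvd_mult_iff)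
    hence "x mod int p = y mod int p" by (simp add: mod_eq_dvd_iff)
    thus "x = y" using xy by simp
  qed
  have "(\<lambda>k. (a * k + b) mod int p) ` {0..<int p} = {0..<int p}"
    by (rule card_subset_eq) (use pos in \<open>auto simp: card_image[OF inj]\<close>)
  thus ?thesis using inj by (simp add: bij_betw_def)
qed

lemma residues_reindex:
  fixes F :: "int \<Rightarrow> 'a :: comm_monoid_add"
  assumes "\<not> int p dvd a" and per: "\<And>k. F (k mod int p) = F k"
  shows "(\<Sum>k\<in>{0..<int p}. F (a * k + b)) = (\<Sum>k\<in>{0..<int p}. F k)"
  using sum.reindex_bij_betw[OF residues_bij[OF assms(1)], of F] by (simp add: per)

lemma sum_chi: "(\<Sum>k\<in>{0..<int p}. chi k) = 0"
proof -
  obtain g where g: "chi g = -1" using ex_nonresidue by auto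
  have "(\<Sum>k\<in>{0..<int p}. chi (g * k + 0)) = (\<Sum>k\<in>{0..<int p}. chi k)"
    by (rule residues_reindex) (use g chi_eq_0_iff[of g] in auto)
  thus ?thesis by (simp add: chi_mult g sum_negf)
qed

text \<open>The constant of the minimal polynomial x^2 - x - \<open>q0\<close> of (1 + sqrt p)/2.
  The polynomial b^2 + b - \<open>q0\<close> used later has the negated roots and discriminant
  p.\<close>

definition q0 :: int where "q0 = (int p - 1) div 4"

lemma p_q0: "int p = 4 * q0 + 1"
proof -
  have "int p - 1 = 4 * int ((p - 1) div 4)" using arg_cong[OF p_eq, of int] by simp
  thus ?thesis unfolding q0_def by simp
qed

definition Res :: "int set" where "Res = {k \<in> {0..<int p}. chi k = 1}"
definition Non :: "int set" where "Non = {k \<in> {0..<int p}. chi k = -1}"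

lemma finite_Res [simp]: "finite Res" and finite_Non [simp]: "finite Non"
proof -
  show "finite Res" unfolding Res_def by (rule finite_subset[of _ "{0..<int p}"]) auto
  show "finite Non" unfolding Non_def by (rule finite_subset[of _ "{0..<int p}"]) auto
qed

lemma residues_split: "{0..<int p} = insert 0 (Res \<union> Non)" "0 \<notin> Res" "0 \<notin> Non" "Res \<inter> Non = {}"
proof -
  have "k = 0" if "k \<in> {0..<int p}" "chi k = 0" for k
    using that zdvd_imp_le[of "int p" k] chi_eq_0_iff[of k] by force
  thus "{0..<int p} = insert 0 (Res \<union> Non)"
    using p_ge_5 chi_values unfolding Res_def Non_def by (auto, metis)
qed (auto simp: Res_def Non_def)

lemma sum_residues_split:
  fixes F :: "int \<Rightarrow> 'a :: comm_monoid_add"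
  shows "(\<Sum>k\<in>{0..<int p}. F k) = F 0 + ((\<Sum>k\<in>Res. F k) + (\<Sum>k\<in>Non. F k))"
  using residues_split by (simp add: sum.union_disjoint)

lemma card_Res: "card Res = (p - 1) div 2" and card_Non: "card Non = (p - 1) div 2"
proof -
  have "(\<Sum>k\<in>{0..<int p}. chi k) = int (card Res) - int (card Non)"
    unfolding sum_residues_split by (simp add: Res_def Non_def)
  hence 1: "card Res = card Non" using sum_chi by simp
  have "int (card {0..<int p}) = 1 + (int (card Res) + int (card Non))"
    using sum_residues_split[of "\<lambda>_. 1 :: int"] by simp
  thus "card Res = (p - 1) div 2" "card Non = (p - 1) div 2" using 1 by auto
qed

section \<open>Gauss sums at an arbitrary nontrivial p-th root of unity\<close>

definition gauss :: "complex \<Rightarrow> complex" where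
  "gauss z = (\<Sum>k\<in>{0..<int p}. of_int (chi k) * z powi k)"

context
  fixes \<zeta> :: complex
  assumes root: "\<zeta> ^ p = 1" "\<zeta> \<noteq> 1"
begin

lemma root_nz: "\<zeta> \<noteq> 0" using root p_ge_5 by (auto simp: power_0_left)

lemma powi_p_mult: "\<zeta> powi (int p * m) = 1"
  using root(1) by (simp add: power_int_mult)

lemma powi_mod: "\<zeta> powi (k mod int p) = \<zeta> powi k"
proof -
  have "\<zeta> powi k = \<zeta> powi (int p * (k div int p) + k mod int p)" by simp
  also have "\<dots> = \<zeta> powi (k mod int p)"
    using root_nz by (subst power_int_add) (auto simp: powi_p_mult)
  finally show ?thesis by simp
qed

lemma powi_eq_1_iff: "\<zeta> powi k = 1 \<longleftrightarrow> int p dvd k"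
proof
  assume k: "\<zeta> powi k = 1"
  show "int p dvd k"
  proof (rule ccontr)
    assume "\<not> int p dvd k"
    hence "coprime k (int p)" using prime_int_p by (metis coprime_commute prime_imp_coprime)
    then obtain a b where "a * k + b * int p = 1"
      by (metis bezout_int coprime_imp_gcd_eq_1)
    hence "\<zeta> = \<zeta> powi (k * a + int p * b)" by (simp add: mult.commute)
    also have "\<dots> = 1" using root_nz k
      by (subst power_int_add) (auto simp: powi_p_mult power_int_mult root)
    finally show False using root by simp
  qed
qed (auto simp: powi_p_mult)

lemma powi_eq_iff: "\<zeta> powi k = \<zeta> powi l \<longleftrightarrow> int p dvd k - l"
proof -
  have "\<zeta> powi k = \<zeta> powi (k - l) * \<zeta> powi l"
    using root_nz by (subst power_int_add[symmetric]) auto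
  thus ?thesis using root_nz by (auto simp: powi_eq_1_iff[symmetric])
qed

lemma norm_root: "norm \<zeta> = 1"
proof -
  have "norm \<zeta> ^ p = 1" using root(1) by (metis norm_one norm_power)
  thus ?thesis using p_ge_5 power_eq_imp_eq_base[of "norm \<zeta>" p 1] by auto
qed

lemma sum_powi: "(\<Sum>k\<in>{0..<int p}. \<zeta> powi (k * m)) = (if int p dvd m then of_nat p else 0)"
proof (cases "int p dvd m")
  case True
  have "\<zeta> powi (k * m) = 1" for k
    using powi_eq_1_iff[of "k * m"] True by auto
  thus ?thesis using True by simp
next
  case False
  have "(\<Sum>k\<in>{0..<int p}. \<zeta> powi ((1 * k + 1) * m)) = (\<Sum>k\<in>{0..<int p}. \<zeta> powi (k * m))"
    by (rule residues_reindex[where F = "\<lambda>k. \<zeta> powi (k * m)"])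
       (use p_ge_5 zdvd_imp_le[of "int p" 1] in \<open>auto simp: powi_eq_iff mod_eq_dvd_iff[symmetric] simp flip: left_diff_distrib intro!: dvd_mult2\<close>)
  moreover have "\<zeta> powi ((1 * k + 1) * m) = \<zeta> powi m * \<zeta> powi (k * m)" for k
    using root_nz by (simp add: power_int_add algebra_simps)
  ultimately have "\<zeta> powi m * (\<Sum>k\<in>{0..<int p}. \<zeta> powi (k * m)) = (\<Sum>k\<in>{0..<int p}. \<zeta> powi (k * m))"
    by (simp add: sum_distrib_left)
  thus ?thesis using False powi_eq_1_iff[of m] by auto
qed

text \<open>If p does not divide m, the substitution of m k for k pulls out \<open>chi m\<close>,
  which is its own inverse; if p divides m, both sides vanish. Read from right to left, this is the
  finite Fourier expansion of \<open>chi\<close>.\<close>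

lemma gauss_twist: "(\<Sum>k\<in>{0..<int p}. of_int (chi k) * \<zeta> powi (k * m)) = of_int (chi m) * gauss \<zeta>"
proof (cases "int p dvd m")
  case True
  have "\<zeta> powi (k * m) = 1" for k
    using powi_eq_1_iff[of "k * m"] True by auto
  thus ?thesis using sum_chi True chi_eq_0_iff[of m] by (simp flip: of_int_sum)
next
  case False
  have "of_int (chi m) * gauss \<zeta> = of_int (chi m) * (\<Sum>k\<in>{0..<int p}. of_int (chi (m * k + 0)) * \<zeta> powi (m * k + 0))"
    unfolding gauss_def
    by (subst residues_reindex[where F = "\<lambda>k. of_int (chi k) * \<zeta> powi k"]) (use False powi_mod in auto)
  also have "\<dots> = (\<Sum>k\<in>{0..<int p}. of_int (chi m * chi m * chi k) * \<zeta> powi (k * m))"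
    by (simp add: sum_distrib_left chi_mult mult_ac)
  also have "chi m * chi m = 1" using False chi_eq_0_iff[of m] chi_values[of m] by auto
  finally show ?thesis by simp
qed

text \<open>The squares of all twists are summed over m in two ways. Directly this gives p - 1 times
  the square of the Gauss sum; after expansion, orthogonality keeps only the pairs with l = -k, and
  \<open>chi\<close> is even.\<close>

lemma gauss_square: "gauss \<zeta> ^ 2 = of_nat p"
proof -
  let ?S = "{0..<int p}"
  have "(\<Sum>m\<in>?S. (of_int (chi m) * gauss \<zeta>)\<^sup>2) = (\<Sum>m\<in>?S. (of_int (chi m))\<^sup>2) * (gauss \<zeta>)\<^sup>2"
    by (simp add: sum_distrib_right power_mult_distrib)
  also have "(\<Sum>m\<in>?S. (of_int (chi m))\<^sup>2) = (of_nat (p - 1) :: complex)"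
    unfolding sum_residues_split using card_Res card_Non odd_p
    by (simp add: Res_def Non_def flip: of_nat_add) presburger
  finally have 1: "(\<Sum>m\<in>?S. (of_int (chi m) * gauss \<zeta>)\<^sup>2) = of_nat (p - 1) * (gauss \<zeta>)\<^sup>2" .
  have "(\<Sum>m\<in>?S. (of_int (chi m) * gauss \<zeta>)\<^sup>2) =
     (\<Sum>m\<in>?S. \<Sum>k\<in>?S. \<Sum>l\<in>?S. of_int (chi k) * of_int (chi l) * \<zeta> powi (m * (k + l)))"
    unfolding gauss_twist[symmetric] power2_eq_square sum_product
    using root_nz by (intro sum.cong refl) (simp add: power_int_add algebra_simps)
  also have "\<dots> = (\<Sum>k\<in>?S. \<Sum>l\<in>?S. \<Sum>m\<in>?S. of_int (chi k) * of_int (chi l) * \<zeta> powi (m * (k + l)))"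
    proof -
    have "(\<Sum>m\<in>?S. \<Sum>k\<in>?S. \<Sum>l\<in>?S. G k l m) = (\<Sum>k\<in>?S. \<Sum>l\<in>?S. \<Sum>m\<in>?S. G k l m)"
      for G :: "int \<Rightarrow> int \<Rightarrow> int \<Rightarrow> complex"
      using sum.swap[of "\<lambda>m k. \<Sum>l\<in>?S. G k l m" ?S ?S] sum.swap[of "\<lambda>m l. G _ l m" ?S ?S] by simp
    thus ?thesis .
  qed
  also have "\<dots> = (\<Sum>k\<in>?S. \<Sum>l\<in>?S. of_int (chi k) * of_int (chi l) * (if int p dvd k + l then of_nat p else 0))"
    by (simp add: sum_distrib_left[symmetric] sum_powi)
  also have "\<dots> = (\<Sum>k\<in>?S. of_int (chi k) * of_int (chi k) * of_nat p)"
  proof (intro sum.cong refl)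
    fix k assume k: "k \<in> ?S"
    have "(\<Sum>l\<in>?S. of_int (chi k) * of_int (chi l) * (if int p dvd k + l then of_nat p else 0)) =
      (\<Sum>l\<in>?S. if l = (- k) mod int p then of_int (chi k) * of_int (chi k) * of_nat p else (0::complex))"
    proof (intro sum.cong refl)
      fix l assume l: "l \<in> ?S"
      have "int p dvd k + l \<longleftrightarrow> l = (- k) mod int p"
      proof -
        have "l = (- k) mod int p \<longleftrightarrow> l mod int p = (- k) mod int p" using l by auto
        also have "\<dots> \<longleftrightarrow> int p dvd l - (- k)" by (rule mod_eq_dvd_iff)
        finally show ?thesis by (simp add: add.commute)
      qed
      thus "of_int (chi k) * of_int (chi l) * (if int p dvd k + l then of_nat p else 0) =
        (if l = (- k) mod int p then of_int (chi k) * of_int (chi k) * of_nat p else (0::complex))"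
        by (auto simp: chi_minus)
    qed
    also have "\<dots> = of_int (chi k) * of_int (chi k) * of_nat p"
      using p_ge_5 by simp
    finally show "(\<Sum>l\<in>?S. of_int (chi k) * of_int (chi l) * (if int p dvd k + l then of_nat p else 0)) = (of_int (chi k) * of_int (chi k) * of_nat p :: complex)" .
  qed
  also have "\<dots> = of_nat (p - 1) * of_nat p"
    unfolding sum_residues_split using card_Res card_Non odd_p
    by (simp add: Res_def Non_def flip: of_nat_add distrib_right) presburger
  finally have "of_nat (p - 1) * (gauss \<zeta>)\<^sup>2 = of_nat (p - 1) * (of_nat p :: complex)" using 1 by simp
  thus ?thesis using p_ge_5 by simp
qed

end

text \<open>Passing to a nonresidue power of the root flips the sign of its Gauss sum.\<close>
lemma ex_root_gauss: "\<exists>\<zeta>. \<zeta> ^ p = 1 \<and> \<zeta> \<noteq> 1 \<and> gauss \<zeta> = of_real (sqrt (real p))"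
proof -
  define z where "z = cis (2 * pi / real p)"
  have z: "z ^ p = 1" proof -
    have "z ^ p = cis (real p * (2 * pi / real p))" unfolding z_def by (rule Complex.DeMoivre)
    also have "real p * (2 * pi / real p) = 2 * pi" using p_ge_5 by simp
    finally show ?thesis by simp
  qed
  have z1: "z \<noteq> 1"
  proof
    assume "z = 1"
    hence "cos (2 * pi / real p) = 1" unfolding z_def by (metis cis.sel(1) one_complex.sel(1))
    moreover have "cos (2 * pi / real p) < cos 0"
      by (intro cos_monotone_0_pi) (use p_ge_5 in \<open>auto simp: field_simps\<close>)
    ultimately show False by simp
  qed
  have "gauss z ^ 2 = (of_real (sqrt (real p)))\<^sup>2"
    using gauss_square[OF z z1] by (simp flip: of_real_power)
  hence "gauss z = of_real (sqrt (real p)) \<or> gauss z = - of_real (sqrt (real p))"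
    by (simp add: power2_eq_iff)
  thus ?thesis
  proof
    assume g: "gauss z = - of_real (sqrt (real p))"
    obtain g where gg: "chi g = -1" using ex_nonresidue by auto
    let ?w = "z powi g"
    have "?w ^ p = 1" using powi_p_mult[OF z z1, of g]
      by (metis mult.commute power_int_mult power_int_of_nat)
    moreover have "?w \<noteq> 1" using powi_eq_1_iff[OF z z1, of g] gg chi_eq_0_iff[of g] by auto
    moreover have "gauss ?w = of_real (sqrt (real p))"
      using gauss_twist[OF z z1, of g] g gg unfolding gauss_def
      by (simp add: power_int_mult[symmetric] mult.commute)
    ultimately show ?thesis by blast
  qed (use z z1 in blast)
qed

end

section \<open>Cauchy determinants with a border\<close>

lemma det_scale:
  fixes f :: "nat \<Rightarrow> nat \<Rightarrow> 'a :: comm_ring_1"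
  shows "det (mat n n (\<lambda>(i, j). r i * c j * f i j)) =
    (\<Prod>i<n. r i) * (\<Prod>j<n. c j) * det (mat n n (\<lambda>(i, j). f i j))"
proof -
  have *: "(\<Prod>i = 0..<n. mat n n (\<lambda>(i, j). r i * c j * f i j) $$ (i, q i)) =
     (\<Prod>i<n. r i) * (\<Prod>j<n. c j) * (\<Prod>i = 0..<n. mat n n (\<lambda>(i, j). f i j) $$ (i, q i))"
    if q: "q permutes {0..<n}" for q
  proof -
    have qi: "q i < n" if "i < n" for i using permutes_in_image[OF q, of i] that by simp
    have "(\<Prod>i = 0..<n. mat n n (\<lambda>(i, j). r i * c j * f i j) $$ (i, q i)) =
      (\<Prod>i = 0..<n. r i * c (q i) * mat n n (\<lambda>(i, j). f i j) $$ (i, q i))"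
      using qi by (intro prod.cong) auto
    also have "\<dots> = (\<Prod>i<n. r i) * (\<Prod>i = 0..<n. c (q i)) * (\<Prod>i = 0..<n. mat n n (\<lambda>(i, j). f i j) $$ (i, q i))"
      by (simp add: prod.distrib lessThan_atLeast0)
    also have "(\<Prod>i = 0..<n. c (q i)) = (\<Prod>j<n. c j)"
      using prod.permute[OF q, of c] by (simp add: lessThan_atLeast0 o_def)
    finally show ?thesis .
  qed
  have d: "det (mat n n (\<lambda>(i, j). g i j)) = (\<Sum>q\<in>{q. q permutes {0..<n}}.
      signof q * (\<Prod>i = 0..<n. mat n n (\<lambda>(i, j). g i j) $$ (i, q i)))" for g :: "nat \<Rightarrow> nat \<Rightarrow> 'a"
    by (rule det_def') simp
  show ?thesis
    unfolding d[of "\<lambda>i j. r i * c j * f i j"] d[of f] sum_distrib_left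
    by (rule sum.cong[OF refl], simp only: * mem_Collect_eq) (simp only: mult_ac)
qed

lemma det_add_last_row:
  fixes F :: "nat \<Rightarrow> nat \<Rightarrow> 'a :: comm_ring_1"
  shows "det (mat (Suc n) (Suc n) (\<lambda>(i, j). if i < n then F i j + a i * r j else r j)) =
    det (mat (Suc n) (Suc n) (\<lambda>(i, j). if i < n then F i j else r j))"
proof -
  define L where "L = mat (Suc n) (Suc n) (\<lambda>(i, j). if i = j then 1 else if j = n then a i else (0::'a))"
  define A where "A = mat (Suc n) (Suc n) (\<lambda>(i, j). if i < n then F i j else r j)"
  have c: "L \<in> carrier_mat (Suc n) (Suc n)" "A \<in> carrier_mat (Suc n) (Suc n)"
    unfolding L_def A_def by auto
  have "det L = prod_list (diag_mat L)"
    by (rule det_upper_triangular[OF _ c(1)]) (auto simp: L_def)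
  also have "diag_mat L = replicate (Suc n) 1"
    unfolding diag_mat_def L_def by (auto intro!: nth_equalityI simp del: upt_Suc replicate_Suc)
  finally have detL: "det L = 1" by simp
  have "mat (Suc n) (Suc n) (\<lambda>(i, j). if i < n then F i j + a i * r j else r j) = L * A"
  proof (rule eq_matI)
    fix i j assume "i < dim_row (L * A)" "j < dim_col (L * A)"
    hence ij: "i < Suc n" "j < Suc n" unfolding L_def A_def by auto
    have "(L * A) $$ (i, j) = (\<Sum>k = 0..<Suc n. L $$ (i, k) * A $$ (k, j))"
      using ij c by (simp add: scalar_prod_def)
    also have "\<dots> = (\<Sum>k = 0..<n. (if k = i then 1 else 0) * F k j) + (if i = n then 1 else a i) * r j"
      using ij unfolding L_def A_def by (auto intro!: sum.cong)
    also have "\<dots> = (if i < n then F i j + a i * r j else r j)"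
      using ij by (auto simp: if_distrib[of "\<lambda>x. x * _"] cong: if_cong)
    finally show "mat (Suc n) (Suc n) (\<lambda>(i, j). if i < n then F i j + a i * r j else r j) $$ (i, j) = (L * A) $$ (i, j)"
      using ij by simp
  qed (auto simp: L_def A_def)
  thus ?thesis using det_mult[OF c] detL unfolding A_def by simp
qed

lemma det_last_row_linear:
  fixes F :: "nat \<Rightarrow> nat \<Rightarrow> 'a :: comm_ring_1"
  shows "det (mat (Suc n) (Suc n) (\<lambda>(i, j). if i < n then F i j else a * r j + b * s j)) =
    a * det (mat (Suc n) (Suc n) (\<lambda>(i, j). if i < n then F i j else r j)) +
    b * det (mat (Suc n) (Suc n) (\<lambda>(i, j). if i < n then F i j else s j))"
proof -
  define A where "A r = mat (Suc n) (Suc n) (\<lambda>(i, j). if i < n then F i j else r j)" for r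
  have c: "A r \<in> carrier_mat (Suc n) (Suc n)" for r unfolding A_def by auto
  have cof: "cofactor (A r) n j = cofactor (A s) n j" if "j < Suc n" for r s j
  proof -
    have "mat_delete (A r) n j = mat_delete (A s) n j"
      unfolding mat_delete_def A_def by (rule eq_matI) auto
    thus ?thesis unfolding cofactor_def by simp
  qed
  have e: "det (A r) = (\<Sum>j<Suc n. r j * cofactor (A s) n j)" for r s
  proof -
    have "det (A r) = (\<Sum>j<Suc n. A r $$ (n, j) * cofactor (A r) n j)"
      by (rule laplace_expansion_row[OF c]) simp
    also have "\<dots> = (\<Sum>j<Suc n. r j * cofactor (A s) n j)"
    proof (intro sum.cong refl)
      fix j assume "j \<in> {..<Suc n}"
      moreover from this have "A r $$ (n, j) = r j" unfolding A_def by simp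
      ultimately show "A r $$ (n, j) * cofactor (A r) n j = r j * cofactor (A s) n j"
        using cof[of j r s] by simp
    qed
    finally show ?thesis .
  qed
  have "det (A (\<lambda>j. a * r j + b * s j)) = a * det (A r) + b * det (A s)"
    unfolding e[of _ r] by (simp add: sum_distrib_left sum.distrib algebra_simps)
  thus ?thesis unfolding A_def .
qed

text \<open>Subtracting \<open>F i n\<close> times the last row from row i clears the last column
  above the corner entry 1.\<close>

lemma det_schur:
  fixes F :: "nat \<Rightarrow> nat \<Rightarrow> 'a :: comm_ring_1"
  assumes "F n n = 1"
  shows "det (mat (Suc n) (Suc n) (\<lambda>(i, j). F i j)) =
    det (mat n n (\<lambda>(i, j). F i j - F i n * F n j))"
proof -
  define G where "G = (\<lambda>i j. F i j - F i n * F n j)"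
  define A where "A = mat (Suc n) (Suc n) (\<lambda>(i, j). if i < n then G i j else F n j)"
  have c: "A \<in> carrier_mat (Suc n) (Suc n)" unfolding A_def by auto
  have "mat (Suc n) (Suc n) (\<lambda>(i, j). F i j) = mat (Suc n) (Suc n) (\<lambda>(i, j). if i < n then G i j + F i n * F n j else F n j)"
    by (rule eq_matI) (auto simp: G_def less_Suc_eq)
  hence "det (mat (Suc n) (Suc n) (\<lambda>(i, j). F i j)) = det A"
    unfolding A_def by (simp add: det_add_last_row)
  also have "\<dots> = (\<Sum>i<Suc n. A $$ (i, n) * cofactor A i n)"
    by (rule laplace_expansion_column[OF c]) simp
  also have "\<dots> = cofactor A n n"
    unfolding A_def G_def using assms by simp
  also have "\<dots> = det (mat_delete A n n)" unfolding cofactor_def by (simp flip: mult_2)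
  also have "mat_delete A n n = mat n n (\<lambda>(i, j). G i j)"
    unfolding mat_delete_def A_def by (rule eq_matI) auto
  finally show ?thesis unfolding G_def .
qed

section \<open>Cauchy's formula and its bordered variants\<close>

definition cauchy_det :: "nat \<Rightarrow> (nat \<Rightarrow> 'a :: field) \<Rightarrow> (nat \<Rightarrow> 'a) \<Rightarrow> 'a" where
  "cauchy_det n y z = det (mat n n (\<lambda>(i, j). 1 / (y i - z j)))"

text \<open>Rows and columns are rescaled so that the last row and the last column consist of ones.
  The Schur complement then subtracts 1 from every entry, and the difference is again a Cauchy entry
  times a row factor and a column factor.\<close>

lemma cauchy_det_Suc:
  assumes ne: "\<And>i j. i \<le> n \<Longrightarrow> j \<le> n \<Longrightarrow> y i \<noteq> z j"
  shows "cauchy_det (Suc n) y z * ((\<Prod>i<n. (y i - z n) * (y n - z i)) * (y n - z n)) =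
    (\<Prod>i<n. (y n - y i) * (z i - z n)) * cauchy_det n y z"
proof -
  define d where "d = y n - z n"
  have d: "d \<noteq> 0" using ne[of n n] unfolding d_def by simp
  define F where "F = (\<lambda>i j. ((y i - z n) / d) * (y n - z j) * (1 / (y i - z j)))"
  have "det (mat (Suc n) (Suc n) (\<lambda>(i, j). F i j)) =
    det (mat n n (\<lambda>(i, j). F i j - F i n * F n j))"
    by (rule det_schur) (use d in \<open>simp add: F_def d_def\<close>)
  also have "mat n n (\<lambda>(i, j). F i j - F i n * F n j) =
     mat n n (\<lambda>(i, j). ((y n - y i) / d) * (z j - z n) * (1 / (y i - z j)))"
  proof (rule eq_matI, goal_cases)
    case (1 i j)
    hence ij: "i < n" "j < n" by auto
    have nz: "y i - z j \<noteq> 0" "y i - z n \<noteq> 0" "y n - z j \<noteq> 0" using ne ij by (auto simp: less_imp_le)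
    have "F i n * F n j = 1" using nz d unfolding F_def d_def by simp
    moreover have "F i j - 1 = ((y n - y i) / d) * (z j - z n) * (1 / (y i - z j))"
      unfolding F_def using nz d by (simp add: divide_simps) (simp add: d_def algebra_simps)
    ultimately show ?case using ij by simp
  qed auto
  also have "det \<dots> = (\<Prod>i<n. (y n - y i) / d) * (\<Prod>j<n. z j - z n) * cauchy_det n y z"
    unfolding cauchy_det_def by (rule det_scale)
  finally have 1: "(\<Prod>i<Suc n. (y i - z n) / d) * (\<Prod>j<Suc n. y n - z j) * cauchy_det (Suc n) y z
     = (\<Prod>i<n. (y n - y i) / d) * (\<Prod>j<n. z j - z n) * cauchy_det n y z"
    unfolding cauchy_det_def F_def det_scale .
  have 2: "(\<Prod>i<n. (y i - z n)) * ((\<Prod>j<n. y n - z j) * d) * cauchy_det (Suc n) y z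
     = (\<Prod>i<n. (y n - y i)) * (\<Prod>j<n. z j - z n) * cauchy_det n y z"
    using 1 d by (simp add: prod_dividef d_def[symmetric] field_simps)
  thus ?thesis by (simp add: prod.distrib d_def[symmetric] mult_ac)
qed

lemma cauchy_det_formula:
  assumes ne: "\<And>i j. i < n \<Longrightarrow> j < n \<Longrightarrow> y i \<noteq> z j"
  shows "cauchy_det n y z * (\<Prod>i<n. \<Prod>j<n. y i - z j) =
    (\<Prod>j<n. \<Prod>i<j. (y j - y i) * (z i - z j))"
  using ne
proof (induction n)
  case 0
  show ?case by (simp add: cauchy_det_def)
next
  case (Suc n)
  have "(\<Prod>i<Suc n. \<Prod>j<Suc n. y i - z j) =
     (\<Prod>i<n. \<Prod>j<n. y i - z j) * ((\<Prod>i<n. (y i - z n) * (y n - z i)) * (y n - z n))"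
    by (simp add: prod.distrib mult_ac)
  hence "cauchy_det (Suc n) y z * (\<Prod>i<Suc n. \<Prod>j<Suc n. y i - z j) =
     (cauchy_det (Suc n) y z * ((\<Prod>i<n. (y i - z n) * (y n - z i)) * (y n - z n))) * (\<Prod>i<n. \<Prod>j<n. y i - z j)"
    by (simp only: mult_ac)
  also have "\<dots> = (\<Prod>i<n. (y n - y i) * (z i - z n)) * (cauchy_det n y z * (\<Prod>i<n. \<Prod>j<n. y i - z j))"
    by (subst cauchy_det_Suc) (use Suc.prems in \<open>auto simp: mult_ac\<close>)
  also have "cauchy_det n y z * (\<Prod>i<n. \<Prod>j<n. y i - z j) = (\<Prod>j<n. \<Prod>i<j. (y j - y i) * (z i - z j))"
    using Suc by simp
  finally show ?case by (simp add: mult_ac)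
qed

lemma prod_sign_pairs: "(\<Prod>j<n. \<Prod>i<j. (-1 :: 'a :: comm_ring_1)) = (-1) ^ (n * (n - 1) div 2)"
proof -
  have "(\<Prod>j<n. \<Prod>i<j. (-1 :: 'a)) = (-1) ^ (\<Sum>j<n. j)"
    by (simp add: power_sum)
  also have "(\<Sum>j<n. j) = n * (n - 1) div 2"
    by (metis Sum_Ico_nat lessThan_atLeast0 minus_nat.diff_0 mult_0 diff_zero)
  finally show ?thesis .
qed

text \<open>Negating the z flips the sign of each of the n(n-1)/2 differences z i - z j in the
  numerator of Cauchy's formula and changes nothing else there. So the Vandermonde products drop out
  when the two determinants are compared.\<close>

lemma cauchy_det_minus:
  fixes y z :: "nat \<Rightarrow> 'a :: field"
  assumes ne: "\<And>i j. i < n \<Longrightarrow> j < n \<Longrightarrow> y i \<noteq> z j" "\<And>i j. i < n \<Longrightarrow> j < n \<Longrightarrow> y i \<noteq> - z j"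
  shows "cauchy_det n y z * (\<Prod>i<n. \<Prod>j<n. y i - z j) =
    (-1) ^ (n * (n - 1) div 2) * (cauchy_det n y (\<lambda>j. - z j) * (\<Prod>i<n. \<Prod>j<n. y i + z j))"
proof -
  have "cauchy_det n y (\<lambda>j. - z j) * (\<Prod>i<n. \<Prod>j<n. y i - (- z j)) =
    (\<Prod>j<n. \<Prod>i<j. (y j - y i) * (- z i - (- z j)))"
    using ne(2) by (rule cauchy_det_formula)
  also have "\<dots> = (\<Prod>j<n. \<Prod>i<j. (-1) * ((y j - y i) * (z i - z j)))"
    by (intro prod.cong refl) (simp add: algebra_simps)
  also have "\<dots> = (-1) ^ (n * (n - 1) div 2) * (\<Prod>j<n. \<Prod>i<j. (y j - y i) * (z i - z j))"
    by (subst prod_sign_pairs[symmetric]) (simp only: prod.distrib)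
  also have "(\<Prod>j<n. \<Prod>i<j. (y j - y i) * (z i - z j)) = cauchy_det n y z * (\<Prod>i<n. \<Prod>j<n. y i - z j)"
    using ne(1) by (rule cauchy_det_formula[symmetric])
  finally show ?thesis by (simp flip: mult.assoc power_add add: mult_2[symmetric])
qed

text \<open>The border is the Cauchy row of one more node c, together with a column of ones, as for
  a z-node at infinity.\<close>

lemma cauchy_det_bordered:
  fixes y z :: "nat \<Rightarrow> 'a :: field"
  assumes ne: "\<And>i j. i < n \<Longrightarrow> j < n \<Longrightarrow> y i \<noteq> z j" and c: "\<And>j. j < n \<Longrightarrow> c \<noteq> z j"
  shows "det (mat (Suc n) (Suc n) (\<lambda>(i, j). if i < n then (if j < n then 1 / (y i - z j) else 1)
            else (if j < n then 1 / (c - z j) else 1))) =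
      (\<Prod>i<n. c - y i) / (\<Prod>j<n. c - z j) * cauchy_det n y z"
proof -
  define F where "F = (\<lambda>i j. if i < n then (if j < n then 1 / (y i - z j) else 1)
            else (if j < n then 1 / (c - z j) else 1))"
  have "det (mat (Suc n) (Suc n) (\<lambda>(i, j). F i j)) = det (mat n n (\<lambda>(i, j). F i j - F i n * F n j))"
    by (rule det_schur) (simp add: F_def)
  also have "mat n n (\<lambda>(i, j). F i j - F i n * F n j) =
    mat n n (\<lambda>(i, j). (c - y i) * (1 / (c - z j)) * (1 / (y i - z j)))"
  proof (rule eq_matI, goal_cases)
    case (1 i j)
    hence ij: "i < n" "j < n" by auto
    have "y i - z j \<noteq> 0" "c - z j \<noteq> 0" using ij ne c by auto
    hence "1 / (y i - z j) - 1 / (c - z j) = (c - y i) * (1 / (c - z j)) * (1 / (y i - z j))"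
      by (simp add: divide_simps)
    thus ?case using ij by (simp add: F_def)
  qed auto
  finally show ?thesis unfolding F_def det_scale cauchy_det_def
    by (simp add: prod_dividef)
qed

text \<open>Division by y - z leaves the Cauchy entry (z^2 - 1)/(y - z) plus the term y, which a
  multiple of the last row removes. Once z^2 - 1 is taken out of each column, the last row splits by
  partial fractions into Cauchy rows of the nodes 1 and -1. Evenness of n makes the products of -1 -
  y and of 1 + y agree.\<close>

lemma det_bordered_minus:
  fixes y z :: "nat \<Rightarrow> complex"
  assumes ne: "\<And>i j. i < n \<Longrightarrow> j < n \<Longrightarrow> y i \<noteq> z j"
    and z1: "\<And>j. j < n \<Longrightarrow> z j \<noteq> 1" "\<And>j. j < n \<Longrightarrow> z j \<noteq> -1"
    and n: "even n"
  shows "det (mat (Suc n) (Suc n) (\<lambda>(i, j). if i < n then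
            (if j < n then (y i ^ 2 - y i * z j + z j ^ 2 - 1) / (y i - z j) else 1)
            else (if j < n then -1 else 0))) =
     cauchy_det n y z * ((\<Prod>i<n. 1 - y i) * (\<Prod>j<n. 1 + z j) - (\<Prod>i<n. 1 + y i) * (\<Prod>j<n. 1 - z j)) / 2"
proof -
  define r where "r = (\<lambda>j. if j < n then -1 else 0 :: complex)"
  define F where "F = (\<lambda>i j. if j < n then (z j ^ 2 - 1) / (y i - z j) else 1)"
  define D where "D = (\<lambda>c. det (mat (Suc n) (Suc n) (\<lambda>(i, j). if i < n then (if j < n then 1 / (y i - z j) else 1)
            else (if j < n then 1 / (c - z j) else 1))))"
  have D: "D 1 = (\<Prod>i<n. 1 - y i) / (\<Prod>j<n. 1 - z j) * cauchy_det n y z"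
       "D (-1) = (\<Prod>i<n. -1 - y i) / (\<Prod>j<n. -1 - z j) * cauchy_det n y z"
    unfolding D_def by (rule cauchy_det_bordered; use ne z1 in force)+
  have sg: "(\<Prod>i<n. -1 - f i) = (\<Prod>i<n. 1 + f i)" for f :: "nat \<Rightarrow> complex"
  proof -
    have "(\<Prod>i<n. -1 - f i) = (\<Prod>i<n. (-1) * (1 + f i))" by simp
    also have "\<dots> = (\<Prod>i<n. 1 + f i)" using n by (simp only: prod.distrib) simp
    finally show ?thesis .
  qed
  \<comment> \<open>The partial fractions of 1/(1 - z^2). The weights 1/2 and -1/2 add up to 0,
    which reproduces the corner entry as well.\<close>
  define Q where "Q = (\<lambda>j. (1/2) * (if j < n then 1 / (1 - z j) else 1) + (-1/2) * (if j < n then 1 / (-1 - z j) else 1))"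
  have rQ: "(1/2) * (if j < n then 1 / (1 - z j) else 1) + (-1/2) * (if j < n then 1 / (-1 - z j) else 1) = Q j" for j
    unfolding Q_def ..
  have Q: "Q j = 0" if "\<not> j < n" for j
    unfolding Q_def using that by simp
  have Q': "(z j ^ 2 - 1) * Q j = -1" if "j < n" for j
  proof -
    have nz: "1 - z j \<noteq> 0" "-1 - z j \<noteq> 0" using z1[OF that] by (auto simp: algebra_simps)
    have f: "z j ^ 2 - 1 = (1 - z j) * (-1 - z j)" by (simp add: algebra_simps power2_eq_square)
    have "a * b * ((1/2) * (1 / a) + (-1/2) * (1 / b)) = (1/2) * b - (1/2) * a"
      if "a \<noteq> 0" "b \<noteq> 0" for a b :: complex using that by (simp add: field_simps)
    from this[OF nz] have "(1 - z j) * (-1 - z j) * Q j = (1/2) * (-1 - z j) - (1/2) * (1 - z j)"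
      unfolding Q_def using that by (simp only: if_True)
    also have "\<dots> = -1" by (simp add: field_simps)
    finally show ?thesis unfolding f .
  qed
  have "mat (Suc n) (Suc n) (\<lambda>(i, j). if i < n then
            (if j < n then (y i ^ 2 - y i * z j + z j ^ 2 - 1) / (y i - z j) else 1)
            else (if j < n then -1 else 0)) =
      mat (Suc n) (Suc n) (\<lambda>(i, j). if i < n then F i j + (- y i) * r j else r j)" (is "?M = _")
  proof (rule eq_matI, goal_cases)
    case (1 i j)
    have "(y i ^ 2 - y i * z j + z j ^ 2 - 1) / (y i - z j) = (z j ^ 2 - 1) / (y i - z j) + y i"
      if "i < n" "j < n"
      using ne[OF that] by (simp add: field_simps power2_eq_square)
    thus ?case using 1 by (auto simp: F_def r_def)
  qed auto
  hence "det ?M = det (mat (Suc n) (Suc n) (\<lambda>(i, j). if i < n then F i j else r j))"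
    by (simp only: det_add_last_row)
  also have "mat (Suc n) (Suc n) (\<lambda>(i, j). if i < n then F i j else r j) =
     mat (Suc n) (Suc n) (\<lambda>(i, j). 1 * (if j < n then z j ^ 2 - 1 else 1) *
        (if i < n then (if j < n then 1 / (y i - z j) else 1)
            else (1/2) * (if j < n then 1 / (1 - z j) else 1) + (-1/2) * (if j < n then 1 / (-1 - z j) else 1)))"
  proof (rule eq_matI, goal_cases)
    case (1 i j)
    show ?case unfolding rQ using 1 Q Q' by (auto simp: F_def r_def less_Suc_eq)
  qed auto
  also have "det \<dots> = (\<Prod>j<Suc n. if j < n then z j ^ 2 - 1 else 1) * ((1/2) * D 1 + (-1/2) * D (-1))"
    unfolding det_scale det_last_row_linear D_def by simp
  also have "(\<Prod>j<Suc n. if j < n then z j ^ 2 - 1 else 1) = (\<Prod>j<n. 1 - z j) * (\<Prod>j<n. -1 - z j)"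
    by (simp add: prod.distrib[symmetric] power2_eq_square algebra_simps)
  finally have e: "det ?M = (\<Prod>j<n. 1 - z j) * (\<Prod>j<n. -1 - z j) * ((1/2) * D 1 + (-1/2) * D (-1))" .
  have q: "(\<Prod>j<n. 1 - z j) \<noteq> 0" "(\<Prod>j<n. 1 + z j) \<noteq> 0" using z1 by (auto simp: add_eq_0_iff)
  have fin: "Q1 * Q2 * ((1/2) * (P1 / Q1 * c) + (-1/2) * (P2 / Q2 * c)) = c * (P1 * Q2 - P2 * Q1) / 2"
    if "Q1 \<noteq> 0" "Q2 \<noteq> 0" for Q1 Q2 P1 P2 c :: complex using that by (simp add: field_simps)
  show ?thesis unfolding e D sg by (rule fin[OF q])
qed

text \<open>The border entries 1 - y and 1 - z are such that the Schur complement of the corner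
  collapses to (1 - y)(1 - z)/(y + z), a scaled Cauchy matrix with nodes -z.\<close>

lemma det_bordered_plus:
  fixes y z :: "nat \<Rightarrow> complex"
  assumes ne: "\<And>i j. i < n \<Longrightarrow> j < n \<Longrightarrow> y i \<noteq> - z j"
  shows "det (mat (Suc n) (Suc n) (\<lambda>(i, j). if i < n then
            (if j < n then y i * z j - (y i ^ 2 + y i * z j + z j ^ 2 - 1) / (y i + z j) else 1 - y i)
            else (if j < n then 1 - z j else 1))) =
     (\<Prod>i<n. 1 - y i) * (\<Prod>j<n. 1 - z j) * cauchy_det n y (\<lambda>j. - z j)"
proof -
  define F where "F = (\<lambda>i j. if i < n then
            (if j < n then y i * z j - (y i ^ 2 + y i * z j + z j ^ 2 - 1) / (y i + z j) else 1 - y i)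
            else (if j < n then 1 - z j else 1))"
  have "det (mat (Suc n) (Suc n) (\<lambda>(i, j). F i j)) = det (mat n n (\<lambda>(i, j). F i j - F i n * F n j))"
    by (rule det_schur) (simp add: F_def)
  also have "mat n n (\<lambda>(i, j). F i j - F i n * F n j) =
    mat n n (\<lambda>(i, j). (1 - y i) * (1 - z j) * (1 / (y i - (- z j))))"
  proof (rule eq_matI, goal_cases)
    case (1 i j)
    hence ij: "i < n" "j < n" by auto
    have "y i + z j \<noteq> 0" using ne[OF ij] by (simp add: add_eq_0_iff2)
    hence "y i * z j - (y i ^ 2 + y i * z j + z j ^ 2 - 1) / (y i + z j) - (1 - y i) * (1 - z j)
       = (1 - y i) * (1 - z j) * (1 / (y i + z j))"
      by (simp add: divide_simps) (simp add: algebra_simps power2_eq_square)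
    thus ?case using ij by (simp add: F_def)
  qed auto
  finally show ?thesis unfolding F_def det_scale cauchy_det_def .
qed

section \<open>The value of the L-series at 1\<close>

text \<open>Summation by parts: the decrements of f telescope, so the total is at most B f(N) + B
  f(M) + B (f(M) - f(N)).\<close>

lemma abel_summation_bound:
  fixes a f :: "nat \<Rightarrow> real"
  assumes A: "\<And>N. \<bar>\<Sum>k<N. a k\<bar> \<le> B"
    and dec: "\<And>k. M \<le> k \<Longrightarrow> f (Suc k) \<le> f k" and nonneg: "\<And>k. M \<le> k \<Longrightarrow> 0 \<le> f k"
  shows "\<bar>\<Sum>k\<in>{M..<N}. a k * f k\<bar> \<le> 2 * B * f M"
proof (cases "M \<le> N")
  case True
  define S where "S = (\<lambda>N. \<Sum>k<N. a k)"
  have B: "B \<ge> 0" using A[of 0] by simp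
  have "(\<Sum>k\<in>{M..<N}. a k * f k) = S N * f N - S M * f M + (\<Sum>k\<in>{M..<N}. S (Suc k) * (f k - f (Suc k)))"
    using True by (induction N rule: dec_induct) (auto simp: S_def algebra_simps)
  hence "\<bar>\<Sum>k\<in>{M..<N}. a k * f k\<bar> \<le> \<bar>S N * f N\<bar> + \<bar>S M * f M\<bar> + \<bar>\<Sum>k\<in>{M..<N}. S (Suc k) * (f k - f (Suc k))\<bar>" by linarith
  moreover have "\<bar>\<Sum>k\<in>{M..<N}. S (Suc k) * (f k - f (Suc k))\<bar> \<le> (\<Sum>k\<in>{M..<N}. B * (f k - f (Suc k)))"
  proof (rule order_trans[OF sum_abs sum_mono])
    fix k assume "k \<in> {M..<N}"
    hence "\<bar>f k - f (Suc k)\<bar> = f k - f (Suc k)" using dec[of k] by auto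
    thus "\<bar>S (Suc k) * (f k - f (Suc k))\<bar> \<le> B * (f k - f (Suc k))"
      unfolding abs_mult using A[of "Suc k"] dec[of k] \<open>k \<in> {M..<N}\<close> B unfolding S_def
      by (intro mult_mono) auto
  qed
  moreover have "(\<Sum>k\<in>{M..<N}. B * (f k - f (Suc k))) = B * (f M - f N)"
    using True by (induction N rule: dec_induct) (auto simp: algebra_simps)
  moreover have "\<bar>S N * f N\<bar> \<le> B * f N" "\<bar>S M * f M\<bar> \<le> B * f M"
    using A nonneg True B unfolding abs_mult S_def by (auto intro!: mult_mono)
  ultimately show ?thesis by (simp add: algebra_simps)
next
  case False
  thus ?thesis using A[of 0] nonneg[of M] by simp
qed

lemma summable_uniform_tail:
  fixes f :: "nat \<Rightarrow> real"
  assumes "\<And>D N. D \<ge> 1 \<Longrightarrow> \<bar>\<Sum>d\<in>{D..<N}. f d\<bar> \<le> C / real D"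
  shows "summable f" "\<And>D. D \<ge> 1 \<Longrightarrow> \<bar>suminf f - (\<Sum>d<D. f d)\<bar> \<le> C / real D"
proof -
  show s: "summable f"
    unfolding summable_Cauchy
  proof (intro allI impI)
    fix e :: real assume e: "e > 0"
    obtain N :: nat where N: "real N > \<bar>C\<bar> / e" using reals_Archimedean2 by blast
    have N0: "N > 0" using N e by (intro gr0I) (auto simp: field_simps)
    have "norm (sum f {m..<n}) < e" if "m \<ge> N" for m n
    proof -
      have "norm (sum f {m..<n}) \<le> C / real m" using assms[of m n] that N0 by simp
      also have "\<dots> \<le> \<bar>C\<bar> / real N" using that N0 by (intro frac_le) auto
      also have "\<dots> < e" using N e N0 by (simp add: field_simps)
      finally show ?thesis .
    qed
    thus "\<exists>N. \<forall>m\<ge>N. \<forall>n. norm (sum f {m..<n}) < e" by blast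
  qed
  fix D :: nat assume D: "D \<ge> 1"
  have "(\<lambda>N. \<bar>(\<Sum>d<N. f d) - (\<Sum>d<D. f d)\<bar>) \<longlonglongrightarrow> \<bar>suminf f - (\<Sum>d<D. f d)\<bar>"
    using summable_LIMSEQ[OF s] by (intro tendsto_intros)
  moreover have "\<bar>(\<Sum>d<N. f d) - (\<Sum>d<D. f d)\<bar> \<le> C / real D" if "N \<ge> D" for N
  proof -
    have "(\<Sum>d<N. f d) - (\<Sum>d<D. f d) = (\<Sum>d\<in>{D..<N}. f d)"
      using that sum.atLeastLessThan_concat[of 0 D N f] by (simp add: lessThan_atLeast0)
    thus ?thesis using assms[OF D, of N] by simp
  qed
  ultimately show "\<bar>suminf f - (\<Sum>d<D. f d)\<bar> \<le> C / real D"
    by (intro LIMSEQ_le_const2) auto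
qed

text \<open>A substitute for dominated convergence when the limit series converges only
  conditionally: the tails from D on are at most C/D for all nearby parameters, and the finitely
  many remaining terms converge one by one.\<close>

lemma tendsto_suminf_uniform_tail:
  fixes f :: "nat \<Rightarrow> real" and g :: "'b \<Rightarrow> nat \<Rightarrow> real"
  assumes lim: "\<And>d. ((\<lambda>x. g x d) \<longlongrightarrow> f d) F"
    and tailf: "\<And>D N. D \<ge> 1 \<Longrightarrow> \<bar>\<Sum>d\<in>{D..<N}. f d\<bar> \<le> C / real D"
    and tailg: "eventually (\<lambda>x. \<forall>D N. D \<ge> 1 \<longrightarrow> \<bar>\<Sum>d\<in>{D..<N}. g x d\<bar> \<le> C / real D) F"
  shows "((\<lambda>x. suminf (g x)) \<longlongrightarrow> suminf f) F"
proof (rule tendstoI)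
  fix e :: real assume e: "e > 0"
  obtain D :: nat where D: "real D > 3 * \<bar>C\<bar> / e" using reals_Archimedean2 by blast
  have D0: "D \<ge> 1" using D e by (cases D) (auto simp: field_simps)
  have "C / real D \<le> \<bar>C\<bar> / real D" by (intro divide_right_mono) auto
  also have CD: "\<bar>C\<bar> / real D < e / 3" using D D0 e by (simp add: field_simps)
  finally have CD: "C / real D < e / 3" .
  have "((\<lambda>x. \<Sum>d<D. g x d) \<longlongrightarrow> (\<Sum>d<D. f d)) F" by (intro tendsto_sum lim)
  hence "eventually (\<lambda>x. dist (\<Sum>d<D. g x d) (\<Sum>d<D. f d) < e / 3) F"
    using e by (intro tendstoD) auto
  thus "eventually (\<lambda>x. dist (suminf (g x)) (suminf f) < e) F"
    using tailg
  proof eventually_elim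
    case (elim x)
    have "\<bar>suminf (g x) - (\<Sum>d<D. g x d)\<bar> \<le> C / real D"
      using elim D0 by (intro summable_uniform_tail(2)) auto
    moreover have "\<bar>suminf f - (\<Sum>d<D. f d)\<bar> \<le> C / real D"
      using tailf D0 by (intro summable_uniform_tail(2)) auto
    ultimately show ?case using elim CD unfolding dist_real_def by linarith
  qed
qed

lemma nat_div_bounds:
  assumes "d > 0"
  shows "real x / real d - 1 \<le> real (x div d)" "real (x div d) \<le> real x / real d"
proof -
  have "real x = real (d * (x div d) + x mod d)" by simp
  hence e: "real x = real d * real (x div d) + real (x mod d)" by (simp only: of_nat_add of_nat_mult)
  have m: "real (x mod d) \<le> real d" "0 \<le> real (x mod d)" using assms by (simp_all add: less_imp_le)
  show "real x / real d - 1 \<le> real (x div d)" "real (x div d) \<le> real x / real d"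
    using e m assms by (simp_all add: field_simps)
qed

section \<open>The value L(1, \<chi>) as a limit in two ways\<close>

context prime_1_mod_4
begin

lemma chi_periodic: "chi (int (k + p)) = chi (int k)"
  by (rule chi_cong) (simp add: cong_iff_mod_eq)

lemma chi_partial_sums: "\<bar>\<Sum>k<N. real_of_int (chi (int k))\<bar> \<le> real p"
proof -
  have z: "(\<Sum>k<p. chi (int k)) = 0"
  proof -
    have "(\<Sum>k<p. chi (int k)) = (\<Sum>k\<in>{0..<int p}. chi k)"
      by (rule sum.reindex_bij_witness[of _ nat int]) auto
    thus ?thesis using sum_chi by simp
  qed
  have "\<bar>\<Sum>k<N. chi (int k)\<bar> \<le> int p"
  proof (induction N rule: less_induct)
    case (less N)
    show ?case
    proof (cases "N < p")
      case True
      have "\<bar>\<Sum>k<N. chi (int k)\<bar> \<le> (\<Sum>k<N. 1)" by (rule order_trans[OF sum_abs sum_mono]) (rule chi_abs_le)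
      thus ?thesis using True by simp
    next
      case False
      have "(\<Sum>k<N. chi (int k)) = (\<Sum>k<p. chi (int k)) + (\<Sum>k\<in>{p..<N}. chi (int k))"
        using False sum.atLeastLessThan_concat[of 0 p N "\<lambda>k. chi (int k)"] by (simp add: lessThan_atLeast0)
      also have "(\<Sum>k\<in>{p..<N}. chi (int k)) = (\<Sum>k<N - p. chi (int (k + p)))"
        using False by (intro sum.reindex_bij_witness[of _ "\<lambda>k. k + p" "\<lambda>k. k - p"]) auto
      also have "\<dots> = (\<Sum>k<N - p. chi (int k))" by (simp only: chi_periodic)
      finally show ?thesis using z less[of "N - p"] False p_ge_5 by simp
    qed
  qed
  thus ?thesis by (metis of_int_abs of_int_le_iff of_int_of_nat_eq of_int_sum)
qed

text \<open>The value L(1, \<chi>). The term at d = 0 is 0 because \<open>chi 0 = 0\<close>.\<close>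

definition L1 :: real where "L1 = (\<Sum>d. of_int (chi (int d)) * (1 / real d))"

lemma chi_tail:
  assumes "\<And>k. D \<le> k \<Longrightarrow> f (Suc k) \<le> f k" "\<And>k. D \<le> k \<Longrightarrow> 0 \<le> f k" "f D \<le> 1 / real D"
  shows "\<bar>\<Sum>d\<in>{D..<N}. of_int (chi (int d)) * f d\<bar> \<le> 2 * real p / real D"
proof -
  have "\<bar>\<Sum>d\<in>{D..<N}. of_int (chi (int d)) * f d\<bar> \<le> 2 * real p * f D"
    using assms by (intro abel_summation_bound chi_partial_sums) auto
  also have "\<dots> \<le> 2 * real p * (1 / real D)" using assms(3) by (intro mult_left_mono) auto
  finally show ?thesis by simp
qed

lemma L1_tail: "D \<ge> 1 \<Longrightarrow> \<bar>\<Sum>d\<in>{D..<N}. of_int (chi (int d)) * (1 / real d)\<bar> \<le> 2 * real p / real D"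
  by (rule chi_tail) (auto simp: field_simps)

text \<open>For fixed x the weights (x div d)/x decrease in d and are at most 1/d, so partial
  summation bounds the tails uniformly in x. They vanish for d > x, which turns the finite sum into
  a series.\<close>

lemma chi_floor_asymp:
  "(\<lambda>x. (\<Sum>d = 1..x. of_int (chi (int d)) * real (x div d)) / real x) \<longlonglongrightarrow> L1"
proof -
  have "(\<lambda>x. \<Sum>d. of_int (chi (int d)) * (real (x div d) / real x)) \<longlonglongrightarrow> L1"
    unfolding L1_def
  proof (rule tendsto_suminf_uniform_tail[where C = "2 * real p"])
    fix d :: nat
    show "(\<lambda>x. of_int (chi (int d)) * (real (x div d) / real x)) \<longlonglongrightarrow> of_int (chi (int d)) * (1 / real d)"
    proof (cases "d = 0")
      case False
      have "(\<lambda>x. real (x div d) / real x) \<longlonglongrightarrow> 1 / real d"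
      proof (rule tendsto_sandwich)
        have b: "real x / real d - 1 \<le> real (x div d)" "real (x div d) \<le> real x / real d" for x
          using nat_div_bounds[of d x] False by auto
        show "\<forall>\<^sub>F x in sequentially. 1 / real d - 1 / real x \<le> real (x div d) / real x"
          using eventually_gt_at_top[of 0]
        proof eventually_elim
          case (elim x)
          have "1 / real d - 1 / real x = (real x / real d - 1) / real x" using elim by (simp add: field_simps)
          also have "\<dots> \<le> real (x div d) / real x" by (intro divide_right_mono b) auto
          finally show ?case .
        qed
        show "\<forall>\<^sub>F x in sequentially. real (x div d) / real x \<le> 1 / real d"
          using eventually_gt_at_top[of 0]
        proof eventually_elim
          case (elim x)
          have "real (x div d) / real x \<le> (real x / real d) / real x" by (intro divide_right_mono b) auto
          thus ?case using elim by simp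
        qed
        show "(\<lambda>x. 1 / real d - 1 / real x) \<longlonglongrightarrow> 1 / real d"
          using tendsto_diff[OF tendsto_const lim_1_over_n, of "1 / real d"] by simp
      qed simp
      thus ?thesis by (rule tendsto_mult_left)
    qed simp
  next
    show "\<forall>\<^sub>F x in sequentially. \<forall>D N. 1 \<le> D \<longrightarrow>
      \<bar>\<Sum>d\<in>{D..<N}. of_int (chi (int d)) * (real (x div d) / real x)\<bar> \<le> 2 * real p / real D"
      using eventually_gt_at_top[of 0]
    proof eventually_elim
      case (elim x)
      show ?case
      proof (intro allI impI chi_tail)
        fix D k :: nat assume "1 \<le> D" "D \<le> k"
        thus "real (x div Suc k) / real x \<le> real (x div k) / real x"
          by (intro divide_right_mono) (auto simp: div_le_mono2)
      next
        fix D :: nat assume "1 \<le> D"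
        hence "real (x div D) \<le> real x / real D" using nat_div_bounds[of D x] by auto
        hence "real (x div D) / real x \<le> (real x / real D) / real x" by (intro divide_right_mono) auto
        thus "real (x div D) / real x \<le> 1 / real D" using elim by simp
      qed auto
    qed
  qed (rule L1_tail)
  moreover have "(\<Sum>d. of_int (chi (int d)) * (real (x div d) / real x)) =
     (\<Sum>d = 1..x. of_int (chi (int d)) * real (x div d)) / real x" for x
  proof -
    have "(\<Sum>d. of_int (chi (int d)) * (real (x div d) / real x)) =
      (\<Sum>d\<in>{1..x}. of_int (chi (int d)) * (real (x div d) / real x))"
      by (rule suminf_finite) (auto simp: not_le)
    thus ?thesis by (simp add: sum_divide_distrib)
  qed
  ultimately show ?thesis by simp
qed

text \<open>Abel's limit theorem for this series: t^d/d also decreases in d and is at most 1/d,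
  uniformly for t in (0, 1).\<close>

lemma L1_abel: "((\<lambda>t. \<Sum>d. of_int (chi (int d)) * (t ^ d / real d)) \<longlongrightarrow> L1) (at_left (1::real))"
  unfolding L1_def
proof (rule tendsto_suminf_uniform_tail[where C = "2 * real p"])
  fix d :: nat
  have "((\<lambda>t. of_int (chi (int d)) * (t ^ d / real d)) \<longlongrightarrow> of_int (chi (int d)) * (1 ^ d / real d)) (at_left (1::real))"
  proof (cases "d = 0")
    case False
    show ?thesis
      by (rule tendsto_mult[OF tendsto_const tendsto_divide[OF tendsto_power[OF tendsto_ident_at] tendsto_const]])
         (use False in simp)
  qed simp
  thus "((\<lambda>t. of_int (chi (int d)) * (t ^ d / real d)) \<longlongrightarrow> of_int (chi (int d)) * (1 / real d)) (at_left (1::real))"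
    by simp
next
  have "\<forall>\<^sub>F t in at_left (1::real). t \<in> {0<..<1}" by (rule eventually_at_leftI[of 0]) auto
  thus "\<forall>\<^sub>F t in at_left (1::real). \<forall>D N. 1 \<le> D \<longrightarrow>
      \<bar>\<Sum>d\<in>{D..<N}. of_int (chi (int d)) * (t ^ d / real d)\<bar> \<le> 2 * real p / real D"
  proof eventually_elim
    case (elim t)
    show ?case
    proof (intro allI impI chi_tail)
      fix D k :: nat assume "1 \<le> D" "D \<le> k"
      thus "t ^ Suc k / real (Suc k) \<le> t ^ k / real k"
        using elim by (intro frac_le power_decreasing) auto
    next
      fix D :: nat assume "1 \<le> D"
      thus "t ^ D / real D \<le> 1 / real D"
        using elim by (intro divide_right_mono power_le_one) auto
    qed (use elim in auto)
  qed
qed (rule L1_tail)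

text \<open>For 0 < t < 1 the Gauss sum replaces sqrt p \<chi>(d) by the sum of \<chi>(k)
  \<zeta>^(kd), and summing over d gives logarithms of 1 - t \<zeta>^k. Only real parts are
  compared, so no argument of a logarithm has to be determined. Letting t tend to 1 avoids the
  logarithm series on the unit circle.\<close>

lemma L1_eq_sum_ln:
  assumes root: "\<zeta> ^ p = 1" "\<zeta> \<noteq> 1" and gs: "gauss \<zeta> = of_real (sqrt (real p))"
  shows "sqrt (real p) * L1 = (\<Sum>k\<in>Non. ln (norm (1 - \<zeta> powi k))) - (\<Sum>k\<in>Res. ln (norm (1 - \<zeta> powi k)))"
proof -
  let ?S = "{0..<int p}"
  have nz: "norm (\<zeta> powi k) = 1" for k
    using norm_root[OF root] by (simp add: norm_power_int)
  have ne1: "1 - of_real t * \<zeta> powi k \<noteq> 0" if "\<bar>t\<bar> < 1" for t :: real and k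
  proof
    assume "1 - of_real t * \<zeta> powi k = 0"
    hence "norm (of_real t * \<zeta> powi k) = 1" by simp
    thus False using that nz by (simp add: norm_mult)
  qed
  have ser: "sqrt (real p) * (\<Sum>d. of_int (chi (int d)) * (t ^ d / real d)) =
     - (\<Sum>k\<in>?S. of_int (chi k) * ln (norm (1 - of_real t * \<zeta> powi k)))" if t: "0 < t" "t < 1" for t :: real
  proof -
    have "(\<lambda>d. (of_real t * \<zeta> powi k) ^ d / of_nat d) sums (- Ln (1 - of_real t * \<zeta> powi k))" for k
    proof -
      have "cmod (- (of_real t * \<zeta> powi k)) < 1" using nz t by (simp add: norm_mult)
      from sums_minus[OF Ln_series'[OF this]] show ?thesis by simp
    qed
    hence "(\<lambda>d. \<Sum>k\<in>?S. of_int (chi k) * ((of_real t * \<zeta> powi k) ^ d / of_nat d)) sums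
       (\<Sum>k\<in>?S. of_int (chi k) * (- Ln (1 - of_real t * \<zeta> powi k)))"
      by (intro sums_sum sums_mult)
    also have "(\<lambda>d. \<Sum>k\<in>?S. of_int (chi k) * ((of_real t * \<zeta> powi k) ^ d / of_nat d)) =
      (\<lambda>d. of_real (sqrt (real p) * (of_int (chi (int d)) * (t ^ d / real d))))"
    proof
      fix d
      have "(\<Sum>k\<in>?S. of_int (chi k) * ((of_real t * \<zeta> powi k) ^ d / of_nat d)) =
        (\<Sum>k\<in>?S. of_int (chi k) * \<zeta> powi (k * int d)) * (of_real t ^ d / of_nat d)"
        unfolding sum_distrib_right
        by (rule sum.cong[OF refl]) (simp add: power_mult_distrib power_int_mult mult_ac)
      thus "(\<Sum>k\<in>?S. of_int (chi k) * ((of_real t * \<zeta> powi k) ^ d / of_nat d)) =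
        of_real (sqrt (real p) * (of_int (chi (int d)) * (t ^ d / real d)))"
        unfolding gauss_twist[OF root] gs by simp
    qed
    finally have "(\<lambda>d. Re (of_real (sqrt (real p) * (of_int (chi (int d)) * (t ^ d / real d))))) sums
       Re (\<Sum>k\<in>?S. of_int (chi k) * (- Ln (1 - of_real t * \<zeta> powi k)))"
      by (rule sums_Re)
    hence s1: "(\<lambda>d. sqrt (real p) * (of_int (chi (int d)) * (t ^ d / real d))) sums
       (- (\<Sum>k\<in>?S. of_int (chi k) * ln (norm (1 - of_real t * \<zeta> powi k))))"
      using ne1[of t] t by (simp add: sum_negf)
    have s2: "summable (\<lambda>d. of_int (chi (int d)) * (t ^ d / real d))"
      by (rule summable_mult_D[OF sums_summable[OF s1]]) (use p_ge_5 in simp)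
    show ?thesis
      by (rule trans[OF suminf_mult[OF s2, symmetric] sums_unique[OF s1, symmetric]])
  qed
  have "((\<lambda>t. sqrt (real p) * (\<Sum>d. of_int (chi (int d)) * (t ^ d / real d))) \<longlongrightarrow> sqrt (real p) * L1) (at_left (1::real))"
    by (intro tendsto_intros L1_abel)
  moreover have "((\<lambda>t. sqrt (real p) * (\<Sum>d. of_int (chi (int d)) * (t ^ d / real d))) \<longlongrightarrow>
     - (\<Sum>k\<in>?S. of_int (chi k) * ln (norm (1 - of_real 1 * \<zeta> powi k)))) (at_left (1::real))"
  proof (rule Lim_transform_eventually)
    have "\<forall>\<^sub>F t in at_left (1::real). t \<in> {0<..<1}" by (rule eventually_at_leftI[of 0]) auto
    thus "\<forall>\<^sub>F t in at_left (1::real). - (\<Sum>k\<in>?S. of_int (chi k) * ln (norm (1 - of_real t * \<zeta> powi k))) = 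
       sqrt (real p) * (\<Sum>d. of_int (chi (int d)) * (t ^ d / real d))"
      by eventually_elim (use ser in auto)
    show "((\<lambda>t. - (\<Sum>k\<in>?S. of_int (chi k) * ln (norm (1 - of_real t * \<zeta> powi k)))) \<longlongrightarrow>
     - (\<Sum>k\<in>?S. of_int (chi k) * ln (norm (1 - of_real 1 * \<zeta> powi k)))) (at_left (1::real))"
    proof (intro tendsto_minus tendsto_sum)
      fix k assume k: "k \<in> ?S"
      show "((\<lambda>t. of_int (chi k) * ln (norm (1 - of_real t * \<zeta> powi k))) \<longlongrightarrow>
         of_int (chi k) * ln (norm (1 - of_real 1 * \<zeta> powi k))) (at_left (1::real))"
      \<comment> \<open>The only singular term, k = 0, has weight 0.\<close>
      proof (cases "chi k = 0")
        case False
        hence "\<zeta> powi k \<noteq> 1" using powi_eq_1_iff[OF root] chi_eq_0_iff by simp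
        thus ?thesis by (intro tendsto_intros) auto
      qed simp
    qed
  qed
  ultimately have "sqrt (real p) * L1 = - (\<Sum>k\<in>?S. of_int (chi k) * ln (norm (1 - of_real 1 * \<zeta> powi k)))"
    by (rule tendsto_unique[rotated]) simp
  also have "\<dots> = (\<Sum>k\<in>Non. ln (norm (1 - \<zeta> powi k))) - (\<Sum>k\<in>Res. ln (norm (1 - \<zeta> powi k)))"
  proof -
    have "(\<Sum>k\<in>Res. of_int (chi k) * ln (norm (1 - \<zeta> powi k))) = (\<Sum>k\<in>Res. ln (norm (1 - \<zeta> powi k)))"
      by (rule sum.cong) (auto simp: Res_def)
    moreover have "(\<Sum>k\<in>Non. of_int (chi k) * ln (norm (1 - \<zeta> powi k))) = - (\<Sum>k\<in>Non. ln (norm (1 - \<zeta> powi k)))"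
      unfolding sum_negf[symmetric] by (rule sum.cong) (auto simp: Non_def)
    ultimately show ?thesis unfolding sum_residues_split by simp
  qed
  finally show ?thesis .
qed

end

section \<open>Lattice points in hyperbolic strips\<close>

lemma hyperbolic_strip_area:
  fixes A B c :: real
  assumes "0 < A" "A \<le> B" "0 \<le> c"
  shows "(\<integral>\<^sup>+ X. \<integral>\<^sup>+ Y. indicator {(X, Y). A \<le> X \<and> X \<le> B \<and> \<bar>X * Y\<bar> \<le> c} (X, Y) \<partial>lborel \<partial>lborel) =
    ennreal (2 * c * ln (B / A))"
proof -
  have "(\<integral>\<^sup>+ Y. indicator {(X, Y). A \<le> X \<and> X \<le> B \<and> \<bar>X * Y\<bar> \<le> c} (X, Y) \<partial>lborel) =
     ennreal (2 * c / X) * indicator {A..B} X" for X :: real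
  proof (cases "X \<in> {A..B}")
    case True
    hence X: "X > 0" using assms by auto
    have "indicator {(X, Y). A \<le> X \<and> X \<le> B \<and> \<bar>X * Y\<bar> \<le> c} (X, Y) = (indicator {- (c / X)..c / X} Y :: ennreal)" for Y
    proof -
      have "\<bar>X * Y\<bar> \<le> c \<longleftrightarrow> \<bar>Y\<bar> \<le> c / X"
        using X by (simp add: abs_mult pos_le_divide_eq mult.commute)
      thus ?thesis using True by (auto simp: indicator_def abs_le_iff)
    qed
    hence "(\<integral>\<^sup>+ Y. indicator {(X, Y). A \<le> X \<and> X \<le> B \<and> \<bar>X * Y\<bar> \<le> c} (X, Y) \<partial>lborel) =
       emeasure lborel {- (c / X)..c / X}" by simp
    also have "\<dots> = ennreal (2 * c / X)"
      using X assms by (subst emeasure_lborel_Icc) (auto simp: field_simps)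
    finally show ?thesis using True by simp
  next
    case False
    thus ?thesis by (auto simp: indicator_def)
  qed
  hence "(\<integral>\<^sup>+ X. \<integral>\<^sup>+ Y. indicator {(X, Y). A \<le> X \<and> X \<le> B \<and> \<bar>X * Y\<bar> \<le> c} (X, Y) \<partial>lborel \<partial>lborel) =
     (\<integral>\<^sup>+ X \<in> {A..B}. ennreal (2 * c / X) \<partial>lborel)" by simp
  also have "\<dots> = ennreal (2 * c * ln B - 2 * c * ln A)"
    by (rule nn_integral_FTC_Icc) (use assms in \<open>auto intro!: derivative_eq_intros\<close>)
  also have "2 * c * ln B - 2 * c * ln A = 2 * c * ln (B / A)"
    using assms by (simp add: ln_div algebra_simps)
  finally show ?thesis .
qed

text \<open>The points are pairs (v, u) in this order, so that the inner integral runs over u, whose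
  coefficient is the same in both linear forms; the forms differ by a multiple of v alone.\<close>

definition strip :: "real \<Rightarrow> real \<Rightarrow> real \<Rightarrow> real \<Rightarrow> real \<Rightarrow> real \<Rightarrow> (real \<times> real) set" where
  "strip \<alpha> \<beta> \<gamma> A B c = {(v, u). A \<le> \<alpha> * u + \<beta> * v \<and> \<alpha> * u + \<beta> * v \<le> B \<and>
     \<bar>(\<alpha> * u + \<beta> * v) * (\<alpha> * u + \<gamma> * v)\<bar> \<le> c}"

lemma strip_measurable [measurable]: "strip \<alpha> \<beta> \<gamma> A B c \<in> sets (lborel \<Otimes>\<^sub>M lborel)"
proof -
  have "strip \<alpha> \<beta> \<gamma> A B c = {w \<in> space (lborel \<Otimes>\<^sub>M lborel). A \<le> \<alpha> * snd w + \<beta> * fst w \<and> \<alpha> * snd w + \<beta> * fst w \<le> B \<and>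
     \<bar>(\<alpha> * snd w + \<beta> * fst w) * (\<alpha> * snd w + \<gamma> * fst w)\<bar> \<le> c}"
    unfolding strip_def by (auto simp: space_pair_measure)
  also have "\<dots> \<in> sets (lborel \<Otimes>\<^sub>M lborel)" by measurable
  finally show ?thesis .
qed

text \<open>Two affine substitutions, X = \<alpha> u + \<beta> v for fixed v and then Y = X +
  (\<gamma> - \<beta>) v for fixed X, reduce to the hyperbolic region between A and B. Their factors
  multiply to the determinant \<alpha> (\<gamma> - \<beta>) of the two forms.\<close>

lemma strip_area:
  fixes \<alpha> \<beta> \<gamma> A B c :: real
  assumes "0 < A" "A \<le> B" "0 \<le> c" "0 < \<alpha>" "\<beta> < \<gamma>"
  shows "emeasure (lborel \<Otimes>\<^sub>M lborel) (strip \<alpha> \<beta> \<gamma> A B c) =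
    ennreal (2 * c * ln (B / A) / (\<alpha> * (\<gamma> - \<beta>)))"
proof -
  let ?D = "{(X, Y). A \<le> X \<and> X \<le> B \<and> \<bar>X * Y\<bar> \<le> c}"
  have D [measurable]: "?D \<in> sets (borel \<Otimes>\<^sub>M borel)"
  proof -
    have "?D = {w \<in> space (borel \<Otimes>\<^sub>M borel). A \<le> fst w \<and> fst w \<le> B \<and> \<bar>fst w * snd w\<bar> \<le> c}"
      by (auto simp: space_pair_measure)
    also have "\<dots> \<in> sets (borel \<Otimes>\<^sub>M borel)" by measurable
    finally show ?thesis .
  qed
  have "emeasure (lborel \<Otimes>\<^sub>M lborel) (strip \<alpha> \<beta> \<gamma> A B c) =
     (\<integral>\<^sup>+ v. \<integral>\<^sup>+ u. indicator (strip \<alpha> \<beta> \<gamma> A B c) (v, u) \<partial>lborel \<partial>lborel)"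
    by (rule lborel.emeasure_pair_measure) (rule strip_measurable)
  also have "\<dots> = (\<integral>\<^sup>+ v. ennreal (1 / \<alpha>) * (\<integral>\<^sup>+ X. indicator ?D (X, X + (\<gamma> - \<beta>) * v) \<partial>lborel) \<partial>lborel)"
  proof (rule nn_integral_cong)
    fix v :: real
    have "(\<integral>\<^sup>+ X. indicator ?D (X, X + (\<gamma> - \<beta>) * v) \<partial>lborel) =
      ennreal \<bar>\<alpha>\<bar> * (\<integral>\<^sup>+ u. indicator ?D (\<beta> * v + \<alpha> * u, (\<beta> * v + \<alpha> * u) + (\<gamma> - \<beta>) * v) \<partial>lborel)"
      by (rule nn_integral_real_affine) (use assms in auto)
    also have "(\<lambda>u. indicator ?D (\<beta> * v + \<alpha> * u, (\<beta> * v + \<alpha> * u) + (\<gamma> - \<beta>) * v) :: ennreal) =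
        (\<lambda>u. indicator (strip \<alpha> \<beta> \<gamma> A B c) (v, u))"
      unfolding strip_def by (auto simp: indicator_def fun_eq_iff algebra_simps)
    finally have "ennreal (1 / \<alpha>) * (\<integral>\<^sup>+ X. indicator ?D (X, X + (\<gamma> - \<beta>) * v) \<partial>lborel) =
      (ennreal (1 / \<alpha>) * ennreal \<alpha>) * (\<integral>\<^sup>+ u. indicator (strip \<alpha> \<beta> \<gamma> A B c) (v, u) \<partial>lborel)"
      using assms by (simp add: mult.assoc)
    also have "ennreal (1 / \<alpha>) * ennreal \<alpha> = 1"
      using assms by (simp flip: ennreal_mult)
    finally show "(\<integral>\<^sup>+ u. indicator (strip \<alpha> \<beta> \<gamma> A B c) (v, u) \<partial>lborel) =
      ennreal (1 / \<alpha>) * (\<integral>\<^sup>+ X. indicator ?D (X, X + (\<gamma> - \<beta>) * v) \<partial>lborel)" by simp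
  qed
  also have "\<dots> = ennreal (1 / \<alpha>) * (\<integral>\<^sup>+ v. \<integral>\<^sup>+ X. indicator ?D (X, X + (\<gamma> - \<beta>) * v) \<partial>lborel \<partial>lborel)"
    by (rule nn_integral_cmult) measurable
  also have "(\<integral>\<^sup>+ v. \<integral>\<^sup>+ X. indicator ?D (X, X + (\<gamma> - \<beta>) * v) \<partial>lborel \<partial>lborel) =
     (\<integral>\<^sup>+ X. \<integral>\<^sup>+ v. indicator ?D (X, X + (\<gamma> - \<beta>) * v) \<partial>lborel \<partial>lborel)"
    by (rule lborel_pair.Fubini') measurable
  also have "\<dots> = (\<integral>\<^sup>+ X. ennreal (1 / (\<gamma> - \<beta>)) * (\<integral>\<^sup>+ Y. indicator ?D (X, Y) \<partial>lborel) \<partial>lborel)"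
  proof (rule nn_integral_cong)
    fix X :: real
    have "(\<integral>\<^sup>+ Y. indicator ?D (X, Y) \<partial>lborel) =
      ennreal \<bar>\<gamma> - \<beta>\<bar> * (\<integral>\<^sup>+ v. indicator ?D (X, X + (\<gamma> - \<beta>) * v) \<partial>lborel)"
      by (rule nn_integral_real_affine) (use assms in auto)
    hence "ennreal (1 / (\<gamma> - \<beta>)) * (\<integral>\<^sup>+ Y. indicator ?D (X, Y) \<partial>lborel) =
      (ennreal (1 / (\<gamma> - \<beta>)) * ennreal (\<gamma> - \<beta>)) * (\<integral>\<^sup>+ v. indicator ?D (X, X + (\<gamma> - \<beta>) * v) \<partial>lborel)"
      using assms by (simp add: mult.assoc)
    also have "ennreal (1 / (\<gamma> - \<beta>)) * ennreal (\<gamma> - \<beta>) = 1"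
      using assms by (simp flip: ennreal_mult)
    finally show "(\<integral>\<^sup>+ v. indicator ?D (X, X + (\<gamma> - \<beta>) * v) \<partial>lborel) =
      ennreal (1 / (\<gamma> - \<beta>)) * (\<integral>\<^sup>+ Y. indicator ?D (X, Y) \<partial>lborel)" by simp
  qed
  also have "\<dots> = ennreal (1 / (\<gamma> - \<beta>)) * (\<integral>\<^sup>+ X. (\<integral>\<^sup>+ Y. indicator ?D (X, Y) \<partial>lborel) \<partial>lborel)"
    by (rule nn_integral_cmult) measurable
  also have "(\<integral>\<^sup>+ X. (\<integral>\<^sup>+ Y. indicator ?D (X, Y) \<partial>lborel) \<partial>lborel) = ennreal (2 * c * ln (B / A))"
    by (rule hyperbolic_strip_area) (use assms in auto)
  also have "ennreal (1 / \<alpha>) * (ennreal (1 / (\<gamma> - \<beta>)) * ennreal (2 * c * ln (B / A))) =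
     ennreal (2 * c * ln (B / A) / (\<alpha> * (\<gamma> - \<beta>)))"
    using assms by (simp flip: ennreal_mult add: mult.commute)
  finally show ?thesis .
qed

section \<open>Comparing numbers of lattice points with areas\<close>

definition cell :: "int \<times> int \<Rightarrow> (real \<times> real) set" where
  "cell w = {of_int (fst w)..<of_int (fst w) + 1} \<times> {of_int (snd w)..<of_int (snd w) + 1}"

lemma cell_measurable [measurable]: "cell w \<in> sets (lborel \<Otimes>\<^sub>M lborel)"
  unfolding cell_def by measurable

lemma emeasure_cells:
  assumes "finite F"
  shows "emeasure (lborel \<Otimes>\<^sub>M lborel) (\<Union>w\<in>F. cell w) = ennreal (real (card F))"
proof -
  have disj: "disjoint_family_on cell F"
    unfolding disjoint_family_on_def
  proof (intro ballI impI)
    fix w w' :: "int \<times> int" assume "w \<noteq> w'"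
    have "w = w'" if "x \<in> cell w" "x \<in> cell w'" for x
    proof -
      have "\<lfloor>fst x\<rfloor> = fst w" "\<lfloor>fst x\<rfloor> = fst w'" "\<lfloor>snd x\<rfloor> = snd w" "\<lfloor>snd x\<rfloor> = snd w'"
        using that unfolding cell_def by (auto simp: floor_eq_iff)
      thus ?thesis by (simp add: prod_eq_iff)
    qed
    thus "cell w \<inter> cell w' = {}" using \<open>w \<noteq> w'\<close> by blast
  qed
  have "emeasure (lborel \<Otimes>\<^sub>M lborel) (cell w) = 1" for w
    unfolding cell_def by (subst lborel.emeasure_pair_measure_Times) auto
  moreover have "(\<Sum>w\<in>F. emeasure (lborel \<Otimes>\<^sub>M lborel) (cell w)) = emeasure (lborel \<Otimes>\<^sub>M lborel) (\<Union>w\<in>F. cell w)"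
    using cell_measurable by (intro sum_emeasure) (use assms disj in blast)+
  ultimately show ?thesis by (simp add: ennreal_of_nat_eq_real_of_nat)
qed

text \<open>
  The condition on the first linear form picks one representative from each orbit of the units,
  up to sign.
\<close>
definition strip_points :: "real \<Rightarrow> real \<Rightarrow> real \<Rightarrow> real \<Rightarrow> real \<Rightarrow> (int \<times> int) set" where
  "strip_points \<alpha> \<beta> \<gamma> \<epsilon> t = {(v, u). t \<le> \<alpha> * of_int u + \<beta> * of_int v \<and> \<alpha> * of_int u + \<beta> * of_int v < \<epsilon> * t \<and>
     \<bar>(\<alpha> * of_int u + \<beta> * of_int v) * (\<alpha> * of_int u + \<gamma> * of_int v)\<bar> \<le> t\<^sup>2}"

lemma product_perturb:
  fixes X Y X' Y' K t \<epsilon> :: real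
  assumes "\<bar>X - X'\<bar> \<le> K" "\<bar>Y - Y'\<bar> \<le> K" "\<bar>X\<bar> \<le> s" "\<bar>Y\<bar> \<le> s"
  shows "\<bar>X' * Y'\<bar> \<le> \<bar>X * Y\<bar> + 2 * K * s + K\<^sup>2"
proof -
  have K: "K \<ge> 0" using assms by linarith
  have "X' * Y' = X * Y + (X' - X) * Y + X * (Y' - Y) + (X' - X) * (Y' - Y)" by (simp add: algebra_simps)
  hence "\<bar>X' * Y'\<bar> \<le> \<bar>X * Y\<bar> + \<bar>X' - X\<bar> * \<bar>Y\<bar> + \<bar>X\<bar> * \<bar>Y' - Y\<bar> + \<bar>X' - X\<bar> * \<bar>Y' - Y\<bar>"
    by (simp flip: abs_mult)
  moreover have "\<bar>X' - X\<bar> * \<bar>Y\<bar> \<le> K * s" "\<bar>Y' - Y\<bar> * \<bar>X\<bar> \<le> K * s" "\<bar>X' - X\<bar> * \<bar>Y' - Y\<bar> \<le> K * K"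
    using assms K by (intro mult_mono; linarith)+
  ultimately show ?thesis by (simp add: power2_eq_square mult.commute[of "\<bar>X\<bar>"])
qed

context
  fixes \<alpha> \<beta> \<gamma> \<epsilon> :: real
  assumes par: "0 < \<alpha>" "\<beta> < \<gamma>" "1 < \<epsilon>"
begin

text \<open>Bounds the change of either linear form between a point of a unit cell and the corner of
  that cell.\<close>

private definition "K = \<alpha> + \<bar>\<beta>\<bar> + \<bar>\<gamma>\<bar>"

private lemma K_pos: "K > 0" unfolding K_def using par by linarith

private lemma cell_close:
  assumes "(x, y) \<in> cell (v, u)"
  shows "\<bar>(\<alpha> * of_int u + \<beta> * of_int v) - (\<alpha> * y + \<beta> * x)\<bar> \<le> K"
        "\<bar>(\<alpha> * of_int u + \<gamma> * of_int v) - (\<alpha> * y + \<gamma> * x)\<bar> \<le> K"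
proof -
  have xy: "\<bar>of_int v - x\<bar> \<le> 1" "\<bar>of_int u - y\<bar> \<le> 1" using assms unfolding cell_def by auto
  have "\<bar>(\<alpha> * of_int u + b * of_int v) - (\<alpha> * y + b * x)\<bar> \<le> \<alpha> + \<bar>b\<bar>" for b :: real
  proof -
    have "(\<alpha> * of_int u + b * of_int v) - (\<alpha> * y + b * x) = \<alpha> * (of_int u - y) + b * (of_int v - x)"
      by (simp add: algebra_simps)
    also have "\<bar>\<dots>\<bar> \<le> \<bar>\<alpha>\<bar> * \<bar>of_int u - y\<bar> + \<bar>b\<bar> * \<bar>of_int v - x\<bar>"
      by (simp flip: abs_mult)
    also have "\<dots> \<le> \<bar>\<alpha>\<bar> * 1 + \<bar>b\<bar> * 1" by (intro add_mono mult_left_mono xy) auto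
    finally show ?thesis using par by simp
  qed
  from this[of \<beta>] this[of \<gamma>] show "\<bar>(\<alpha> * of_int u + \<beta> * of_int v) - (\<alpha> * y + \<beta> * x)\<bar> \<le> K"
        "\<bar>(\<alpha> * of_int u + \<gamma> * of_int v) - (\<alpha> * y + \<gamma> * x)\<bar> \<le> K"
    unfolding K_def by linarith+
qed

private lemma abs_le_of_prod:
  fixes X Y t s :: real
  assumes "t > 0" "t \<le> X" "\<bar>X * Y\<bar> \<le> t * s" shows "\<bar>Y\<bar> \<le> s"
proof -
  have "t * \<bar>Y\<bar> \<le> X * \<bar>Y\<bar>" using assms by (intro mult_right_mono) auto
  also have "\<dots> = \<bar>X * Y\<bar>" using assms by (simp add: abs_mult)
  finally show ?thesis using assms by (meson dual_order.trans mult_le_cancel_left_pos)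
qed

text \<open>The unit cells at the points are disjoint and lie in a strip enlarged by the cell error
  \<open>K\<close>, so its area bounds their number. The estimate is made for finite subsets, which
  at the same time yields finiteness.\<close>

lemma strip_points_upper:
  assumes t: "t > K"
  shows "finite (strip_points \<alpha> \<beta> \<gamma> \<epsilon> t)"
    "real (card (strip_points \<alpha> \<beta> \<gamma> \<epsilon> t)) \<le>
      2 * (t\<^sup>2 + 2 * K * (\<epsilon> * t) + K\<^sup>2) * ln ((\<epsilon> * t + K) / (t - K)) / (\<alpha> * (\<gamma> - \<beta>))" (is "_ \<le> ?b")
proof -
  have t0: "t > 0" using t K_pos by simp
  have tle: "t \<le> \<epsilon> * t" using t0 par by simp
  have bd: "real (card G) \<le> ?b" if G: "G \<subseteq> strip_points \<alpha> \<beta> \<gamma> \<epsilon> t" "finite G" for G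
  proof -
    have "(\<Union>w\<in>G. cell w) \<subseteq> strip \<alpha> \<beta> \<gamma> (t - K) (\<epsilon> * t + K) (t\<^sup>2 + 2 * K * (\<epsilon> * t) + K\<^sup>2)"
    proof (clarify)
      fix x y v u assume vu: "(v, u) \<in> G" and xy: "(x, y) \<in> cell (v, u)"
      let ?X = "\<alpha> * of_int u + \<beta> * of_int v" and ?Y = "\<alpha> * of_int u + \<gamma> * of_int v"
      have s: "t \<le> ?X" "?X < \<epsilon> * t" "\<bar>?X * ?Y\<bar> \<le> t\<^sup>2" using vu G unfolding strip_points_def by auto
      have "\<bar>?Y\<bar> \<le> t" by (rule abs_le_of_prod[OF t0 s(1)]) (use s in \<open>simp add: power2_eq_square\<close>)
      hence "\<bar>(\<alpha> * y + \<beta> * x) * (\<alpha> * y + \<gamma> * x)\<bar> \<le> \<bar>?X * ?Y\<bar> + 2 * K * (\<epsilon> * t) + K\<^sup>2"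
        by (intro product_perturb cell_close[OF xy]) (use s tle t0 in linarith)+
      thus "(x, y) \<in> strip \<alpha> \<beta> \<gamma> (t - K) (\<epsilon> * t + K) (t\<^sup>2 + 2 * K * (\<epsilon> * t) + K\<^sup>2)"
        unfolding strip_def using s cell_close[OF xy] by auto
    qed
    hence "emeasure (lborel \<Otimes>\<^sub>M lborel) (\<Union>w\<in>G. cell w) \<le>
      emeasure (lborel \<Otimes>\<^sub>M lborel) (strip \<alpha> \<beta> \<gamma> (t - K) (\<epsilon> * t + K) (t\<^sup>2 + 2 * K * (\<epsilon> * t) + K\<^sup>2))"
      by (rule emeasure_mono) (rule strip_measurable)
    also have "\<dots> = ennreal ?b"
    proof (rule strip_area)
      show "t - K \<le> \<epsilon> * t + K" using tle K_pos by linarith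
    qed (use t t0 K_pos par in auto)
    finally have "ennreal (real (card G)) \<le> ennreal ?b" using emeasure_cells[OF G(2)] by simp
    moreover have "?b \<ge> 0"
    proof -
      have "t - K \<le> \<epsilon> * t + K" "t - K > 0" using tle K_pos t by linarith+
      hence "ln ((\<epsilon> * t + K) / (t - K)) \<ge> 0" by (intro ln_ge_zero) (simp add: le_divide_eq)
      thus ?thesis using t0 K_pos par by (intro divide_nonneg_nonneg mult_nonneg_nonneg add_nonneg_nonneg) auto
    qed
    ultimately show ?thesis by simp
  qed
  have "card G \<le> nat \<lfloor>?b\<rfloor>" if "G \<subseteq> strip_points \<alpha> \<beta> \<gamma> \<epsilon> t" "finite G" for G
    using bd[OF that] by linarith
  thus fin: "finite (strip_points \<alpha> \<beta> \<gamma> \<epsilon> t)"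
    using finite_if_finite_subsets_card_bdd[of "strip_points \<alpha> \<beta> \<gamma> \<epsilon> t"] by blast
  show "real (card (strip_points \<alpha> \<beta> \<gamma> \<epsilon> t)) \<le> ?b" by (rule bd) (use fin in auto)
qed

text \<open>The cells at the points cover a strip shrunk by the cell error. The additional 1 in the
  upper end secures the strict inequality for the first form at the corner of the cell.\<close>

lemma strip_points_lower:
  assumes t: "t > K" "t + K \<le> \<epsilon> * t - K - 1" "t\<^sup>2 - 2 * K * (\<epsilon> * t) - K\<^sup>2 \<ge> 0"
  shows "2 * (t\<^sup>2 - 2 * K * (\<epsilon> * t) - K\<^sup>2) * ln ((\<epsilon> * t - K - 1) / (t + K)) / (\<alpha> * (\<gamma> - \<beta>)) \<le>
    real (card (strip_points \<alpha> \<beta> \<gamma> \<epsilon> t))" (is "?b \<le> _")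
proof -
  have t0: "t > 0" using t K_pos by simp
  have tle: "t \<le> \<epsilon> * t" using t0 par by simp
  note fin = strip_points_upper(1)[OF t(1)]
  have "strip \<alpha> \<beta> \<gamma> (t + K) (\<epsilon> * t - K - 1) (t\<^sup>2 - 2 * K * (\<epsilon> * t) - K\<^sup>2) \<subseteq> (\<Union>w\<in>strip_points \<alpha> \<beta> \<gamma> \<epsilon> t. cell w)"
  proof (clarify)
    fix x y assume xy: "(x, y) \<in> strip \<alpha> \<beta> \<gamma> (t + K) (\<epsilon> * t - K - 1) (t\<^sup>2 - 2 * K * (\<epsilon> * t) - K\<^sup>2)"
    define v u where "v = \<lfloor>x\<rfloor>" and "u = \<lfloor>y\<rfloor>"
    have c: "(x, y) \<in> cell (v, u)" unfolding cell_def v_def u_def by auto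
    let ?X = "\<alpha> * y + \<beta> * x" and ?Y = "\<alpha> * y + \<gamma> * x"
    have s: "t + K \<le> ?X" "?X \<le> \<epsilon> * t - K - 1" "\<bar>?X * ?Y\<bar> \<le> t\<^sup>2 - 2 * K * (\<epsilon> * t) - K\<^sup>2"
      using xy unfolding strip_def by auto
    have "t\<^sup>2 - 2 * K * (\<epsilon> * t) - K\<^sup>2 \<le> t * t"
    proof -
      have "2 * K * (\<epsilon> * t) \<ge> 0" "K\<^sup>2 \<ge> 0" using K_pos t0 par by auto
      thus ?thesis unfolding power2_eq_square[of t] by linarith
    qed
    with s(3) have tt: "\<bar>?X * ?Y\<bar> \<le> t * t" by (rule order_trans)
    have tX: "t \<le> ?X" using s(1) K_pos by linarith
    have Yt: "\<bar>?Y\<bar> \<le> t" by (rule abs_le_of_prod[OF t0 tX tt])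
    have cc: "\<bar>?X - (\<alpha> * of_int u + \<beta> * of_int v)\<bar> \<le> K" "\<bar>?Y - (\<alpha> * of_int u + \<gamma> * of_int v)\<bar> \<le> K"
      by (subst abs_minus_commute, rule cell_close[OF c])+
    have Xt: "\<bar>?X\<bar> \<le> \<epsilon> * t" using s(1,2) t0 K_pos by linarith
    have "\<bar>(\<alpha> * of_int u + \<beta> * of_int v) * (\<alpha> * of_int u + \<gamma> * of_int v)\<bar> \<le> \<bar>?X * ?Y\<bar> + 2 * K * (\<epsilon> * t) + K\<^sup>2"
      by (rule product_perturb[OF cc Xt order_trans[OF Yt tle]])
    hence pp: "\<bar>(\<alpha> * of_int u + \<beta> * of_int v) * (\<alpha> * of_int u + \<gamma> * of_int v)\<bar> \<le> t\<^sup>2"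
      using s(3) by linarith
    have "(v, u) \<in> strip_points \<alpha> \<beta> \<gamma> \<epsilon> t"
      unfolding strip_points_def using pp s(1,2) cc(1) by (simp add: abs_le_iff)
    thus "(x, y) \<in> (\<Union>w\<in>strip_points \<alpha> \<beta> \<gamma> \<epsilon> t. cell w)" using c by blast
  qed
  hence "emeasure (lborel \<Otimes>\<^sub>M lborel) (strip \<alpha> \<beta> \<gamma> (t + K) (\<epsilon> * t - K - 1) (t\<^sup>2 - 2 * K * (\<epsilon> * t) - K\<^sup>2)) \<le>
     emeasure (lborel \<Otimes>\<^sub>M lborel) (\<Union>w\<in>strip_points \<alpha> \<beta> \<gamma> \<epsilon> t. cell w)"
    by (rule emeasure_mono) (use fin in measurable)
  also have "\<dots> = ennreal (real (card (strip_points \<alpha> \<beta> \<gamma> \<epsilon> t)))" by (rule emeasure_cells[OF fin])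
  also have "emeasure (lborel \<Otimes>\<^sub>M lborel) (strip \<alpha> \<beta> \<gamma> (t + K) (\<epsilon> * t - K - 1) (t\<^sup>2 - 2 * K * (\<epsilon> * t) - K\<^sup>2)) = ennreal ?b"
    by (rule strip_area) (use t t0 tle K_pos par in auto)
  finally show ?thesis by simp
qed

lemma strip_points_asymp:
  "((\<lambda>t. real (card (strip_points \<alpha> \<beta> \<gamma> \<epsilon> t)) / t\<^sup>2) \<longlongrightarrow> 2 * ln \<epsilon> / (\<alpha> * (\<gamma> - \<beta>))) at_top"
proof -
  define d where "d = \<alpha> * (\<gamma> - \<beta>)"
  define k where "k = K"
  have d: "d > 0" unfolding d_def using par by simp
  have k: "k > 0" using K_pos unfolding k_def .
  have e: "\<epsilon> > 1" using par by simp
  show ?thesis unfolding d_def[symmetric]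
  proof (rule tendsto_sandwich)
    have ev: "eventually (\<lambda>t. t > k) at_top" "eventually (\<lambda>t. t + k \<le> \<epsilon> * t - k - 1) at_top"
      "eventually (\<lambda>t. t\<^sup>2 - 2 * k * (\<epsilon> * t) - k\<^sup>2 \<ge> 0) at_top" "eventually (\<lambda>t::real. t > 0) at_top"
      using k e by real_asymp+
    show "\<forall>\<^sub>F t in at_top. (2 * (t\<^sup>2 - 2 * k * (\<epsilon> * t) - k\<^sup>2) * ln ((\<epsilon> * t - k - 1) / (t + k)) / d) / t\<^sup>2 \<le>
      real (card (strip_points \<alpha> \<beta> \<gamma> \<epsilon> t)) / t\<^sup>2"
      using ev
    proof eventually_elim
      case (elim t)
      show ?case by (intro divide_right_mono strip_points_lower[folded d_def k_def] elim) auto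
    qed
    show "\<forall>\<^sub>F t in at_top. real (card (strip_points \<alpha> \<beta> \<gamma> \<epsilon> t)) / t\<^sup>2 \<le>
      (2 * (t\<^sup>2 + 2 * k * (\<epsilon> * t) + k\<^sup>2) * ln ((\<epsilon> * t + k) / (t - k)) / d) / t\<^sup>2"
      using ev(1)
    proof eventually_elim
      case (elim t)
      show ?case by (intro divide_right_mono strip_points_upper(2)[folded d_def k_def] elim) auto
    qed
    show "((\<lambda>t. (2 * (t\<^sup>2 - 2 * k * (\<epsilon> * t) - k\<^sup>2) * ln ((\<epsilon> * t - k - 1) / (t + k)) / d) / t\<^sup>2) \<longlongrightarrow> 2 * ln \<epsilon> / d) at_top"
      unfolding divide_inverse[of "2 * ln \<epsilon>" d] using k e d by real_asymp
    show "((\<lambda>t. (2 * (t\<^sup>2 + 2 * k * (\<epsilon> * t) + k\<^sup>2) * ln ((\<epsilon> * t + k) / (t - k)) / d) / t\<^sup>2) \<longlongrightarrow> 2 * ln \<epsilon> / d) at_top"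
      unfolding divide_inverse[of "2 * ln \<epsilon>" d] using k e d by real_asymp
  qed
qed

end

section \<open>Roots modulo integers of the polynomial of discriminant p\<close>

lemma bij_betw_coprime_divisors:
  fixes m n :: nat
  assumes "coprime m n"
  shows "bij_betw (\<lambda>(a, b). a * b) ({d. d dvd m} \<times> {d. d dvd n}) {d. d dvd m * n}"
proof (rule bij_betw_imageI)
  have eq: "a = a'" if "a dvd m" "b dvd n" "a' dvd m" "b' dvd n" "a * b = a' * b'" for a b a' b'
  proof (rule dvd_antisym)
    have "coprime a b'" "coprime a' b" using assms that by (auto intro: coprime_divisors)
    thus "a dvd a'" "a' dvd a"
      using that(5) by (metis coprime_dvd_mult_left_iff dvd_triv_left)+
  qed
  show "inj_on (\<lambda>(a, b). a * b) ({d. d dvd m} \<times> {d. d dvd n})"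
  proof (rule inj_onI, clarify, rule conjI)
    fix a b a' b' assume d: "a dvd m" "b dvd n" "a' dvd m" "b' dvd n" "a * b = a' * b'"
    show "a = a'" using eq[OF d] .
    have eq2: "b = b'" if "a dvd m" "b dvd n" "a' dvd m" "b' dvd n" "a * b = a' * b'" for a b a' b'
    proof (rule dvd_antisym)
      have "coprime a b'" "coprime a' b" using assms that by (auto intro: coprime_divisors)
      hence "coprime b a'" "coprime b' a" by (auto simp: coprime_commute)
      thus "b dvd b'" "b' dvd b"
        using that(5) by (metis coprime_dvd_mult_right_iff dvd_triv_right)+
    qed
    show "b = b'" using eq2[OF d] .
  qed
  show "(\<lambda>(a, b). a * b) ` ({d. d dvd m} \<times> {d. d dvd n}) = {d. d dvd m * n}"
  proof (intro equalityI subsetI)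
    fix d assume "d \<in> (\<lambda>(a, b). a * b) ` ({d. d dvd m} \<times> {d. d dvd n})"
    thus "d \<in> {d. d dvd m * n}" by (auto intro: mult_dvd_mono)
  next
    fix d assume "d \<in> {d. d dvd m * n}"
    then obtain a b where "d = a * b" "a dvd m" "b dvd n" using division_decomp[of d m n] by blast
    thus "d \<in> (\<lambda>(a, b). a * b) ` ({d. d dvd m} \<times> {d. d dvd n})"
      by (intro image_eqI[of _ _ "(a, b)"]) simp_all
  qed
qed

definition dirichlet_conv :: "(nat \<Rightarrow> int) \<Rightarrow> (nat \<Rightarrow> int) \<Rightarrow> nat \<Rightarrow> int" where
  "dirichlet_conv F G n = (\<Sum>d | d dvd n. F d * G (n div d))"

lemma dirichlet_conv_mult:
  assumes F: "\<And>m n. m > 0 \<Longrightarrow> n > 0 \<Longrightarrow> coprime m n \<Longrightarrow> F (m * n) = F m * F n"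
    and G: "\<And>m n. m > 0 \<Longrightarrow> n > 0 \<Longrightarrow> coprime m n \<Longrightarrow> G (m * n) = G m * G n"
    and c: "coprime m n" "m > 0" "n > 0"
  shows "dirichlet_conv F G (m * n) = dirichlet_conv F G m * dirichlet_conv F G n"
proof -
  have "dirichlet_conv F G (m * n) =
      (\<Sum>(a, b)\<in>{d. d dvd m} \<times> {d. d dvd n}. F (a * b) * G (m * n div (a * b)))"
    unfolding dirichlet_conv_def
    by (subst sum.reindex_bij_betw[OF bij_betw_coprime_divisors[OF c(1)], symmetric]) (simp add: case_prod_unfold)
  also have "\<dots> = (\<Sum>(a, b)\<in>{d. d dvd m} \<times> {d. d dvd n}. (F a * G (m div a)) * (F b * G (n div b)))"
  proof (intro sum.cong refl, clarify)
    fix a b assume ab: "a dvd m" "b dvd n"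
    have "a > 0" "b > 0" "m div a > 0" "n div b > 0"
      using ab c by (auto simp: dvd_div_eq_0_iff intro!: gr0I)
    moreover have "coprime a b" using c ab by (auto intro: coprime_divisors)
    moreover have "coprime (m div a) (n div b)"
    proof (rule coprime_divisors[OF _ _ c(1)])
      show "m div a dvd m" "n div b dvd n" using ab by (metis dvd_triv_left dvd_div_mult_self)+
    qed
    moreover have "m * n div (a * b) = (m div a) * (n div b)"
      using ab by (simp add: div_mult_div_if_dvd)
    ultimately show "F (a * b) * G (m * n div (a * b)) = (F a * G (m div a)) * (F b * G (n div b))"
      using F[of a b] G[of "m div a" "n div b"] by simp
  qed
  also have "\<dots> = dirichlet_conv F G m * dirichlet_conv F G n"
    unfolding dirichlet_conv_def sum_product sum.cartesian_product by simp
  finally show ?thesis .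
qed

lemma dirichlet_conv_prime_power:
  assumes "prime q"
  shows "dirichlet_conv F G (q ^ k) = (\<Sum>i\<le>k. F (q ^ i) * G (q ^ (k - i)))"
proof -
  have q: "q > 1" using assms prime_gt_1_nat by blast
  have "{d. d dvd q ^ k} = (\<lambda>i. q ^ i) ` {..k}"
    using assms by (auto simp: divides_primepow_nat le_imp_power_dvd)
  moreover have "inj_on (\<lambda>i. q ^ i) {..k}" using q by (intro inj_onI) (simp add: power_inject_exp)
  ultimately have "dirichlet_conv F G (q ^ k) = (\<Sum>i\<le>k. F (q ^ i) * G (q ^ k div q ^ i))"
    unfolding dirichlet_conv_def by (simp add: sum.reindex)
  also have "\<dots> = (\<Sum>i\<le>k. F (q ^ i) * G (q ^ (k - i)))"
    using q by (intro sum.cong refl) (simp add: power_diff)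
  finally show ?thesis .
qed

lemma multiplicative_eqI:
  fixes F G :: "nat \<Rightarrow> int"
  assumes F: "\<And>m n. m > 0 \<Longrightarrow> n > 0 \<Longrightarrow> coprime m n \<Longrightarrow> F (m * n) = F m * F n"
    and G: "\<And>m n. m > 0 \<Longrightarrow> n > 0 \<Longrightarrow> coprime m n \<Longrightarrow> G (m * n) = G m * G n"
    and eq: "\<And>q k. prime q \<Longrightarrow> F (q ^ k) = G (q ^ k)"
    and "n > 0"
  shows "F n = G n"
  using \<open>n > 0\<close>
proof (induction n rule: less_induct)
  case (less n)
  show ?case
  proof (cases "n = 1")
    case True
    thus ?thesis using eq[OF two_is_prime_nat, of 0] by simp
  next
    case False
    then obtain q where "prime q" "q dvd n" using prime_factor_nat by blast
    hence "\<exists>q\<in>prime_factors n. True" using less.prems by (auto simp: prime_factors_dvd)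
    hence ex: "n \<noteq> 0" "\<exists>q\<in>prime_factors n. True" using less.prems by auto
    obtain q k n' where "True" and q: "prime q" "q dvd n" "\<not> q dvd n'" "k > 0" "n = q ^ k * n'"
      by (rule divide_out_primepow_ex[OF ex])
    have n': "n' > 0" using q less.prems by (cases n') auto
    have "coprime (q ^ k) n'" using q by (simp add: prime_imp_coprime)
    moreover have "q ^ k > 1" by (rule one_less_power[OF prime_gt_1_nat[OF q(1)] q(4)])
    hence "n' < n" using q n' by simp
    ultimately show ?thesis using F[of "q ^ k" n'] G[of "q ^ k" n'] eq[OF q(1), of k] less.IH[of n'] n' q
      by (simp add: prime_gt_0_nat)
  qed
qed

section \<open>Roots of b^2 + b - q0 modulo a, and the number of ideals of bounded norm\<close>

context prime_1_mod_4
begin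

text \<open>The number of ideals a \<int> + (b + w) \<int>, that is, of ideals of norm a not
  divisible by an integer above 1.\<close>

definition root_count :: "nat \<Rightarrow> int" where
  "root_count a = int (card {b \<in> {0..<int a}. int a dvd b\<^sup>2 + b - q0})"

lemma root_cong:
  assumes "[b = b'] (mod m)" shows "m dvd b\<^sup>2 + b - q0 \<longleftrightarrow> m dvd b'\<^sup>2 + b' - q0"
  by (rule cong_dvd_iff) (intro cong_add cong_diff cong_pow assms cong_refl)

lemma root_count_mult:
  assumes "m > 0" "n > 0" "coprime m n"
  shows "root_count (m * n) = root_count m * root_count n"
proof -
  let ?R = "\<lambda>a. {b \<in> {0..<int a}. int a dvd b\<^sup>2 + b - q0}"
  have co: "coprime (int m) (int n)" using assms by simp
  have md: "int m * int n dvd c \<longleftrightarrow> int m dvd c \<and> int n dvd c" for c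
    using co by (meson divides_mult dvd_mult_left dvd_mult_right)
  have "bij_betw (\<lambda>b. (b mod int m, b mod int n)) (?R (m * n)) (?R m \<times> ?R n)"
  proof (rule bij_betw_imageI)
    show "inj_on (\<lambda>b. (b mod int m, b mod int n)) (?R (m * n))"
    proof (rule inj_onI)
      fix b b' assume b: "b \<in> ?R (m * n)" "b' \<in> ?R (m * n)" "(b mod int m, b mod int n) = (b' mod int m, b' mod int n)"
      hence "int m * int n dvd b - b'" unfolding md by (simp add: mod_eq_dvd_iff)
      hence "b mod int (m * n) = b' mod int (m * n)" by (simp add: mod_eq_dvd_iff)
      thus "b = b'" using b by simp
    qed
    show "(\<lambda>b. (b mod int m, b mod int n)) ` ?R (m * n) = ?R m \<times> ?R n"
    proof (intro Set.set_eqI iffI)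
      fix w assume "w \<in> (\<lambda>b. (b mod int m, b mod int n)) ` ?R (m * n)"
      then obtain b where b: "b \<in> ?R (m * n)" "w = (b mod int m, b mod int n)" by auto
      have "int m dvd b\<^sup>2 + b - q0" "int n dvd b\<^sup>2 + b - q0" using b md by auto
      thus "w \<in> ?R m \<times> ?R n" using b(2) assms root_cong[of "b mod int m" b "int m"] root_cong[of "b mod int n" b "int n"]
        by (auto simp: cong_iff_mod_eq)
    next
      fix w assume "w \<in> ?R m \<times> ?R n"
      then obtain u v where w: "w = (u, v)" "u \<in> ?R m" "v \<in> ?R n" by auto
      obtain x where x: "[x = u] (mod int m)" "[x = v] (mod int n)"
        using binary_chinese_remainder_int[OF co] by blast
      define b where "b = x mod (int m * int n)"
      have bx: "b mod int m = u" "b mod int n = v"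
        using x w by (auto simp: b_def cong_iff_mod_eq mod_mod_cancel)
      have "[b = u] (mod int m)" "[b = v] (mod int n)" using bx w by (auto simp: cong_iff_mod_eq)
      hence "int m dvd b\<^sup>2 + b - q0" "int n dvd b\<^sup>2 + b - q0"
        using w root_cong[of b u "int m"] root_cong[of b v "int n"] by auto
      hence "b \<in> ?R (m * n)" using assms md unfolding b_def by auto
      thus "w \<in> (\<lambda>b. (b mod int m, b mod int n)) ` ?R (m * n)" using bx w by auto
    qed
  qed
  from bij_betw_same_card[OF this] show ?thesis
    unfolding root_count_def by (simp add: card_cartesian_product)
qed

lemma root_count_1 [simp]: "root_count 1 = 1"
proof -
  have "{b \<in> {0..<int 1}. int 1 dvd b\<^sup>2 + b - q0} = {0}" by auto
  thus ?thesis unfolding root_count_def by simp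
qed

lemma root_count_Suc_0 [simp]: "root_count (Suc 0) = 1"
  using root_count_1 by simp

lemma disc_eq: "4 * (b\<^sup>2 + b - q0) = (2 * b + 1)\<^sup>2 - int p"
  using p_q0 by (simp add: power2_eq_square algebra_simps)

text \<open>For odd q completing the square asks for a square root of p modulo q, and quadratic
  reciprocity carries no sign because p = 1 modulo 4. For q = 2 the number b^2 + b is always even,
  so the question is whether \<open>q0\<close> is even, which is what \<open>chi_2\<close>
  expresses.\<close>

lemma root_mod_prime_iff:
  assumes "prime q" "q \<noteq> p"
  shows "(\<exists>b. int q dvd b\<^sup>2 + b - q0) \<longleftrightarrow> chi (int q) = 1"
proof (cases "q = 2")
  case True
  have "nat q0 = (p - 1) div 4" unfolding q0_def by (simp add: nat_div_distrib nat_diff_distrib')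
  hence c: "chi 2 = (-1) ^ nat q0" using chi_2 by simp
  have q0: "q0 \<ge> 0" using p_q0 by linarith
  have "int 2 dvd b\<^sup>2 + b - q0 \<longleftrightarrow> even q0" for b by simp
  moreover have "chi 2 = 1 \<longleftrightarrow> even q0" unfolding c using q0 by (cases "even q0") (auto simp: even_nat_iff)
  ultimately show ?thesis using True by simp
next
  case False
  have q2: "q > 2" using assms False prime_ge_2_nat[of q] by simp
  have oq: "odd q" using assms(1) q2 prime_odd_nat by blast
  have "(p - 1) div 2 = 2 * ((p - 1) div 4)" by (subst (1) p_eq) simp
  hence "even ((p - 1) div 2)" by simp
  hence rec: "Legendre (int p) (int q) * Legendre (int q) (int p) = 1"
    using Quadratic_Reciprocity[of p q] prime_p p_ge_5 assms q2 by simp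
  have "chi (int q) = 1 \<longleftrightarrow> Legendre (int p) (int q) = 1"
    unfolding chi_def using rec by (auto simp: zmult_eq_1_iff)
  also have "\<dots> \<longleftrightarrow> QuadRes (int q) (int p)"
    using rec unfolding Legendre_def by (auto split: if_splits)
  also have "\<dots> \<longleftrightarrow> (\<exists>b. int q dvd b\<^sup>2 + b - q0)"
  proof
    assume "\<exists>b. int q dvd b\<^sup>2 + b - q0"
    then obtain b where "int q dvd b\<^sup>2 + b - q0" by auto
    hence "int q dvd 4 * (b\<^sup>2 + b - q0)" by (rule dvd_mult)
    thus "QuadRes (int q) (int p)" unfolding disc_eq QuadRes_def by (auto simp: cong_iff_dvd_diff)
  next
    assume "QuadRes (int q) (int p)"
    then obtain y where y: "[y\<^sup>2 = int p] (mod int q)" unfolding QuadRes_def by auto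
    have co: "coprime (int q) 2" using oq by simp
    then obtain b where b: "[2 * b = y - 1] (mod int q)"
      using cong_solve_coprime_int[of 2 "int q"]
      by (metis (no_types, lifting) cong_scalar_right coprime_commute mult.assoc mult_1)
    have "[2 * b + 1 = (y - 1) + 1] (mod int q)" by (intro cong_add b cong_refl)
    hence "[(2 * b + 1)\<^sup>2 = y\<^sup>2] (mod int q)" by (intro cong_pow) simp
    hence "[(2 * b + 1)\<^sup>2 = int p] (mod int q)" using y by (rule cong_trans)
    hence "int q dvd 4 * (b\<^sup>2 + b - q0)" unfolding disc_eq by (simp only: cong_iff_dvd_diff)
    moreover have "coprime (int q) (2 * 2)" using co by (simp only: coprime_mult_right_iff)
    hence "coprime (int q) 4" by simp
    ultimately have "int q dvd b\<^sup>2 + b - q0" by (metis coprime_dvd_mult_right_iff)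
    thus "\<exists>b. int q dvd b\<^sup>2 + b - q0" ..
  qed
  finally show ?thesis by simp
qed

text \<open>The discriminant is p, so a double root modulo q would force q to divide p.\<close>

lemma root_not_ramified:
  assumes "prime q" "q \<noteq> p" "int q dvd b\<^sup>2 + b - q0" shows "\<not> int q dvd 2 * b + 1"
proof
  assume "int q dvd 2 * b + 1"
  hence "int q dvd (2 * b + 1)\<^sup>2" by (simp add: power2_eq_square)
  moreover have "int q dvd 4 * (b\<^sup>2 + b - q0)" using assms(3) by (rule dvd_mult)
  ultimately have "int q dvd (2 * b + 1)\<^sup>2 - 4 * (b\<^sup>2 + b - q0)" by (rule dvd_diff)
  hence "int q dvd int p" unfolding disc_eq by simp
  thus False using assms prime_p by (simp add: primes_dvd_imp_eq)
qed

text \<open>Hensel lifting: s inverts the derivative 2b + 1 modulo q, and the shift by -s c q^(j+1)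
  cancels the remainder c modulo q.\<close>

lemma root_lift:
  assumes q: "prime q" "q \<noteq> p" and r: "int q dvd b\<^sup>2 + b - q0"
  shows "\<exists>b. int q ^ Suc j dvd b\<^sup>2 + b - q0"
proof (induction j)
  case 0
  thus ?case using r by auto
next
  case (Suc j)
  then obtain b c where b: "b\<^sup>2 + b - q0 = int q ^ Suc j * c" by (auto elim: dvdE)
  have "\<not> int q dvd 2 * b + 1" by (rule root_not_ramified[OF q]) (simp add: b)
  hence "coprime (2 * b + 1) (int q)" using q(1) by (metis coprime_commute prime_imp_coprime prime_nat_int_transfer)
  then obtain s where s: "[(2 * b + 1) * s = 1] (mod int q)" using cong_solve_coprime_int by blast
  have "[(2 * b + 1) * s * (- c) + c = 1 * (- c) + c] (mod int q)" by (intro cong_add cong_mult s cong_refl)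
  hence "int q dvd (2 * b + 1) * s * (- c) + c" by (simp add: cong_0_iff)
  then obtain e where e: "(2 * b + 1) * s * (- c) + c = int q * e" by (elim dvdE)
  define t where "t = s * (- c)"
  have "(b + t * int q ^ Suc j)\<^sup>2 + (b + t * int q ^ Suc j) - q0 =
     (b\<^sup>2 + b - q0) + int q ^ Suc j * ((2 * b + 1) * t) + t\<^sup>2 * (int q ^ Suc j * int q ^ Suc j)"
    by (simp add: power2_eq_square algebra_simps)
  also have "\<dots> = int q ^ Suc j * ((2 * b + 1) * s * (- c) + c) + t\<^sup>2 * (int q ^ Suc j * int q ^ Suc j)"
    unfolding b t_def by (simp add: algebra_simps)
  also have "\<dots> = int q ^ Suc (Suc j) * (e + t\<^sup>2 * int q ^ j)"
    unfolding e by (simp add: algebra_simps)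
  finally show ?case by (metis dvd_triv_left)
qed

text \<open>The two roots are b and -1 - b: for a further root c the modulus divides (c - b)(c + b +
  1), and q divides at most one of these factors since their difference is 2b + 1.\<close>

lemma root_count_split:
  assumes q: "prime q" "q \<noteq> p" and j: "j > 0" and r: "int (q ^ j) dvd b\<^sup>2 + b - q0"
  shows "root_count (q ^ j) = 2"
proof -
  define m where "m = int (q ^ j)"
  have m0: "m > 0" using q prime_gt_0_nat[of q] unfolding m_def by simp
  have qm: "int q dvd m" using j unfolding m_def by (simp add: dvd_power)
  have nr: "\<not> int q dvd 2 * b + 1"
    by (rule root_not_ramified[OF q]) (use qm r in \<open>auto simp: m_def intro: dvd_trans\<close>)
  have "{c \<in> {0..<m}. m dvd c\<^sup>2 + c - q0} = {b mod m, (- 1 - b) mod m}"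
  proof (intro Set.set_eqI iffI)
    fix c assume "c \<in> {c \<in> {0..<m}. m dvd c\<^sup>2 + c - q0}"
    hence c: "0 \<le> c" "c < m" "m dvd c\<^sup>2 + c - q0" by auto
    have "m dvd (c\<^sup>2 + c - q0) - (b\<^sup>2 + b - q0)" by (rule dvd_diff[OF c(3) r[folded m_def]])
    also have "(c\<^sup>2 + c - q0) - (b\<^sup>2 + b - q0) = (c - b) * (c + b + 1)"
      by (simp add: power2_eq_square algebra_simps)
    finally have d: "m dvd (c - b) * (c + b + 1)" .
    have "\<not> (int q dvd c - b \<and> int q dvd c + b + 1)"
    proof
      assume "int q dvd c - b \<and> int q dvd c + b + 1"
      hence "int q dvd (c + b + 1) - (c - b)" using dvd_diff by blast
      also have "(c + b + 1) - (c - b) = 2 * b + 1" by simp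
      finally show False using nr by blast
    qed
    hence "coprime m (c - b) \<or> coprime m (c + b + 1)"
      using q(1) unfolding m_def by (metis coprime_power_left_iff of_nat_power prime_imp_coprime prime_nat_int_transfer)
    hence "m dvd c + b + 1 \<or> m dvd c - b"
      using d by (auto simp: coprime_dvd_mult_right_iff coprime_dvd_mult_left_iff)
    hence "c mod m = (- 1 - b) mod m \<or> c mod m = b mod m"
      by (auto simp: mod_eq_dvd_iff algebra_simps)
    thus "c \<in> {b mod m, (- 1 - b) mod m}" using c by auto
  next
    fix c assume "c \<in> {b mod m, (- 1 - b) mod m}"
    hence "[c = b] (mod m) \<or> [c = -1 - b] (mod m)" "0 \<le> c" "c < m" using m0 by (auto simp: cong_iff_mod_eq)
    moreover have "(- 1 - b)\<^sup>2 + (- 1 - b) - q0 = b\<^sup>2 + b - q0" by (simp add: power2_eq_square algebra_simps)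
    hence "m dvd (- 1 - b)\<^sup>2 + (- 1 - b) - q0" using r unfolding m_def by (simp only:)
    moreover note r[folded m_def]
    ultimately have "m dvd c\<^sup>2 + c - q0" using root_cong[of c b m] root_cong[of c "-1 - b" m] by blast
    thus "c \<in> {c \<in> {0..<m}. m dvd c\<^sup>2 + c - q0}" using \<open>0 \<le> c\<close> \<open>c < m\<close> by simp
  qed
  moreover have "b mod m \<noteq> (- 1 - b) mod m"
  proof
    assume "b mod m = (- 1 - b) mod m"
    hence "m dvd b - (- 1 - b)" by (simp add: mod_eq_dvd_iff)
    hence "m dvd 2 * b + 1" by (simp add: algebra_simps)
    thus False using nr qm dvd_trans by blast
  qed
  ultimately show ?thesis unfolding root_count_def m_def by simp
qed

text \<open>Two roots for split q, none for inert q. For q = p there is one root modulo p, matched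
  by \<open>0 ^ 0 = 1\<close>, and none modulo p^2, since (2b + 1)^2 - p would be divisible by p^2
  together with its square term.\<close>

lemma root_count_prime_power:
  assumes q: "prime q"
  shows "root_count (q ^ Suc j) = chi (int q) ^ j * (1 + chi (int q))"
proof (cases "q = p")
  case True
  have c: "chi (int q) = 0" using True by (simp add: chi_eq_0_iff)
  have d: "int p dvd 2 * b + 1" if "int p dvd b\<^sup>2 + b - q0" for b
  proof -
    have "int p dvd 4 * (b\<^sup>2 + b - q0)" using that by (rule dvd_mult)
    hence "int p dvd (2 * b + 1)\<^sup>2" unfolding disc_eq by (simp add: dvd_diff_left_iff)
    thus ?thesis using prime_int_p by (simp add: prime_dvd_power_iff)
  qed
  show ?thesis
  proof (cases j)
    case 0
    have "{b \<in> {0..<int p}. int p dvd b\<^sup>2 + b - q0} = {2 * q0}"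
    proof (intro Set.set_eqI iffI)
      fix b assume "b \<in> {b \<in> {0..<int p}. int p dvd b\<^sup>2 + b - q0}"
      hence b: "0 \<le> b" "b < int p" "int p dvd 2 * b + 1" using d by auto
      then obtain k where k: "2 * b + 1 = int p * k" by (elim dvdE)
      have "int p * k < int p * 2" "int p * k > 0" using b k by linarith+
      hence "k = 1" using p_ge_5 by (simp add: zero_less_mult_iff)
      thus "b \<in> {2 * q0}" using k p_q0 by simp
    next
      fix b assume "b \<in> {2 * q0}"
      moreover have "(2 * q0)\<^sup>2 + 2 * q0 - q0 = q0 * int p" unfolding p_q0 by (simp add: power2_eq_square algebra_simps)
      ultimately show "b \<in> {b \<in> {0..<int p}. int p dvd b\<^sup>2 + b - q0}" using p_q0 p_ge_5 by auto
    qed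
    thus ?thesis using 0 c True unfolding root_count_def by simp
  next
    case (Suc i)
    have "\<not> int (p ^ Suc j) dvd b\<^sup>2 + b - q0" for b
    proof
      assume a: "int (p ^ Suc j) dvd b\<^sup>2 + b - q0"
      have "int p * int p dvd int (p ^ Suc j)" using Suc by (simp add: mult_dvd_mono)
      hence pp: "int p * int p dvd b\<^sup>2 + b - q0" using a by (rule dvd_trans)
      hence "int p dvd b\<^sup>2 + b - q0" by (rule dvd_mult_left)
      hence "int p * int p dvd (2 * b + 1)\<^sup>2" using d unfolding power2_eq_square by (intro mult_dvd_mono)
      moreover have "int p * int p dvd 4 * (b\<^sup>2 + b - q0)" using pp by (rule dvd_mult)
      ultimately have "int p * int p dvd (2 * b + 1)\<^sup>2 - 4 * (b\<^sup>2 + b - q0)" by (rule dvd_diff)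
      hence "int p * int p dvd int p" unfolding disc_eq by simp
      thus False using p_ge_5 by simp
    qed
    thus ?thesis using True c Suc unfolding root_count_def by simp
  qed
next
  case False
  have c: "chi (int q) = 1 \<or> chi (int q) = -1"
  proof -
    have "\<not> int p dvd int q" using False q prime_p primes_dvd_imp_eq[of p q] by auto
    thus ?thesis using chi_eq_0_iff[of "int q"] chi_values[of "int q"] by auto
  qed
  show ?thesis
  proof (cases "chi (int q) = 1")
    case True
    then obtain b where "int q dvd b\<^sup>2 + b - q0" using root_mod_prime_iff[OF q False] by blast
    then obtain b where "int q ^ Suc j dvd b\<^sup>2 + b - q0" using root_lift[OF q False] by blast
    thus ?thesis using root_count_split[OF q False, of "Suc j" b] True by simp
  next
    case nr: False
    have "\<not> int (q ^ Suc j) dvd b\<^sup>2 + b - q0" for b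
    proof
      assume a: "int (q ^ Suc j) dvd b\<^sup>2 + b - q0"
      have "int q dvd int (q ^ Suc j)" by simp
      hence "int q dvd b\<^sup>2 + b - q0" using a by (rule dvd_trans)
      thus False using root_mod_prime_iff[OF q False] nr by blast
    qed
    thus ?thesis using nr c unfolding root_count_def by simp
  qed
qed

definition square_ind :: "nat \<Rightarrow> int" where "square_ind n = (if is_square n then 1 else 0)"

text \<open>Both sides are the coefficients of the Dedekind zeta function: the left counts ideals of
  norm g^2 a, the right comes from the factorization into zeta and L(s, \<chi>). At powers of q the
  left grows from k to k + 2 by c^(k+1) (1 + c), exactly the two new terms of the geometric sum on
  the right.\<close>

lemma dirichlet_conv_root_count:
  assumes "n > 0"
  shows "dirichlet_conv square_ind root_count n = dirichlet_conv (\<lambda>d. chi (int d)) (\<lambda>_. 1) n"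
proof (rule multiplicative_eqI[OF _ _ _ assms])
  fix m n :: nat assume mn: "m > 0" "n > 0" "coprime m n"
  show "dirichlet_conv square_ind root_count (m * n) = dirichlet_conv square_ind root_count m * dirichlet_conv square_ind root_count n"
    by (rule dirichlet_conv_mult[OF _ root_count_mult])
       (use mn in \<open>auto simp: square_ind_def is_nth_power_mult_coprime_nat_iff\<close>)
  show "dirichlet_conv (\<lambda>d. chi (int d)) (\<lambda>_. 1) (m * n) =
     dirichlet_conv (\<lambda>d. chi (int d)) (\<lambda>_. 1) m * dirichlet_conv (\<lambda>d. chi (int d)) (\<lambda>_. 1) n"
    by (rule dirichlet_conv_mult) (use mn in \<open>auto simp: chi_mult\<close>)
next
  fix q k :: nat assume q: "prime q"
  define c where "c = chi (int q)"
  define T where "T k = dirichlet_conv square_ind root_count (q ^ k)" for k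
  define U where "U k = (\<Sum>i\<le>k. c ^ i)" for k
  have sq: "square_ind (q ^ i) = (if even i then 1 else 0)" for i
    unfolding square_ind_def using q by (simp add: is_nth_power_prime_power_nat_iff)
  have T: "T k = (\<Sum>i\<le>k. (if even i then 1 else 0) * root_count (q ^ (k - i)))" for k
    unfolding T_def dirichlet_conv_prime_power[OF q] sq ..
  have Tr: "T (Suc (Suc k)) = root_count (q ^ Suc (Suc k)) + T k" for k
  proof -
    have "T (Suc (Suc k)) = (\<Sum>i<Suc (Suc (Suc k)). (if even i then 1 else 0) * root_count (q ^ (Suc (Suc k) - i)))"
      unfolding T by (simp only: lessThan_Suc_atMost)
    also have "\<dots> = root_count (q ^ Suc (Suc k)) + (\<Sum>i<Suc k. (if even i then 1 else 0) * root_count (q ^ (k - i)))"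
      unfolding sum.lessThan_Suc_shift[of _ "Suc (Suc k)"] sum.lessThan_Suc_shift[of _ "Suc k"] by simp
    finally show ?thesis unfolding T by (simp only: lessThan_Suc_atMost)
  qed
  have "T k = U k \<and> T (Suc k) = U (Suc k)" for k
  proof (induction k)
    case 0
    show ?case using root_count_prime_power[OF q, of 0] unfolding T U_def c_def by simp
  next
    case (Suc k)
    have "T (Suc (Suc k)) = c ^ Suc k * (1 + c) + U k"
      unfolding Tr root_count_prime_power[OF q] c_def[symmetric] using Suc by simp
    also have "\<dots> = U (Suc (Suc k))" unfolding U_def by (simp add: algebra_simps)
    finally show ?case using Suc by simp
  qed
  thus "dirichlet_conv square_ind root_count (q ^ k) = dirichlet_conv (\<lambda>d. chi (int d)) (\<lambda>_. 1) (q ^ k)"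
    unfolding T_def U_def dirichlet_conv_prime_power[OF q] c_def by (simp add: chi_power)
qed

text \<open>The triple \<open>(g, a, b)\<close> encodes the ideal \<open>g (a \<int> + (b + w) \<int>)\<close>, of norm \<open>g\<^sup>2 a\<close>.\<close>
definition ideal_triples :: "nat \<Rightarrow> (nat \<times> nat \<times> int) set" where
  "ideal_triples x = {(g, a, b). g > 0 \<and> a > 0 \<and> g\<^sup>2 * a \<le> x \<and> b \<in> {0..<int a} \<and> int a dvd b\<^sup>2 + b - q0}"

text \<open>Grouped by the norm n = g^2 a, the triples are counted by the convolution of the square
  indicator with \<open>root_count\<close>. It is replaced by the divisor sum of \<open>chi\<close>,
  and the order of summation is exchanged.\<close>

lemma card_ideal_triples:
  "finite (ideal_triples x)"
  "int (card (ideal_triples x)) = (\<Sum>d = 1..x. chi (int d) * int (x div d))"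
proof -
  define P where "P = {(g, a). g > 0 \<and> a > 0 \<and> g\<^sup>2 * a \<le> x}"
  have Psub: "P \<subseteq> {..x} \<times> {..x}"
  proof (clarify)
    fix g a assume "(g, a) \<in> P"
    hence ga: "g > 0" "a > 0" "g\<^sup>2 * a \<le> x" unfolding P_def by auto
    have "g \<le> g\<^sup>2" using ga by (simp add: power2_eq_square)
    moreover have "g\<^sup>2 * 1 \<le> g\<^sup>2 * a" "1 * a \<le> g\<^sup>2 * a" using ga by (intro mult_le_mono; simp)+
    ultimately have "g \<le> x" "a \<le> x" using ga by linarith+
    thus "g \<in> {..x} \<and> a \<in> {..x}" by simp
  qed
  have finP: "finite P" by (rule finite_subset[OF Psub]) auto
  have eq: "ideal_triples x = (\<lambda>((g, a), b). (g, a, b)) ` (SIGMA (g, a) : P. {b \<in> {0..<int a}. int a dvd b\<^sup>2 + b - q0})"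
    unfolding ideal_triples_def P_def by (auto simp: image_iff)
  have finR: "finite {b \<in> {0..<int a}. int a dvd b\<^sup>2 + b - q0}" for a
    by (rule finite_subset[of _ "{0..<int a}"]) auto
  show "finite (ideal_triples x)"
    unfolding eq by (intro finite_imageI finite_SigmaI finP) (auto simp only: split: prod.splits intro: finR)
  have "card (ideal_triples x) = card (SIGMA (g, a) : P. {b \<in> {0..<int a}. int a dvd b\<^sup>2 + b - q0})"
    unfolding eq by (rule card_image) (auto simp: inj_on_def)
  also have "\<dots> = (\<Sum>w\<in>P. card {b \<in> {0..<int (snd w)}. int (snd w) dvd b\<^sup>2 + b - q0})"
    unfolding case_prod_unfold by (rule card_SigmaI) (use finP finR in blast)+
  finally have "int (card (ideal_triples x)) = (\<Sum>(g, a)\<in>P. root_count a)"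
    unfolding root_count_def by (simp add: case_prod_unfold)
  also have "\<dots> = (\<Sum>(n, d)\<in>(SIGMA n : {1..x}. {d. d dvd n \<and> is_square d}). root_count (n div d))"
  \<comment> \<open>The pair (g, a) becomes the norm g^2 a with its square divisor g^2; the
    description operator takes the root back.\<close>
  proof (rule sum.reindex_bij_witness[of _ "\<lambda>(n, d). (THE g. d = g\<^sup>2, n div d)" "\<lambda>(g, a). (g\<^sup>2 * a, g\<^sup>2)"])
    have the: "(THE g'. (g::nat)\<^sup>2 = g'\<^sup>2) = g" for g by (rule the_equality) auto
    show "(case case w of (g, a) \<Rightarrow> (g\<^sup>2 * a, g\<^sup>2) of (n, d) \<Rightarrow> (THE g. d = g\<^sup>2, n div d)) = w" if "w \<in> P" for w
      using that the unfolding P_def by auto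
    show "(case w of (g, a) \<Rightarrow> (g\<^sup>2 * a, g\<^sup>2)) \<in> (SIGMA n : {1..x}. {d. d dvd n \<and> is_square d})" if "w \<in> P" for w
      using that unfolding P_def by (auto intro: is_nth_powerI)
    fix v assume v: "v \<in> (SIGMA n : {1..x}. {d. d dvd n \<and> is_square d})"
    then obtain n g where w: "v = (n, g\<^sup>2)" "n \<in> {1..x}" "g\<^sup>2 dvd n" by (auto elim: is_nth_powerE)
    have "n div g\<^sup>2 > 0" "g > 0" using w by (auto simp: dvd_div_eq_0_iff intro!: gr0I)
    thus "(case case v of (n, d) \<Rightarrow> (THE g. d = g\<^sup>2, n div d) of (g, a) \<Rightarrow> (g\<^sup>2 * a, g\<^sup>2)) = v"
      "(case v of (n, d) \<Rightarrow> (THE g. d = g\<^sup>2, n div d)) \<in> P"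
      using w the unfolding P_def by auto
  qed (auto simp: P_def)
  also have "\<dots> = (\<Sum>n = 1..x. \<Sum>d | d dvd n \<and> is_square d. root_count (n div d))"
    by (subst sum.Sigma) (auto intro: finite_subset[OF _ finite_divisors_nat])
  also have "\<dots> = (\<Sum>n = 1..x. dirichlet_conv square_ind root_count n)"
  proof (intro sum.cong refl)
    fix n assume "n \<in> {1..x}"
    hence "finite {d. d dvd n}" by auto
    moreover have "{d. d dvd n \<and> is_square d} = {d. d dvd n} \<inter> {d. is_square d}" by auto
    ultimately show "(\<Sum>d | d dvd n \<and> is_square d. root_count (n div d)) = dirichlet_conv square_ind root_count n"
      unfolding dirichlet_conv_def square_ind_def
      by (simp add: sum.inter_restrict if_distrib[of "\<lambda>x. x * _"] cong: if_cong)
  qed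
  also have "\<dots> = (\<Sum>n = 1..x. dirichlet_conv (\<lambda>d. chi (int d)) (\<lambda>_. 1) n)"
    by (intro sum.cong refl dirichlet_conv_root_count) auto
  also have "\<dots> = (\<Sum>n = 1..x. \<Sum>d = 1..x. if d dvd n then chi (int d) else 0)"
  proof (intro sum.cong refl)
    fix n assume n: "n \<in> {1..x}"
    have "d \<in> {1..x}" if "d dvd n" for d
      using n dvd_imp_le[OF that] dvd_pos_nat[OF _ that] by auto
    hence e: "{d. d dvd n} = {1..x} \<inter> {d. d dvd n}" by auto
    show "dirichlet_conv (\<lambda>d. chi (int d)) (\<lambda>_. 1) n = (\<Sum>d = 1..x. if d dvd n then chi (int d) else 0)"
      unfolding dirichlet_conv_def mult_1_right by (subst e, subst sum.inter_restrict) simp_all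
  qed
  also have "\<dots> = (\<Sum>d = 1..x. \<Sum>n = 1..x. if d dvd n then chi (int d) else 0)" by (rule sum.swap)
  also have "\<dots> = (\<Sum>d = 1..x. chi (int d) * int (x div d))"
  proof (intro sum.cong refl)
    fix d assume d: "d \<in> {1..x}"
    have "(\<Sum>n = 1..x. if d dvd n then chi (int d) else 0) = chi (int d) * int (card ({1..x} \<inter> {n. d dvd n}))"
    proof -
      have "(\<Sum>n = 1..x. if d dvd n then chi (int d) else 0) = (\<Sum>n\<in>{1..x} \<inter> {n. d dvd n}. chi (int d))"
        by (subst sum.inter_restrict) simp_all
      thus ?thesis by simp
    qed
    also have "{1..x} \<inter> {n. d dvd n} = (\<lambda>k. d * k) ` {1..x div d}"
    proof (intro Set.set_eqI iffI)
      fix n assume "n \<in> {1..x} \<inter> {n. d dvd n}"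
      then obtain k where k: "n = d * k" "1 \<le> n" "n \<le> x" by auto
      hence "k \<ge> 1" by (cases k) auto
      moreover have "k \<le> x div d" using k d by (simp add: less_eq_div_iff_mult_less_eq mult.commute)
      ultimately show "n \<in> (\<lambda>k. d * k) ` {1..x div d}" using k by auto
    next
      fix n assume "n \<in> (\<lambda>k. d * k) ` {1..x div d}"
      thus "n \<in> {1..x} \<inter> {n. d dvd n}" using d by (auto simp: less_eq_div_iff_mult_less_eq mult.commute)
    qed
    also have "card \<dots> = x div d" using d by (subst card_image) (auto simp: inj_on_def)
    finally show "(\<Sum>n = 1..x. if d dvd n then chi (int d) else 0) = chi (int d) * int (x div d)" .
  qed
  finally show "int (card (ideal_triples x)) = (\<Sum>d = 1..x. chi (int d) * int (x div d))" .
qed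

end

section \<open>Ideals of the real quadratic ring of integers\<close>

lemma algebraic_int_quadratic:
  fixes y :: real
  assumes "y\<^sup>2 - of_int T * y + of_int N = 0"
  shows "algebraic_int y"
  unfolding algebraic_int_altdef_ipoly
  by (rule exI[of _ "[:N, - T, 1:]"]) (use assms in \<open>simp add: map_poly_pCons power2_eq_square algebra_simps\<close>)

text \<open>If b is the reduced denominator, every b^k divides D, and b >= 2 would give 2^D <=
  D.\<close>

lemma rational_bounded_powers_int:
  fixes N :: real
  assumes "N \<in> \<rat>" "D > 0" "\<And>k. of_int D * N ^ k \<in> \<int>"
  shows "N \<in> \<int>"
proof -
  obtain a b where ab: "b > 0" "coprime a b" "N = of_int a / of_int b"
    using assms(1) by (metis Rats_cases')
  have "b ^ k dvd D" for k
  proof -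
    obtain m where m: "of_int D * N ^ k = of_int m" using assms(3)[of k] by (auto elim: Ints_cases)
    have "of_int (D * a ^ k) = (of_int (m * b ^ k) :: real)"
      using m ab by (simp add: power_divide field_simps)
    hence "D * a ^ k = m * b ^ k" by (simp only: of_int_eq_iff)
    hence "b ^ k dvd D * a ^ k" by simp
    moreover have "coprime (b ^ k) (a ^ k)" using ab(2) by (simp add: coprime_commute)
    ultimately show ?thesis by (simp add: coprime_dvd_mult_left_iff)
  qed
  hence le: "b ^ k \<le> D" for k using assms(2) by (intro zdvd_imp_le) auto
  have "b = 1"
  proof (rule ccontr)
    assume "b \<noteq> 1"
    hence "b \<ge> 2" using ab by simp
    hence "(2::int) ^ nat D \<le> b ^ nat D" by (intro power_mono) auto
    moreover have "int (nat D) < 2 ^ nat D" using of_nat_less_two_power[of "nat D", where 'a = int] by simp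
    ultimately show False using le[of "nat D"] assms(2) by simp
  qed
  thus ?thesis using ab by simp
qed

definition span2 :: "real \<Rightarrow> real \<Rightarrow> real set" where
  "span2 \<alpha> \<beta> = {of_int m * \<alpha> + of_int n * \<beta> | m n. True}"

lemma span2_in: "of_int m * \<alpha> + of_int n * \<beta> \<in> span2 \<alpha> \<beta>"
  unfolding span2_def by blast

lemma span2_basis: "\<alpha> \<in> span2 \<alpha> \<beta>" "\<beta> \<in> span2 \<alpha> \<beta>"
  using span2_in[of 1 \<alpha> 0 \<beta>] span2_in[of 0 \<alpha> 1 \<beta>] by simp_all

lemma span2_E:
  assumes "x \<in> span2 \<alpha> \<beta>" obtains m n where "x = of_int m * \<alpha> + of_int n * \<beta>"
  using assms unfolding span2_def by blast

lemma span2_add: "x \<in> span2 \<alpha> \<beta> \<Longrightarrow> y \<in> span2 \<alpha> \<beta> \<Longrightarrow> x + y \<in> span2 \<alpha> \<beta>"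
proof (elim span2_E)
  fix m n m' n' assume "x = of_int m * \<alpha> + of_int n * \<beta>" "y = of_int m' * \<alpha> + of_int n' * \<beta>"
  hence "x + y = of_int (m + m') * \<alpha> + of_int (n + n') * \<beta>" by (simp add: algebra_simps)
  thus ?thesis using span2_in by metis
qed

lemma span2_int_mult: "x \<in> span2 \<alpha> \<beta> \<Longrightarrow> of_int c * x \<in> span2 \<alpha> \<beta>"
proof (elim span2_E)
  fix m n assume "x = of_int m * \<alpha> + of_int n * \<beta>"
  hence "of_int c * x = of_int (c * m) * \<alpha> + of_int (c * n) * \<beta>" by (simp add: algebra_simps)
  thus ?thesis using span2_in by metis
qed

lemma span2_0: "0 \<in> span2 \<alpha> \<beta>" using span2_in[of 0 \<alpha> 0 \<beta>] by simp

lemma span2_sum: "(\<And>i. i \<in> A \<Longrightarrow> f i \<in> span2 \<alpha> \<beta>) \<Longrightarrow> sum f A \<in> span2 \<alpha> \<beta>"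
  by (induction A rule: infinite_finite_induct) (auto intro: span2_add span2_0)

section \<open>The field Q(sqrt p) and its integral basis 1, w\<close>

context prime_1_mod_4
begin

abbreviation "rp \<equiv> sqrt (real p)"

lemma rp_square: "rp * rp = real p" by simp

lemma rp_pos: "rp > 0" using p_ge_5 by simp

lemma rp_irrational: "rp \<notin> \<rat>"
proof
  assume "rp \<in> \<rat>"
  moreover have "algebraic_int rp" by (intro algebraic_int_sqrt int_imp_algebraic_int) simp
  ultimately have "rp \<in> \<int>" by (rule rational_algebraic_int_is_int[rotated])
  then obtain k where "rp = of_int k" by (auto elim: Ints_cases)
  hence "of_int (k * k) = (of_int (int p) :: real)" using rp_square by simp
  hence k: "k * k = int p" by (simp only: of_int_eq_iff)
  hence "int p dvd k" using prime_int_p by (metis dvd_refl prime_dvd_multD)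
  then obtain l where "k = int p * l" by (elim dvdE)
  hence "int p * (int p * (l * l)) = int p * 1" using k by (simp add: algebra_simps)
  hence "int p * (l * l) = 1" using p_ge_5 by simp
  thus False using p_ge_5 by (simp add: zmult_eq_1_iff)
qed

lemma rat_indep:
  assumes "r \<in> \<rat>" "s \<in> \<rat>" "r + s * rp = 0" shows "r = 0" "s = 0"
proof -
  show s: "s = 0"
  proof (rule ccontr)
    assume "s \<noteq> 0"
    hence "rp = - r / s" using assms(3) by (simp add: field_simps add_eq_0_iff)
    thus False using assms rp_irrational by auto
  qed
  thus "r = 0" using assms by simp
qed

lemma rat_indep_eq:
  assumes "r \<in> \<rat>" "s \<in> \<rat>" "r' \<in> \<rat>" "s' \<in> \<rat>" "r + s * rp = r' + s' * rp" shows "r = r'" "s = s'"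
  using rat_indep[of "r - r'" "s - s'"] assms by (auto simp: algebra_simps)

definition w :: real where "w = (1 + rp) / 2"
definition w' :: real where "w' = (1 - rp) / 2"

definition lat :: "int \<Rightarrow> int \<Rightarrow> real" where "lat u v = of_int u + of_int v * w"

lemma p_q0_real: "real p = 4 * of_int q0 + 1"
  using arg_cong[OF p_q0, of real_of_int] by simp

lemma w_square: "w * w = w + of_int q0"
  unfolding w_def using rp_square p_q0_real by (simp add: field_simps)

lemma w'_eq: "w' = 1 - w" unfolding w_def w'_def by (simp add: field_simps)

lemma lat_eq_iff: "lat u v = lat u' v' \<longleftrightarrow> u = u' \<and> v = v'"
proof
  assume "lat u v = lat u' v'"
  hence "(of_int u + of_int v / 2) + (of_int v / 2) * rp = (of_int u' + of_int v' / 2) + (of_int v' / 2) * rp"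
    unfolding lat_def w_def by (simp add: field_simps)
  hence "of_int u + of_int v / 2 = (of_int u' + of_int v' / 2 :: real)" "of_int v / 2 = (of_int v' / 2 :: real)"
    using rat_indep_eq[of "of_int u + of_int v / 2" "of_int v / 2" "of_int u' + of_int v' / 2" "of_int v' / 2"] by auto
  thus "u = u' \<and> v = v'" by simp
qed auto

lemma lat_0_iff: "lat u v = 0 \<longleftrightarrow> u = 0 \<and> v = 0"
  using lat_eq_iff[of u v 0 0] by (simp add: lat_def)

lemma lat_mult: "lat u v * lat x y = lat (u * x + v * y * q0) (u * y + v * x + v * y)"
proof -
  have "lat u v * lat x y = of_int (u * x) + of_int (u * y + v * x) * w + of_int (v * y) * (w * w)"
    unfolding lat_def by (simp add: algebra_simps)
  thus ?thesis unfolding w_square lat_def by (simp add: algebra_simps)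
qed

lemma lat_add: "lat u v + lat x y = lat (u + x) (v + y)"
  unfolding lat_def by (simp add: algebra_simps)

lemma lat_minus: "- lat u v = lat (- u) (- v)"
  unfolding lat_def by simp

abbreviation "QF \<equiv> real_quadratic_field p"
abbreviation "OK \<equiv> ring_of_integers QF"

lemma QF_I: "r \<in> \<rat> \<Longrightarrow> s \<in> \<rat> \<Longrightarrow> r + s * rp \<in> QF"
  unfolding real_quadratic_field_def by blast

lemma QF_E:
  assumes "x \<in> QF" obtains r s where "r \<in> \<rat>" "s \<in> \<rat>" "x = r + s * rp"
  using assms unfolding real_quadratic_field_def by blast

lemma QF_mult: assumes "x \<in> QF" "y \<in> QF" shows "x * y \<in> QF"
proof -
  obtain r s r' s' where e: "r \<in> \<rat>" "s \<in> \<rat>" "x = r + s * rp" "r' \<in> \<rat>" "s' \<in> \<rat>" "y = r' + s' * rp"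
    using assms by (metis QF_E)
  have "x * y = (r * r' + s * s' * (rp * rp)) + (r * s' + s * r') * rp" unfolding e by (simp only: ring_distribs mult_ac add_ac)
  thus ?thesis unfolding rp_square using e by (auto intro!: QF_I)
qed

lemma QF_inverse: assumes "x \<in> QF" shows "inverse x \<in> QF"
proof (cases "x = 0")
  case False
  obtain r s where e: "r \<in> \<rat>" "s \<in> \<rat>" "x = r + s * rp" using assms by (metis QF_E)
  have m: "x * (r - s * rp) = r * r - s * s * (rp * rp)" unfolding e by (simp add: algebra_simps)
  have "r - s * rp \<noteq> 0"
    using rat_indep[of r "- s"] e False by auto
  hence nz: "r * r - s * s * real p \<noteq> 0" using m False unfolding rp_square by (metis mult_eq_0_iff)
  have "inverse x = (r - s * rp) / (x * (r - s * rp))" using \<open>r - s * rp \<noteq> 0\<close> False by (simp add: field_simps)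
  also have "\<dots> = r / (r * r - s * s * real p) + (- s / (r * r - s * s * real p)) * rp"
    unfolding m rp_square by (simp add: diff_divide_distrib)
  also have "\<dots> \<in> QF" using e by (intro QF_I Rats_divide Rats_diff Rats_mult Rats_minus_iff[THEN iffD2]) auto
  finally show ?thesis .
qed (use assms in simp)

lemma lat_QF: "lat u v \<in> QF"
proof -
  have "lat u v = (of_int u + of_int v / 2) + (of_int v / 2) * rp" unfolding lat_def w_def by (simp add: field_simps)
  also have "\<dots> \<in> QF" by (intro QF_I) auto
  finally show ?thesis .
qed

lemma carrier_OK: "carrier OK = {x \<in> QF. algebraic_int x}"
  by (simp add: ring_of_integers_def)

lemma lat_carrier: "lat u v \<in> carrier OK"
proof -
  have "w * w = w + of_int q0" by (rule w_square)
  hence "(lat u v)\<^sup>2 - of_int (2 * u + v) * lat u v + of_int (u\<^sup>2 + u * v - q0 * v\<^sup>2) = 0"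
    unfolding lat_def power2_eq_square
    using w_square by (simp add: algebra_simps)
  thus ?thesis unfolding carrier_OK using lat_QF algebraic_int_quadratic by blast
qed

lemma span_rp_mult:
  assumes "x \<in> span2 1 rp" "y \<in> span2 1 rp" shows "x * y \<in> span2 1 rp"
proof -
  obtain m n m' n' where e: "x = of_int m * 1 + of_int n * rp" "y = of_int m' * 1 + of_int n' * rp"
    using assms by (metis span2_E)
  have "x * y = of_int (m * m') + of_int (n * n') * (rp * rp) + of_int (m * n' + n * m') * rp"
    unfolding e by (simp only: of_int_add of_int_mult ring_distribs mult_ac add_ac mult_1_right)
  also have "\<dots> = of_int (m * m' + n * n' * int p) * 1 + of_int (m * n' + n * m') * rp"
    unfolding rp_square by simp
  finally show ?thesis using span2_in by metis
qed

lemma span_rp_power: "x \<in> span2 1 rp \<Longrightarrow> x ^ k \<in> span2 1 rp"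
  by (induction k) (use span2_basis(1)[of 1 rp] in \<open>auto intro: span_rp_mult\<close>)

text \<open>If e clears the denominators of x itself, then e^n, with n the degree of a monic
  integral equation, does so for the powers up to n; the equation expresses all higher powers by
  lower ones with integer coefficients.\<close>

lemma bounded_denominators:
  assumes "x \<in> QF" "algebraic_int x"
  shows "\<exists>D::int. D > 0 \<and> (\<forall>k. of_int D * x ^ k \<in> span2 1 rp)"
proof -
  obtain P where P: "poly (map_poly of_int P) x = 0" "lead_coeff P = 1"
    using assms(2) unfolding algebraic_int_altdef_ipoly by blast
  obtain r s where rs: "r \<in> \<rat>" "s \<in> \<rat>" "x = r + s * rp" using assms(1) by (metis QF_E)
  obtain a b where ab: "b > 0" "r = of_int a / of_int b" using rs(1) by (metis Rats_cases')
  obtain c d where cd: "d > 0" "s = of_int c / of_int d" using rs(2) by (metis Rats_cases')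
  define e where "e = b * d"
  have e: "e > 0" using ab cd unfolding e_def by simp
  have ex: "of_int e * x \<in> span2 1 rp"
  proof -
    have "of_int e * x = of_int (a * d) * 1 + of_int (c * b) * rp"
      unfolding e_def rs(3) ab(2) cd(2) using ab cd by (simp add: field_simps)
    thus ?thesis using span2_in by metis
  qed
  define n where "n = degree P"
  have rec: "x ^ n = - (\<Sum>i<n. of_int (coeff P i) * x ^ i)"
  proof -
    have "degree (map_poly real_of_int P) = n" unfolding n_def by (rule degree_map_poly) simp
    hence "0 = (\<Sum>i\<le>n. of_int (coeff P i) * x ^ i)"
      using P(1) by (simp add: poly_altdef coeff_map_poly)
    also have "\<dots> = (\<Sum>i<n. of_int (coeff P i) * x ^ i) + x ^ n"
      using P(2) by (simp add: lessThan_Suc_atMost[symmetric] n_def)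
    finally show ?thesis by linarith
  qed
  have "of_int (e ^ n) * x ^ k \<in> span2 1 rp" for k
  proof (induction k rule: less_induct)
    case (less k)
    show ?case
    proof (cases "k \<le> n")
      case True
      hence "n = (n - k) + k" by simp
      hence "of_int (e ^ n) * x ^ k = of_int (e ^ (n - k)) * (of_int e * x) ^ k"
        by (metis (no_types, opaque_lifting) mult.assoc of_int_mult of_int_power power_add power_mult_distrib)
      thus ?thesis using span_rp_power[OF ex] span2_int_mult by metis
    next
      case False
      hence "k = (k - n) + n" by simp
      hence "x ^ k = x ^ (k - n) * x ^ n" by (metis power_add)
      also have "\<dots> = (\<Sum>i<n. of_int (- coeff P i) * x ^ (k - n + i))"
        unfolding rec by (simp add: sum_distrib_left sum_negf power_add mult_ac)
      finally have "of_int (e ^ n) * x ^ k = (\<Sum>i<n. of_int (- coeff P i) * (of_int (e ^ n) * x ^ (k - n + i)))"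
        by (simp add: sum_distrib_left mult_ac)
      also have "\<dots> \<in> span2 1 rp"
        by (rule span2_sum, rule span2_int_mult, rule less) (use False in auto)
      finally show ?thesis .
    qed
  qed
  thus ?thesis using e by (intro exI[of _ "e ^ n"]) auto
qed

lemma norm_integral:
  assumes rs: "r \<in> \<rat>" "s \<in> \<rat>" and D: "D > 0" "\<And>k. of_int D * (r + s * rp) ^ k \<in> span2 1 rp"
  shows "r\<^sup>2 - real p * s\<^sup>2 \<in> \<int>"
proof (rule rational_bounded_powers_int)
  define N where "N = r\<^sup>2 - real p * s\<^sup>2"
  show "r\<^sup>2 - real p * s\<^sup>2 \<in> \<rat>" using rs by simp
  \<comment> \<open>The norm is quadratic in the coordinates, so it needs the square of their common
    denominator.\<close>
  show "D * D > 0" using D by simp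
  fix k
  have "\<exists>r' s'. r' \<in> \<rat> \<and> s' \<in> \<rat> \<and> (r + s * rp) ^ k = r' + s' * rp \<and> r'\<^sup>2 - real p * s'\<^sup>2 = N ^ k"
  proof (induction k)
    case 0
    show ?case by (rule exI[of _ 1], rule exI[of _ 0]) auto
  next
    case (Suc k)
    then obtain r' s' where e: "r' \<in> \<rat>" "s' \<in> \<rat>" "(r + s * rp) ^ k = r' + s' * rp" "r'\<^sup>2 - real p * s'\<^sup>2 = N ^ k" by blast
    have "(r + s * rp) ^ Suc k = (r * r' + s * s' * (rp * rp)) + (r * s' + s * r') * rp"
      unfolding power_Suc e(3) by (simp only: ring_distribs mult_ac add_ac)
    moreover have "(r * r' + s * s' * real p)\<^sup>2 - real p * (r * s' + s * r')\<^sup>2 = N * (r'\<^sup>2 - real p * s'\<^sup>2)"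
      unfolding N_def by (simp add: power2_eq_square algebra_simps)
    hence "(r * r' + s * s' * real p)\<^sup>2 - real p * (r * s' + s * r')\<^sup>2 = N ^ Suc k" unfolding e(4) by simp
    ultimately show ?case unfolding rp_square using rs e
      by (intro exI[of _ "r * r' + s * s' * real p"] exI[of _ "r * s' + s * r'"]) auto
  qed
  then obtain r' s' where e: "r' \<in> \<rat>" "s' \<in> \<rat>" "(r + s * rp) ^ k = r' + s' * rp" "r'\<^sup>2 - real p * s'\<^sup>2 = N ^ k" by blast
  obtain m n where "of_int D * (r + s * rp) ^ k = of_int m * 1 + of_int n * rp" using D(2) span2_E by blast
  hence "of_int D * r' + of_int D * s' * rp = of_int m + of_int n * rp" unfolding e by (simp add: algebra_simps)
  hence dm: "of_int D * r' = of_int m" and dn: "of_int D * s' = of_int n"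
    using rat_indep_eq[of "of_int D * r'" "of_int D * s'" "of_int m" "of_int n"] e by auto
  have "of_int (D * D) * N ^ k = (of_int D * r')\<^sup>2 - real p * (of_int D * s')\<^sup>2"
    unfolding e(4)[symmetric] by (simp add: power2_eq_square algebra_simps)
  also have "\<dots> = of_int (m\<^sup>2 - int p * n\<^sup>2)" unfolding dm dn by simp
  finally have "of_int (D * D) * N ^ k = of_int (m\<^sup>2 - int p * n\<^sup>2)" .
  thus "of_int (D * D) * (r\<^sup>2 - real p * s\<^sup>2) ^ k \<in> \<int>" unfolding N_def by (metis Ints_of_int)
qed

text \<open>
  Trace and norm of an integral element are integers: the powers of \<open>x\<close> and of \<open>x + 1\<close> have bounded
  denominators, hence so do the powers of their norms.
\<close>
lemma carrier_lat:
  assumes "x \<in> carrier OK"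
  shows "\<exists>u v. x = lat u v"
proof -
  have x: "x \<in> QF" "algebraic_int x" using assms unfolding carrier_OK by auto
  obtain r s where rs: "r \<in> \<rat>" "s \<in> \<rat>" "x = r + s * rp" using x(1) by (metis QF_E)
  obtain D where D: "D > 0" "\<And>k. of_int D * x ^ k \<in> span2 1 rp" using bounded_denominators[OF x] by blast
  have "of_int D * (x + 1) ^ k \<in> span2 1 rp" for k
  proof -
    have "of_int D * (x + 1) ^ k = (\<Sum>i\<le>k. of_int (int (k choose i)) * (of_int D * x ^ i))"
      by (simp add: binomial_ring sum_distrib_left mult_ac)
    also have "\<dots> \<in> span2 1 rp" by (rule span2_sum, rule span2_int_mult, rule D(2))
    finally show ?thesis .
  qed
  hence D1: "of_int D * ((r + 1) + s * rp) ^ k \<in> span2 1 rp" for k unfolding rs(3) by (simp add: algebra_simps)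
  have "r\<^sup>2 - real p * s\<^sup>2 \<in> \<int>" by (rule norm_integral[OF rs(1,2) D[unfolded rs(3)]])
  then obtain N where N: "r\<^sup>2 - real p * s\<^sup>2 = of_int N" by (auto elim: Ints_cases)
  have "(r + 1)\<^sup>2 - real p * s\<^sup>2 \<in> \<int>" by (rule norm_integral[OF _ rs(2) D(1) D1]) (use rs in simp)
  then obtain N1 where N1: "(r + 1)\<^sup>2 - real p * s\<^sup>2 = of_int N1" by (auto elim: Ints_cases)
  \<comment> \<open>The norms of x + 1 and x differ by the trace of x plus 1.\<close>
  define T where "T = N1 - N - 1"
  have T: "2 * r = of_int T" unfolding T_def using N N1 by (simp add: power2_eq_square algebra_simps)
  have pS: "real p * (2 * s)\<^sup>2 = of_int (T\<^sup>2 - 4 * N)" using N T[symmetric] by (simp add: power_mult_distrib)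
  have "algebraic_int (real p * (2 * s))"
  proof (rule algebraic_int_quadratic[where T = 0])
    have "(real p * (2 * s))\<^sup>2 = real p * (real p * (2 * s)\<^sup>2)" by (simp add: power2_eq_square)
    also have "\<dots> = of_int (int p * (T\<^sup>2 - 4 * N))" unfolding pS by simp
    finally show "(real p * (2 * s))\<^sup>2 - of_int 0 * (real p * (2 * s)) + of_int (- (int p * (T\<^sup>2 - 4 * N))) = 0" by simp
  qed
  hence "real p * (2 * s) \<in> \<int>" by (rule rational_algebraic_int_is_int) (use rs in simp)
  then obtain k where k: "real p * (2 * s) = of_int k" by (auto elim: Ints_cases)
  have "of_int (k * k) = real p * (real p * (2 * s)\<^sup>2)" unfolding of_int_mult k[symmetric] by (simp add: power2_eq_square)
  hence "of_int (k * k) = (of_int (int p * (T\<^sup>2 - 4 * N)) :: real)" unfolding pS by simp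
  hence "k * k = int p * (T\<^sup>2 - 4 * N)" by (simp only: of_int_eq_iff)
  hence "int p dvd k" using prime_int_p by (metis dvd_triv_left prime_dvd_multD)
  then obtain S where S: "k = int p * S" by (elim dvdE)
  have S2: "2 * s = of_int S" using k p_ge_5 unfolding S by simp
  have "of_int (int p * S\<^sup>2) = (of_int (T\<^sup>2 - 4 * N) :: real)" using pS unfolding S2 by simp
  hence "(4 * q0 + 1) * S\<^sup>2 = T\<^sup>2 - 4 * N" unfolding p_q0[symmetric] by (simp only: of_int_eq_iff)
  hence "T\<^sup>2 = S\<^sup>2 + 2 * (2 * (q0 * S\<^sup>2) + 2 * N)" by (simp add: algebra_simps)
  \<comment> \<open>Here p = 1 modulo 4 enters: trace and coefficient of sqrt p, both doubled
    coordinates, have equal parity, which brings in the half-integers of w.\<close>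
  hence "even (T\<^sup>2) \<longleftrightarrow> even (S\<^sup>2)" by simp
  hence "even (T - S)" by simp
  then obtain u where u: "T - S = 2 * u" by (elim evenE)
  hence uT: "of_int T = 2 * of_int u + (of_int S :: real)"
  proof -
    have "T = 2 * u + S" using u by simp
    thus ?thesis by simp
  qed
  have "x = lat u S" unfolding rs(3) lat_def w_def using T S2 uT by (simp add: field_simps)
  thus ?thesis by blast
qed

lemma carrier_OK_iff: "x \<in> carrier OK \<longleftrightarrow> (\<exists>u v. x = lat u v)"
  using carrier_lat lat_carrier by blast

lemma OK_simps [simp]: "x \<otimes>\<^bsub>OK\<^esub> y = x * y" "x \<oplus>\<^bsub>OK\<^esub> y = x + y" "\<one>\<^bsub>OK\<^esub> = 1" "\<zero>\<^bsub>OK\<^esub> = 0"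
  by (simp_all add: ring_of_integers_def)

lemma OK_closed:
  "x \<in> carrier OK \<Longrightarrow> y \<in> carrier OK \<Longrightarrow> x + y \<in> carrier OK"
  "x \<in> carrier OK \<Longrightarrow> y \<in> carrier OK \<Longrightarrow> x * y \<in> carrier OK"
  "x \<in> carrier OK \<Longrightarrow> - x \<in> carrier OK"
  unfolding carrier_OK_iff using lat_mult lat_add lat_minus by metis+

lemma int_OK: "of_int k \<in> carrier OK" 
  unfolding carrier_OK_iff by (intro exI[of _ k] exI[of _ 0]) (simp add: lat_def)

lemma w_OK: "w \<in> carrier OK" "w' \<in> carrier OK"
  unfolding carrier_OK_iff w'_eq by (intro exI[of _ 0] exI[of _ 1], simp add: lat_def, intro exI[of _ 1] exI[of _ "-1"], simp add: lat_def)

lemma ring_OK: "ring OK"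
proof (rule ringI)
  show "abelian_group OK"
  proof (rule abelian_groupI)
    fix x assume "x \<in> carrier OK"
    thus "\<exists>y\<in>carrier OK. y \<oplus>\<^bsub>OK\<^esub> x = \<zero>\<^bsub>OK\<^esub>" using OK_closed(3) by (intro bexI[of _ "- x"]) auto
  qed (use OK_closed int_OK[of 0] in auto)
  show "Group.monoid OK" by (rule monoidI) (use OK_closed int_OK[of 1] in auto)
qed (simp_all add: algebra_simps)

lemma ideal_OK_iff:
  "ideal I OK \<longleftrightarrow> I \<subseteq> carrier OK \<and> I \<noteq> {} \<and> (\<forall>x\<in>I. \<forall>y\<in>I. x + y \<in> I) \<and> (\<forall>c\<in>carrier OK. \<forall>x\<in>I. c * x \<in> I)"
proof
  assume I: "ideal I OK"
  have "additive_subgroup I OK" using I by (rule ideal.axioms)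
  thus "I \<subseteq> carrier OK \<and> I \<noteq> {} \<and> (\<forall>x\<in>I. \<forall>y\<in>I. x + y \<in> I) \<and> (\<forall>c\<in>carrier OK. \<forall>x\<in>I. c * x \<in> I)"
    using additive_subgroup.a_subset[of I OK] additive_subgroup.zero_closed[of I OK] 
      additive_subgroup.a_closed[of I OK] ideal.I_l_closed[OF I] by auto
next
  assume I: "I \<subseteq> carrier OK \<and> I \<noteq> {} \<and> (\<forall>x\<in>I. \<forall>y\<in>I. x + y \<in> I) \<and> (\<forall>c\<in>carrier OK. \<forall>x\<in>I. c * x \<in> I)"
  interpret ring OK by (rule ring_OK)
  show "ideal I OK"
  proof (rule idealI[OF ring_OK])
    show "subgroup I (add_monoid OK)"
    proof (rule group.subgroupI)
      show "group (add_monoid OK)" by (rule a_group)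
      fix a assume a: "a \<in> I"
      have "inv\<^bsub>add_monoid OK\<^esub> a = - a"
        unfolding a_inv_def[symmetric] by (rule minus_equality) (use a I OK_closed in auto)
      moreover have "- a \<in> I" using I a int_OK[of "-1"] by force
      ultimately show "inv\<^bsub>add_monoid OK\<^esub> a \<in> I" by simp
    qed (use I in auto)
  next
    fix a x assume "a \<in> I" "x \<in> carrier OK"
    hence "x * a \<in> I" using I by blast
    thus "x \<otimes>\<^bsub>OK\<^esub> a \<in> I" "a \<otimes>\<^bsub>OK\<^esub> x \<in> I" by (simp_all add: mult.commute)
  qed
qed

end

text \<open>Determinants multiply: the quotient is the determinant of the coefficient
  matrix.\<close>

lemma span2_subset_det:
  fixes u1 v1 u2 v2 x1 y1 x2 y2 :: int
  assumes "u1 = m1 * x1 + n1 * x2" "v1 = m1 * y1 + n1 * y2" "u2 = m2 * x1 + n2 * x2" "v2 = m2 * y1 + n2 * y2"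
  shows "x1 * y2 - x2 * y1 dvd u1 * v2 - u2 * v1"
proof -
  have "u1 * v2 - u2 * v1 = (x1 * y2 - x2 * y1) * (m1 * n2 - m2 * n1)"
    unfolding assms by (simp add: algebra_simps)
  thus ?thesis by simp
qed

lemma (in prime_1_mod_4) lat_comb:
  "of_int m * lat x1 y1 + of_int n * lat x2 y2 = lat (m * x1 + n * x2) (m * y1 + n * y2)"
  unfolding lat_def by (simp add: algebra_simps)

definition smul :: "real \<Rightarrow> real set \<Rightarrow> real set" where "smul c I = (\<lambda>x. c * x) ` I"

lemma smul_smul: "smul c (smul d I) = smul (c * d) I"
  unfolding smul_def by (auto simp: image_image mult.assoc)

lemma smul_1 [simp]: "smul 1 I = I" unfolding smul_def by simp

lemma smul_cancel: "c \<noteq> 0 \<Longrightarrow> smul c I = smul d J \<longleftrightarrow> I = smul (d / c) J"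
proof
  assume c: "c \<noteq> 0" and "smul c I = smul d J"
  hence "smul (1 / c) (smul c I) = smul (1 / c) (smul d J)" by simp
  thus "I = smul (d / c) J" using c by (simp add: smul_smul)
qed (simp add: smul_smul)

lemma smul_span2: "smul c (span2 \<alpha> \<beta>) = span2 (c * \<alpha>) (c * \<beta>)"
proof -
  have "c * (of_int m * \<alpha> + of_int n * \<beta>) = of_int m * (c * \<alpha>) + of_int n * (c * \<beta>)" for m n
    by (simp add: algebra_simps)
  thus ?thesis unfolding smul_def span2_def by (auto simp: image_iff; metis)
qed

section \<open>Normal form and norm of an ideal\<close>

context prime_1_mod_4
begin

lemma span2_lat_subset_dvd:
  assumes "span2 (lat u1 v1) (lat u2 v2) \<subseteq> span2 (lat x1 y1) (lat x2 y2)"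
  shows "x1 * y2 - x2 * y1 dvd u1 * v2 - u2 * v1"
proof -
  obtain m1 n1 where 1: "lat u1 v1 = of_int m1 * lat x1 y1 + of_int n1 * lat x2 y2"
    using assms span2_basis(1) span2_E by blast
  obtain m2 n2 where 2: "lat u2 v2 = of_int m2 * lat x1 y1 + of_int n2 * lat x2 y2"
    using assms span2_basis(2) span2_E by blast
  show ?thesis using 1 2 unfolding lat_comb lat_eq_iff by (intro span2_subset_det) auto
qed

definition triples :: "(nat \<times> nat \<times> int) set" where
  "triples = {(g, a, b). g > 0 \<and> a > 0 \<and> b \<in> {0..<int a} \<and> int a dvd b\<^sup>2 + b - q0}"

definition triple_ideal :: "nat \<times> nat \<times> int \<Rightarrow> real set" where
  "triple_ideal = (\<lambda>(g, a, b). span2 (lat (int g * int a) 0) (lat (int g * b) (int g)))"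

lemma in_triple_ideal_iff:
  "lat u v \<in> triple_ideal (g, a, b) \<longleftrightarrow> (\<exists>m n. u = m * (int g * int a) + n * (int g * b) \<and> v = n * int g)"
proof
  assume "lat u v \<in> triple_ideal (g, a, b)"
  then obtain m n where "lat u v = of_int m * lat (int g * int a) 0 + of_int n * lat (int g * b) (int g)"
    unfolding triple_ideal_def by (auto elim: span2_E)
  thus "\<exists>m n. u = m * (int g * int a) + n * (int g * b) \<and> v = n * int g"
    unfolding lat_comb lat_eq_iff by auto
next
  assume "\<exists>m n. u = m * (int g * int a) + n * (int g * b) \<and> v = n * int g"
  then obtain m n where "lat u v = of_int m * lat (int g * int a) 0 + of_int n * lat (int g * b) (int g)"
    unfolding lat_comb lat_eq_iff by auto
  thus "lat u v \<in> triple_ideal (g, a, b)" unfolding triple_ideal_def using span2_in by simp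
qed

lemma ideal_w_closed:
  assumes "I \<subseteq> carrier OK" "I \<noteq> {}" "\<And>x y. x \<in> I \<Longrightarrow> y \<in> I \<Longrightarrow> x + y \<in> I"
    "\<And>k x. x \<in> I \<Longrightarrow> of_int k * x \<in> I" "\<And>x. x \<in> I \<Longrightarrow> w * x \<in> I"
  shows "ideal I OK"
  unfolding ideal_OK_iff
proof (intro conjI ballI)
  fix c x assume "c \<in> carrier OK" "x \<in> I"
  then obtain u v where c: "c = lat u v" using carrier_lat by blast
  have "c * x = of_int u * x + of_int v * (w * x)" unfolding c lat_def by (simp add: algebra_simps)
  thus "c * x \<in> I" using assms \<open>x \<in> I\<close> by simp
qed (use assms in auto)

lemma span2_ideal:
  assumes "\<alpha> \<in> carrier OK" "\<beta> \<in> carrier OK" "w * \<alpha> \<in> span2 \<alpha> \<beta>" "w * \<beta> \<in> span2 \<alpha> \<beta>"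
  shows "ideal (span2 \<alpha> \<beta>) OK"
proof (rule ideal_w_closed)
  show "span2 \<alpha> \<beta> \<subseteq> carrier OK"
  proof
    fix x assume "x \<in> span2 \<alpha> \<beta>"
    then obtain m n where "x = of_int m * \<alpha> + of_int n * \<beta>" by (rule span2_E)
    thus "x \<in> carrier OK" using assms OK_closed int_OK by auto
  qed
  fix x assume "x \<in> span2 \<alpha> \<beta>"
  then obtain m n where x: "x = of_int m * \<alpha> + of_int n * \<beta>" by (rule span2_E)
  have "w * x = of_int m * (w * \<alpha>) + of_int n * (w * \<beta>)" unfolding x by (simp add: algebra_simps)
  thus "w * x \<in> span2 \<alpha> \<beta>" using assms by (auto intro: span2_add span2_int_mult)
qed (use span2_0 in \<open>auto intro: span2_add span2_int_mult\<close>)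

lemma w_lat: "w * lat u v = lat (v * q0) (u + v)"
  using lat_mult[of 0 1 u v] by (simp add: lat_def mult_ac)

text \<open>The divisibility in \<open>triples\<close> is closure under w, because w (b + w) = (b +
  1)(b + w) - (b^2 + b - q0).\<close>

lemma triple_ideal_nonzero:
  assumes "t \<in> triples" shows "triple_ideal t \<in> nonzero_ideals OK"
proof -
  obtain g a b where t: "t = (g, a, b)" "g > 0" "a > 0" "int a dvd b\<^sup>2 + b - q0"
    using assms unfolding triples_def by auto
  obtain k where k: "b\<^sup>2 + b - q0 = int a * k" using t by (auto elim: dvdE)
  have "ideal (triple_ideal t) OK"
    unfolding t(1) triple_ideal_def prod.case
  proof (rule span2_ideal)
    have "w * lat (int g * int a) 0 = of_int (- b) * lat (int g * int a) 0 + of_int (int a) * lat (int g * b) (int g)"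
      unfolding w_lat lat_comb lat_eq_iff by simp
    thus "w * lat (int g * int a) 0 \<in> span2 (lat (int g * int a) 0) (lat (int g * b) (int g))"
      using span2_in by metis
    have "w * lat (int g * b) (int g) = of_int (- k) * lat (int g * int a) 0 + of_int (b + 1) * lat (int g * b) (int g)"
    proof -
      have "int g * q0 = int g * (b\<^sup>2 + b - int a * k)" using k by (simp add: algebra_simps)
      thus ?thesis unfolding w_lat lat_comb lat_eq_iff by (simp add: algebra_simps power2_eq_square)
    qed
    thus "w * lat (int g * b) (int g) \<in> span2 (lat (int g * int a) 0) (lat (int g * b) (int g))"
      using span2_in by metis
  qed (rule lat_carrier)+
  moreover have "lat (int g * int a) 0 \<in> triple_ideal t"
    unfolding t(1) triple_ideal_def using span2_basis by simp
  moreover have "lat (int g * int a) 0 \<noteq> 0" unfolding lat_0_iff using t by simp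
  ultimately show ?thesis unfolding nonzero_ideals_def by auto
qed

lemma int_subgroup:
  fixes S :: "int set"
  assumes "S \<noteq> {}" "\<And>x y. x \<in> S \<Longrightarrow> y \<in> S \<Longrightarrow> x + y \<in> S" "\<And>k x. x \<in> S \<Longrightarrow> k * x \<in> S" "\<exists>x\<in>S. x \<noteq> 0"
  obtains g :: nat where "g > 0" "int g \<in> S" "\<And>x. x \<in> S \<Longrightarrow> int g dvd x"
proof -
  define P where "P = (\<lambda>n::nat. n > 0 \<and> int n \<in> S)"
  obtain x where x: "x \<in> S" "x \<noteq> 0" using assms(4) by auto
  have "\<bar>x\<bar> \<in> S" using assms(3)[OF x(1), of "sgn x"] by (simp add: sgn_mult_self_eq abs_sgn mult.commute)
  hence ex: "P (nat \<bar>x\<bar>)" unfolding P_def using x by simp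
  define g where "g = (LEAST n. P n)"
  have g: "P g" unfolding g_def by (rule LeastI[of P, OF ex])
  have "int g dvd y" if "y \<in> S" for y
  proof -
    have "y + (- (y div int g)) * int g \<in> S" using g that assms(2,3) unfolding P_def by blast
    moreover have "y + (- (y div int g)) * int g = y mod int g" by (simp add: minus_div_mult_eq_mod[symmetric])
    ultimately have m: "y mod int g \<in> S" by simp
    have "nat (y mod int g) < g" using g unfolding P_def by (simp add: nat_less_iff)
    hence "\<not> P (nat (y mod int g))" unfolding g_def by (rule not_less_Least)
    moreover have "y mod int g \<ge> 0" using g unfolding P_def by simp
    ultimately have "y mod int g = 0" using m unfolding P_def by (cases "y mod int g = 0") simp_all
    thus ?thesis by (simp add: dvd_eq_mod_eq_0)
  qed
  thus ?thesis using that[of g] g unfolding P_def by blast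
qed

text \<open>Hermite normal form: c generates the integers in I, and g generates the w-coordinates of
  its elements. Closure under w makes g divide both c and the integer part s of an element with
  w-coordinate g, so g comes out as a common factor.\<close>

lemma ex_triple:
  assumes "I \<in> nonzero_ideals OK"
  shows "\<exists>t\<in>triples. I = triple_ideal t"
proof -
  have I: "ideal I OK" and nz: "I \<noteq> {0}" using assms unfolding nonzero_ideals_def by auto
  note I' = I[unfolded ideal_OK_iff]
  have add: "x + y \<in> I" if "x \<in> I" "y \<in> I" for x y using I' that by blast
  have mul: "c * x \<in> I" if "x \<in> I" "c \<in> carrier OK" for c x using I' that by blast
  have imul: "of_int k * x \<in> I" if "x \<in> I" for k x using mul that int_OK by blast
  obtain x where x: "x \<in> I" "x \<noteq> 0" using nz I' by blast
  then obtain u v where uv: "x = lat u v" using I' carrier_lat by blast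
  \<comment> \<open>The norm of x, obtained below as the product of x with its conjugate, is a
    nonzero integer in I.\<close>
  define N where "N = u * u + u * v - q0 * (v * v)"
  have "lat (u + v) (- v) * x = lat N 0" unfolding uv lat_mult lat_eq_iff N_def by (simp add: algebra_simps)
  moreover have "lat (u + v) (- v) \<noteq> 0" using x unfolding uv lat_0_iff by auto
  ultimately have N: "lat N 0 \<in> I" "N \<noteq> 0" using mul[OF x(1) lat_carrier] x(2) lat_0_iff[of N 0] by (metis, metis mult_eq_0_iff)
  define SZ where "SZ = {n. lat n 0 \<in> I}"
  define SV where "SV = {n. \<exists>m. lat m n \<in> I}"
  have "\<exists>c::nat. c > 0 \<and> int c \<in> SZ \<and> (\<forall>x\<in>SZ. int c dvd x)"
  proof (rule int_subgroup[of SZ])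
    show "SZ \<noteq> {}" "\<exists>x\<in>SZ. x \<noteq> 0" using N unfolding SZ_def by auto
    show "x + y \<in> SZ" if "x \<in> SZ" "y \<in> SZ" for x y
      using add[of "lat x 0" "lat y 0"] that unfolding SZ_def lat_add by simp
    show "k * x \<in> SZ" if "x \<in> SZ" for k x
      using imul[of "lat x 0" k] that lat_comb[of k x 0 0 0 0] unfolding SZ_def by simp
  qed blast
  then obtain c :: nat where c: "c > 0" "lat (int c) 0 \<in> I" "\<And>n. lat n 0 \<in> I \<Longrightarrow> int c dvd n"
    unfolding SZ_def by auto
  have wc: "lat 0 (int c) \<in> I" using mul[OF c(2) w_OK(1)] unfolding w_lat by simp
  have "\<exists>g::nat. g > 0 \<and> int g \<in> SV \<and> (\<forall>x\<in>SV. int g dvd x)"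
  proof (rule int_subgroup[of SV])
    show "SV \<noteq> {}" "\<exists>x\<in>SV. x \<noteq> 0" using wc c(1) unfolding SV_def by force+
    show "x + y \<in> SV" if xy: "x \<in> SV" "y \<in> SV" for x y
    proof -
      obtain m m' where "lat m x \<in> I" "lat m' y \<in> I" using xy unfolding SV_def by auto
      from add[OF this] show ?thesis unfolding SV_def lat_add by auto
    qed
    show "k * x \<in> SV" if xy: "x \<in> SV" for k x
    proof -
      obtain m where "lat m x \<in> I" using xy unfolding SV_def by auto
      from imul[OF this, of k] show ?thesis using lat_comb[of k m x 0 0 0] unfolding SV_def by auto
    qed
  qed blast
  then obtain g :: nat where g: "g > 0" "int g \<in> SV" "\<And>m n. lat m n \<in> I \<Longrightarrow> int g dvd n"
    unfolding SV_def by blast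
  obtain s where s: "lat s (int g) \<in> I" using g(2) unfolding SV_def by auto
  have "int g dvd int c" using g(3)[OF wc] .
  then obtain a where a: "int c = int g * int a" by (metis dvdE of_nat_dvd_iff of_nat_mult)
  have a0: "a > 0" using a c(1) by (cases a) auto
  have "lat (int g * q0) (s + int g) \<in> I" using mul[OF s w_OK(1)] unfolding w_lat .
  hence "int g dvd s + int g" by (rule g(3))
  hence "int g dvd s" by simp
  then obtain b' where b': "s = int g * b'" by (elim dvdE)
  define b where "b = b' mod int a"
  have bI: "lat (int g * b) (int g) \<in> I"
  proof -
    have "b' = b + int a * (b' div int a)" unfolding b_def by simp
    hence "int g * b' = int g * (b + int a * (b' div int a))" by (rule arg_cong)
    hence "s = int g * b + int c * (b' div int a)" unfolding a b' by (simp only: distrib_left mult.assoc)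
    hence "lat (int g * b) (int g) = of_int 1 * lat s (int g) + of_int (- (b' div int a)) * lat (int c) 0"
      unfolding lat_comb lat_eq_iff by simp
    thus ?thesis using add[OF imul[OF s] imul[OF c(2)]] by metis
  qed
  have "lat (int g * (b\<^sup>2 + b - q0)) 0 \<in> I"
  proof -
    \<comment> \<open>The factor b + 1 - w is the conjugate of b + w.\<close>
    have "lat (b + 1) (- 1) * lat (int g * b) (int g) = lat (int g * (b\<^sup>2 + b - q0)) 0"
      unfolding lat_mult lat_eq_iff by (simp add: power2_eq_square algebra_simps)
    thus ?thesis using mul[OF bI lat_carrier] by metis
  qed
  hence "int g * int a dvd int g * (b\<^sup>2 + b - q0)" using c(3) unfolding a by blast
  hence ad: "int a dvd b\<^sup>2 + b - q0" using g(1) by simp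
  have t: "(g, a, b) \<in> triples" unfolding triples_def using g(1) a0 ad unfolding b_def by simp
  have "I = triple_ideal (g, a, b)"
  proof
    show "triple_ideal (g, a, b) \<subseteq> I"
    proof
      fix x assume "x \<in> triple_ideal (g, a, b)"
      then obtain m n where "x = of_int m * lat (int g * int a) 0 + of_int n * lat (int g * b) (int g)"
        unfolding triple_ideal_def by (auto elim: span2_E)
      thus "x \<in> I" using add[OF imul imul] bI c(2) unfolding a by blast
    qed
    show "I \<subseteq> triple_ideal (g, a, b)"
    proof
      fix x assume x: "x \<in> I"
      then obtain u v where uv: "x = lat u v" using I' carrier_lat by blast
      obtain n where n: "v = int g * n" using g(3) x unfolding uv by (metis dvdE)
      have "lat (u - n * (int g * b)) 0 = of_int 1 * lat u v + of_int (- n) * lat (int g * b) (int g)"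
        unfolding lat_comb lat_eq_iff n by (simp add: algebra_simps)
      hence "lat (u - n * (int g * b)) 0 \<in> I" using add[OF imul[OF x] imul[OF bI]] unfolding uv by metis
      then obtain m where "u - n * (int g * b) = int g * int a * m" using c(3) unfolding a by (metis dvdE)
      thus "x \<in> triple_ideal (g, a, b)" unfolding uv in_triple_ideal_iff n
        by (intro exI[of _ m] exI[of _ n]) (simp add: algebra_simps)
    qed
  qed
  thus ?thesis using t by blast
qed

lemma triple_ideal_inj: "inj_on triple_ideal triples"
proof (rule inj_onI)
  fix t t' assume t: "t \<in> triples" "t' \<in> triples" "triple_ideal t = triple_ideal t'"
  obtain g a b g' a' b' where e: "t = (g, a, b)" "t' = (g', a', b')" by (metis prod_cases3)
  have p: "g > 0" "a > 0" "0 \<le> b" "b < int a" "g' > 0" "a' > 0" "0 \<le> b'" "b' < int a'"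
    using t unfolding e triples_def by auto
  have sub: "g dvd g' \<and> g * a dvd g' * a'" if eq: "triple_ideal (g, a, b) = triple_ideal (g', a', b')"
      and pos: "g > 0" "g' > 0" for g a g' a' :: nat and b b'
  proof -
    have "lat (int g' * b') (int g') \<in> triple_ideal (g', a', b')"
      unfolding in_triple_ideal_iff by (intro exI[of _ 0] exI[of _ 1]) simp
    hence "int g dvd int g'" unfolding eq[symmetric] in_triple_ideal_iff by (metis dvd_triv_right)
    moreover have "lat (int g' * int a') 0 \<in> triple_ideal (g', a', b')"
      unfolding in_triple_ideal_iff by (intro exI[of _ 1] exI[of _ 0]) simp
    then obtain m n where "int g' * int a' = m * (int g * int a) + n * (int g * b)" "0 = n * int g"
      unfolding eq[symmetric] in_triple_ideal_iff by blast
    hence "int g * int a dvd int g' * int a'" using pos by simp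
    hence "int (g * a) dvd int (g' * a')" by (simp only: of_nat_mult)
    ultimately show ?thesis by (simp only: of_nat_dvd_iff)
  qed
  have g: "g = g'" using sub[of g a b g' a' b'] sub[of g' a' b' g a b] t(3) p unfolding e by (intro dvd_antisym) auto
  have "g * a = g' * a'" using sub[of g a b g' a' b'] sub[of g' a' b' g a b] t(3) p unfolding e by (intro dvd_antisym) auto
  hence a: "a = a'" using g p by simp
  have "lat (int g' * b') (int g') \<in> triple_ideal (g', a', b')"
    unfolding in_triple_ideal_iff by (intro exI[of _ 0] exI[of _ 1]) simp
  hence "lat (int g' * b') (int g') \<in> triple_ideal (g, a, b)" using t(3) unfolding e by simp
  then obtain m n where mn: "int g * b' = m * (int g * int a) + n * (int g * b)" "int g = n * int g"
    unfolding in_triple_ideal_iff g[symmetric] by blast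
  have "n = 1" using mn(2) p by simp
  hence "int g * b' = int g * (m * int a + b)" using mn(1) by (simp add: algebra_simps)
  hence "b' = m * int a + b" using p by simp
  hence "b' mod int a = b mod int a" by simp
  hence "b' = b" using p a by simp
  thus "t = t'" using e g a by simp
qed

text \<open>The index of the ideal, read off its normal form; \<open>idnorm_span2\<close> computes
  it from any integral basis.\<close>

definition idnorm :: "real set \<Rightarrow> nat" where
  "idnorm I = (case the_inv_into triples triple_ideal I of (g, a, b) \<Rightarrow> g\<^sup>2 * a)"

lemma idnorm_triple: "(g, a, b) \<in> triples \<Longrightarrow> idnorm (triple_ideal (g, a, b)) = g\<^sup>2 * a"
  unfolding idnorm_def by (simp add: the_inv_into_f_f[OF triple_ideal_inj])

lemma idnorm_span2:
  assumes "span2 (lat u1 v1) (lat u2 v2) \<in> nonzero_ideals OK"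
  shows "int (idnorm (span2 (lat u1 v1) (lat u2 v2))) = \<bar>u1 * v2 - u2 * v1\<bar>"
proof -
  obtain g a b where t: "(g, a, b) \<in> triples" "span2 (lat u1 v1) (lat u2 v2) = triple_ideal (g, a, b)"
    using ex_triple[OF assms] by (metis prod_cases3)
  have e: "span2 (lat u1 v1) (lat u2 v2) = span2 (lat (int g * int a) 0) (lat (int g * b) (int g))"
    using t(2) unfolding triple_ideal_def by simp
  have "u1 * v2 - u2 * v1 dvd int g * int a * int g - int g * b * 0"
    by (rule span2_lat_subset_dvd) (simp add: e)
  moreover have "int g * int a * int g - int g * b * 0 dvd u1 * v2 - u2 * v1"
    by (rule span2_lat_subset_dvd) (simp add: e)
  ultimately have "\<bar>u1 * v2 - u2 * v1\<bar> = \<bar>int g * int a * int g\<bar>" by (simp add: zdvd_antisym_abs)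
  thus ?thesis unfolding t(2) idnorm_triple[OF t(1)] by (simp add: power2_eq_square mult_ac)
qed

lemma card_ideals_norm_le:
  "finite {I \<in> nonzero_ideals OK. idnorm I \<le> x}"
  "card {I \<in> nonzero_ideals OK. idnorm I \<le> x} = card (ideal_triples x)"
proof -
  have e: "{I \<in> nonzero_ideals OK. idnorm I \<le> x} = triple_ideal ` ideal_triples x"
  proof (intro equalityI subsetI)
    fix I assume I: "I \<in> {I \<in> nonzero_ideals OK. idnorm I \<le> x}"
    then obtain g a b where t: "(g, a, b) \<in> triples" "I = triple_ideal (g, a, b)"
      using ex_triple by (metis mem_Collect_eq prod_cases3)
    hence "(g, a, b) \<in> ideal_triples x" using I idnorm_triple[OF t(1)] unfolding triples_def ideal_triples_def by auto
    thus "I \<in> triple_ideal ` ideal_triples x" using t by blast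
  next
    fix I assume "I \<in> triple_ideal ` ideal_triples x"
    then obtain g a b where t: "(g, a, b) \<in> ideal_triples x" "I = triple_ideal (g, a, b)" by auto
    hence "(g, a, b) \<in> triples" "g\<^sup>2 * a \<le> x" unfolding ideal_triples_def triples_def by auto
    thus "I \<in> {I \<in> nonzero_ideals OK. idnorm I \<le> x}" using t idnorm_triple triple_ideal_nonzero by auto
  qed
  have sub: "ideal_triples x \<subseteq> triples" unfolding ideal_triples_def triples_def by auto
  show "finite {I \<in> nonzero_ideals OK. idnorm I \<le> x}" unfolding e using card_ideal_triples(1) by simp
  show "card {I \<in> nonzero_ideals OK. idnorm I \<le> x} = card (ideal_triples x)"
    unfolding e by (rule card_image) (rule inj_on_subset[OF triple_ideal_inj sub])
qed

lemma ideals_asymp: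
  "(\<lambda>x. real (card {I \<in> nonzero_ideals OK. idnorm I \<le> x}) / real x) \<longlonglongrightarrow> L1"
proof -
  have "real (card {I \<in> nonzero_ideals OK. idnorm I \<le> x}) = (\<Sum>d = 1..x. of_int (chi (int d)) * real (x div d))" for x
  proof -
    have "real (card (ideal_triples x)) = of_int (int (card (ideal_triples x)))" by simp
    also have "\<dots> = of_int (\<Sum>d = 1..x. chi (int d) * int (x div d))" unfolding card_ideal_triples(2) ..
    finally show ?thesis unfolding card_ideals_norm_le(2) by simp
  qed
  thus ?thesis using chi_floor_asymp by simp
qed

end

section \<open>The class number formula\<close>

text \<open>All classes have the same positive density, and the densities of finitely many of them
  add up to at most L. So there are at most L/\<kappa> classes, and finiteness needs no separate
  argument.\<close>

lemma partition_asymp: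
  fixes nrm :: "'a \<Rightarrow> nat" and \<kappa> L :: real
  assumes part: "\<Union>Q = A" "\<And>C D. C \<in> Q \<Longrightarrow> D \<in> Q \<Longrightarrow> C \<noteq> D \<Longrightarrow> C \<inter> D = {}"
    and fin: "\<And>x. finite {I \<in> A. nrm I \<le> x}"
    and cls: "\<And>C. C \<in> Q \<Longrightarrow> (\<lambda>x. real (card {I \<in> C. nrm I \<le> x}) / real x) \<longlonglongrightarrow> \<kappa>"
    and tot: "(\<lambda>x. real (card {I \<in> A. nrm I \<le> x}) / real x) \<longlonglongrightarrow> L"
    and pos: "\<kappa> > 0"
  shows "finite Q" "real (card Q) * \<kappa> = L"
proof -
  have un: "card {I \<in> \<Union>F. nrm I \<le> x} = (\<Sum>C\<in>F. card {I \<in> C. nrm I \<le> x})" if F: "F \<subseteq> Q" "finite F" for F x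
  proof -
    have "{I \<in> \<Union>F. nrm I \<le> x} = (\<Union>C\<in>F. {I \<in> C. nrm I \<le> x})" by auto
    moreover have "card \<dots> = (\<Sum>C\<in>F. card {I \<in> C. nrm I \<le> x})"
    proof (rule card_UN_disjoint[OF F(2)])
      show "\<forall>C\<in>F. finite {I \<in> C. nrm I \<le> x}"
      proof
        fix C assume "C \<in> F"
        hence "{I \<in> C. nrm I \<le> x} \<subseteq> {I \<in> A. nrm I \<le> x}" using F part(1) by auto
        thus "finite {I \<in> C. nrm I \<le> x}" using fin finite_subset by blast
      qed
      show "\<forall>C\<in>F. \<forall>D\<in>F. C \<noteq> D \<longrightarrow> {I \<in> C. nrm I \<le> x} \<inter> {I \<in> D. nrm I \<le> x} = {}"
        using part(2) F(1) by blast
    qed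
    ultimately show ?thesis by simp
  qed
  have lim: "(\<lambda>x. real (card {I \<in> \<Union>F. nrm I \<le> x}) / real x) \<longlonglongrightarrow> real (card F) * \<kappa>" if F: "F \<subseteq> Q" "finite F" for F
  proof -
    have "(\<lambda>x. \<Sum>C\<in>F. real (card {I \<in> C. nrm I \<le> x}) / real x) \<longlonglongrightarrow> (\<Sum>C\<in>F. \<kappa>)"
      using F cls by (intro tendsto_sum) auto
    thus ?thesis unfolding un[OF F] by (simp add: sum_divide_distrib)
  qed
  have bound: "card F \<le> nat \<lfloor>L / \<kappa>\<rfloor>" if F: "F \<subseteq> Q" "finite F" for F
  proof -
    have "real (card {I \<in> \<Union>F. nrm I \<le> x}) / real x \<le> real (card {I \<in> A. nrm I \<le> x}) / real x" for x
    proof -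
      have "{I \<in> \<Union>F. nrm I \<le> x} \<subseteq> {I \<in> A. nrm I \<le> x}" using F part(1) by auto
      hence "card {I \<in> \<Union>F. nrm I \<le> x} \<le> card {I \<in> A. nrm I \<le> x}" by (rule card_mono[OF fin])
      thus ?thesis by (intro divide_right_mono) auto
    qed
    hence "real (card F) * \<kappa> \<le> L" by (intro LIMSEQ_le[OF lim[OF F] tot]) auto
    hence "real (card F) \<le> L / \<kappa>" using pos by (simp add: field_simps)
    thus ?thesis by linarith
  qed
  show Q: "finite Q" using finite_if_finite_subsets_card_bdd[of Q] bound by blast
  show "real (card Q) * \<kappa> = L" using LIMSEQ_unique[OF lim[OF subset_refl Q] tot[folded part(1)]] .
qed

section \<open>Ideal classes, units and stabilizers of lattices\<close>

context prime_1_mod_4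
begin

lemma l_coset_smul: "a <#\<^bsub>OK\<^esub> I = smul a I"
  unfolding l_coset_def smul_def by auto

lemma class_rel_iff:
  "(I, J) \<in> ideal_class_rel OK \<longleftrightarrow> I \<in> nonzero_ideals OK \<and> J \<in> nonzero_ideals OK \<and>
     (\<exists>a\<in>carrier OK. \<exists>b\<in>carrier OK. a \<noteq> 0 \<and> b \<noteq> 0 \<and> smul a I = smul b J)"
  unfolding ideal_class_rel_def l_coset_smul by auto

lemma equiv_class_rel: "equiv (nonzero_ideals OK) (ideal_class_rel OK)"
proof (rule equivI)
  show "ideal_class_rel OK \<subseteq> nonzero_ideals OK \<times> nonzero_ideals OK" by (auto simp: class_rel_iff)
  show "refl_on (nonzero_ideals OK) (ideal_class_rel OK)"
  proof (rule refl_onI)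
    fix I assume "I \<in> nonzero_ideals OK"
    moreover have "1 \<in> carrier OK" using int_OK[of 1] by simp
    ultimately show "(I, I) \<in> ideal_class_rel OK" unfolding class_rel_iff
      by (intro conjI bexI[of _ 1]) auto
  qed
  show "sym (ideal_class_rel OK)"
  proof (rule symI)
    fix I J assume "(I, J) \<in> ideal_class_rel OK"
    then obtain a b where h: "a \<in> carrier OK" "b \<in> carrier OK" "a \<noteq> 0" "b \<noteq> 0" "smul a I = smul b J"
      "I \<in> nonzero_ideals OK" "J \<in> nonzero_ideals OK" unfolding class_rel_iff by blast
    show "(J, I) \<in> ideal_class_rel OK" unfolding class_rel_iff
      by (intro conjI h(6,7) bexI[OF _ h(2)] bexI[OF _ h(1)] h(3,4) h(5)[symmetric])
  qed
  show "trans (ideal_class_rel OK)"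
  proof (rule transI)
    fix I J K assume "(I, J) \<in> ideal_class_rel OK" "(J, K) \<in> ideal_class_rel OK"
    then obtain a b c d where h: "a \<in> carrier OK" "b \<in> carrier OK" "c \<in> carrier OK" "d \<in> carrier OK"
      "a \<noteq> 0" "b \<noteq> 0" "c \<noteq> 0" "d \<noteq> 0" "smul a I = smul b J" "smul c J = smul d K"
      "I \<in> nonzero_ideals OK" "K \<in> nonzero_ideals OK" unfolding class_rel_iff by blast
    have e: "smul (c * a) I = smul (b * d) K"
      by (metis h(9,10) mult.commute smul_smul)
    have nz: "c * a \<noteq> 0" "b * d \<noteq> 0" using h by simp_all
    show "(I, K) \<in> ideal_class_rel OK" unfolding class_rel_iff
      by (intro conjI h(11,12) bexI[OF _ OK_closed(2)[OF h(3,1)]] bexI[OF _ OK_closed(2)[OF h(2,4)]] nz e)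
  qed
qed

lemma span2_lat_carrier: "span2 (lat u v) (lat x y) \<subseteq> carrier OK"
proof
  fix z assume "z \<in> span2 (lat u v) (lat x y)"
  then obtain m n where "z = of_int m * lat u v + of_int n * lat x y" by (rule span2_E)
  thus "z \<in> carrier OK" using lat_carrier unfolding lat_comb by simp
qed

lemma smul_ideal:
  assumes "ideal I OK" "smul \<gamma> I \<subseteq> carrier OK" shows "ideal (smul \<gamma> I) OK"
  unfolding ideal_OK_iff
proof (intro conjI ballI)
  note I = assms(1)[unfolded ideal_OK_iff]
  show "smul \<gamma> I \<noteq> {}" using I unfolding smul_def by auto
  fix x y assume "x \<in> smul \<gamma> I" "y \<in> smul \<gamma> I"
  then obtain x' y' where "x' \<in> I" "y' \<in> I" "x = \<gamma> * x'" "y = \<gamma> * y'" unfolding smul_def by auto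
  hence "x + y = \<gamma> * (x' + y')" "x' + y' \<in> I" using I by (auto simp: algebra_simps)
  thus "x + y \<in> smul \<gamma> I" unfolding smul_def by blast
next
  note I = assms(1)[unfolded ideal_OK_iff]
  fix c x assume c: "c \<in> carrier OK" "x \<in> smul \<gamma> I"
  then obtain x' where "x' \<in> I" "x = \<gamma> * x'" unfolding smul_def by auto
  hence "c * x = \<gamma> * (c * x')" "c * x' \<in> I" using I c by (auto simp: algebra_simps)
  thus "c * x \<in> smul \<gamma> I" unfolding smul_def by blast
qed (use assms in auto)

lemma Units_iff: "\<eta> \<in> Units OK \<longleftrightarrow> \<eta> \<noteq> 0 \<and> \<eta> \<in> carrier OK \<and> inverse \<eta> \<in> carrier OK"
proof
  assume "\<eta> \<in> Units OK"
  then obtain x where x: "x \<in> carrier OK" "\<eta> \<in> carrier OK" "x * \<eta> = 1" unfolding Units_def by auto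
  hence "\<eta> \<noteq> 0" by auto
  moreover from this have "inverse \<eta> = x" using x by (simp add: field_simps)
  ultimately show "\<eta> \<noteq> 0 \<and> \<eta> \<in> carrier OK \<and> inverse \<eta> \<in> carrier OK" using x by simp
next
  assume "\<eta> \<noteq> 0 \<and> \<eta> \<in> carrier OK \<and> inverse \<eta> \<in> carrier OK"
  thus "\<eta> \<in> Units OK" unfolding Units_def by (auto intro!: bexI[of _ "inverse \<eta>"])
qed

lemma carrier_power: "x \<in> carrier OK \<Longrightarrow> x ^ k \<in> carrier OK"
  by (induction k) (use int_OK[of 1] OK_closed in auto)

lemma Units_powi:
  assumes "\<eta> \<in> Units OK" shows "\<eta> powi k \<in> Units OK"
proof (cases "k \<ge> 0")
  case True
  then obtain n where "k = int n" by (metis nonneg_int_cases)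
  thus ?thesis using assms carrier_power unfolding Units_iff by (auto simp flip: power_inverse)
next
  case False
  then obtain n where "k = - int n" by (metis nonpos_int_cases linear)
  thus ?thesis using assms carrier_power unfolding Units_iff by (auto simp: power_int_minus simp flip: power_inverse)
qed

lemma Units_uminus: "\<eta> \<in> Units OK \<Longrightarrow> - \<eta> \<in> Units OK"
  unfolding Units_iff using OK_closed(3) by auto

lemma unit_smul:
  assumes "ideal I OK" "\<eta> \<in> Units OK" shows "smul \<eta> I = I"
proof -
  note I = assms(1)[unfolded ideal_OK_iff]
  have u: "\<eta> \<noteq> 0" "\<eta> \<in> carrier OK" "inverse \<eta> \<in> carrier OK" using assms(2) unfolding Units_iff by auto
  show ?thesis
  proof
    show "smul \<eta> I \<subseteq> I" unfolding smul_def using I u by auto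
    show "I \<subseteq> smul \<eta> I"
    proof
      fix x assume "x \<in> I"
      hence "inverse \<eta> * x \<in> I" using I u by auto
      moreover have "x = \<eta> * (inverse \<eta> * x)" using u by (simp add: field_simps)
      ultimately show "x \<in> smul \<eta> I" unfolding smul_def by blast
    qed
  qed
qed

text \<open>Multiplication by \<eta> acts on the lattice by an integral 2 x 2 matrix, and \<eta> is
  a root of its characteristic polynomial.\<close>

lemma stabilizer_integral:
  assumes "\<eta> \<in> QF" "smul \<eta> (span2 \<alpha> \<beta>) \<subseteq> span2 \<alpha> \<beta>" "\<alpha> \<noteq> 0"
  shows "\<eta> \<in> carrier OK"
proof -
  have "\<eta> * \<alpha> \<in> span2 \<alpha> \<beta>" "\<eta> * \<beta> \<in> span2 \<alpha> \<beta>" using assms(2) span2_basis unfolding smul_def by blast+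
  then obtain m11 m12 m21 m22 where m: "\<eta> * \<alpha> = of_int m11 * \<alpha> + of_int m12 * \<beta>" "\<eta> * \<beta> = of_int m21 * \<alpha> + of_int m22 * \<beta>"
    by (metis span2_E)
  have "(\<eta> - of_int m11) * \<alpha> = of_int m12 * \<beta>" "(\<eta> - of_int m22) * \<beta> = of_int m21 * \<alpha>"
    using m by (auto simp: algebra_simps)
  hence "(\<eta> - of_int m22) * ((\<eta> - of_int m11) * \<alpha>) = of_int m12 * (of_int m21 * \<alpha>)" by (metis mult.left_commute)
  hence "((\<eta> - of_int m22) * (\<eta> - of_int m11) - of_int m12 * of_int m21) * \<alpha> = 0" by (simp add: algebra_simps)
  hence "(\<eta> - of_int m22) * (\<eta> - of_int m11) - of_int m12 * of_int m21 = 0" using assms(3) by simp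
  hence "\<eta>\<^sup>2 - of_int (m11 + m22) * \<eta> + of_int (m11 * m22 - m12 * m21) = 0"
    by (simp add: power2_eq_square algebra_simps)
  thus ?thesis unfolding carrier_OK using assms(1) algebraic_int_quadratic by blast
qed

lemma stabilizer_unit:
  assumes "\<eta> \<in> QF" "\<eta> \<noteq> 0" "smul \<eta> (span2 \<alpha> \<beta>) = span2 \<alpha> \<beta>" "\<alpha> \<noteq> 0"
  shows "\<eta> \<in> Units OK"
proof -
  have inv: "smul (inverse \<eta>) (span2 \<alpha> \<beta>) = span2 \<alpha> \<beta>"
    using smul_cancel[OF assms(2), of "span2 \<alpha> \<beta>" 1 "span2 \<alpha> \<beta>"] assms(3) by (simp add: inverse_eq_divide)
  have "\<eta> \<in> carrier OK" by (rule stabilizer_integral[OF assms(1) equalityD1[OF assms(3)] assms(4)])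
  moreover have "inverse \<eta> \<in> carrier OK"
    by (rule stabilizer_integral[OF QF_inverse[OF assms(1)] equalityD1[OF inv] assms(4)])
  ultimately show ?thesis unfolding Units_iff using assms(2) by blast
qed

section \<open>Counting the ideals of one class\<close>

context
  fixes \<epsilon> :: real
  assumes fund: "is_fundamental_unit OK \<epsilon>"
begin

lemma fund_gt_1: "\<epsilon> > 1" and fund_unit: "\<epsilon> \<in> Units OK"
  using fund unfolding is_fundamental_unit_def by auto

text \<open>Gives uniqueness of the representative in the strip: the quotient of two representatives
  is a unit in this interval, which allows only the exponent 0 and the positive sign.\<close>

lemma unit_between:
  assumes "\<eta> \<in> Units OK" "1 / \<epsilon> < \<eta>" "\<eta> < \<epsilon>" shows "\<eta> = 1"
proof -
  have e: "\<epsilon> > 1" by (rule fund_gt_1)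
  have pos: "\<epsilon> powi k > 0" for k using e by simp
  obtain k where k: "\<eta> = \<epsilon> powi k \<or> \<eta> = - (\<epsilon> powi k)"
    using assms(1) fund unfolding is_fundamental_unit_def by blast
  have "1 / \<epsilon> > 0" using e by simp
  hence "\<eta> > 0" using assms(2) by linarith
  hence k: "\<eta> = \<epsilon> powi k" using k pos[of k] by auto
  have "k < 1"
  proof (rule ccontr)
    assume "\<not> k < 1"
    hence "\<epsilon> powi 1 \<le> \<epsilon> powi k" using e by (intro power_int_increasing) auto
    thus False using assms(3) k by simp
  qed
  moreover have "k > -1"
  proof (rule ccontr)
    assume "\<not> k > -1"
    hence "\<epsilon> powi k \<le> \<epsilon> powi (-1)" using e by (intro power_int_increasing) auto
    thus False using assms(2) k by (simp add: power_int_minus divide_inverse)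
  qed
  ultimately have "k = 0" by simp
  thus ?thesis using k by simp
qed

text \<open>Gives existence of the representative: rounding the logarithm up lands in the half-open
  interval.\<close>

lemma ex_unit_scale:
  assumes "x > 0" "t > 0"
  shows "\<exists>k::int. t \<le> x * \<epsilon> powi k \<and> x * \<epsilon> powi k < \<epsilon> * t"
proof -
  have e: "\<epsilon> > 1" by (rule fund_gt_1)
  define k where "k = \<lceil>log \<epsilon> (t / x)\<rceil>"
  have tx: "t / x = \<epsilon> powr (log \<epsilon> (t / x))" using assms e by simp
  have pw: "\<epsilon> powi k = \<epsilon> powr (of_int k)" using e by (simp add: powr_real_of_int')
  have "\<epsilon> powr (log \<epsilon> (t / x)) \<le> \<epsilon> powr (of_int k)" unfolding k_def using e by (intro powr_mono) (auto simp: le_of_int_ceiling)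
  hence 1: "t / x \<le> \<epsilon> powi k" using tx pw by simp
  have "of_int k < log \<epsilon> (t / x) + 1" unfolding k_def by linarith
  hence "\<epsilon> powr (of_int k) < \<epsilon> powr (log \<epsilon> (t / x) + 1)" using e by (intro powr_less_mono) auto
  also have "\<dots> = (t / x) * \<epsilon>" using e tx by (simp add: powr_add)
  finally have 2: "\<epsilon> powi k < (t / x) * \<epsilon>" using pw by simp
  from 1 2 show ?thesis using assms by (intro exI[of _ k]) (auto simp: field_simps)
qed

context
  fixes a :: nat and b c :: int
  assumes a0: "a > 0" and fb: "b\<^sup>2 + b - q0 = int a * c"
begin

text \<open>
  The class of the ideal \<open>J0 = a \<int> + (b + w) \<int>\<close> consists of the ideals \<open>(\<delta> / a) J0\<close> with \<open>\<delta> = dl v u\<close>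
  nonzero in \<open>a \<int> + (b + w') \<int>\<close>; the conjugate of \<open>\<delta>\<close> is \<open>dl' v u\<close>.
\<close>
definition "J0 = span2 (lat (int a) 0) (lat b 1)"
definition "Phi v u = span2 (lat (int a * u + v * b + v) (- v)) (lat (u * b + v * c) u)"
definition "dl v u = real a * of_int u + (of_int b + w') * of_int v"
definition "dl' v u = real a * of_int u + (of_int b + w) * of_int v"

lemma dl_lat: "dl v u = lat (int a * u + v * b + v) (- v)"
  unfolding dl_def lat_def w'_eq by (simp add: algebra_simps)

lemma dl'_lat: "dl' v u = lat (int a * u + v * b) v"
  unfolding dl'_def lat_def by (simp add: algebra_simps)

lemma dl_eq_iff: "dl v u = dl x y \<longleftrightarrow> v = x \<and> u = y"
  unfolding dl_lat lat_eq_iff using a0 by auto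

lemma real_lat: "real a = lat (int a) 0" by (simp add: lat_def)

text \<open>By \<open>fb\<close> the norm of b + w is a c, so the part v (b + w') of \<delta>
  contributes the multiple v c of a.\<close>

lemma dl_mult_lat: "dl v u * lat b 1 = real a * lat (u * b + v * c) u"
proof -
  have "v * (b\<^sup>2 + b - q0) = v * (int a * c)" using fb by simp
  thus ?thesis unfolding real_lat dl_lat lat_mult lat_eq_iff by (simp add: algebra_simps power2_eq_square)
qed

lemma Phi_smul: "Phi v u = smul (dl v u / real a) J0"
proof -
  have "dl v u / real a * lat (int a) 0 = dl v u" using a0 by (simp add: real_lat[symmetric])
  moreover have "dl v u / real a * lat b 1 = lat (u * b + v * c) u" using dl_mult_lat[of v u] a0 by (simp add: field_simps)
  ultimately show ?thesis unfolding J0_def smul_span2 Phi_def dl_lat by simp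
qed

text \<open>The norm of \<delta> is a times the determinant of the basis of \<open>Phi v u\<close>;
  a is the norm of \<open>J0\<close>.\<close>

lemma dl_mult_dl': "dl v u * dl' v u = real a * of_int ((int a * u + v * b + v) * u - (u * b + v * c) * (- v))"
proof -
  have "v * v * (b\<^sup>2 + b - q0) = v * v * (int a * c)" using fb by simp
  moreover have "of_int k = lat k 0" for k by (simp add: lat_def)
  ultimately show ?thesis unfolding real_lat dl_lat dl'_lat \<open>\<And>k. of_int k = lat k 0\<close> lat_mult lat_eq_iff
    by (simp add: algebra_simps power2_eq_square)
qed

lemma J0_ideal: "ideal J0 OK"
  unfolding J0_def
proof (rule span2_ideal)
  have "w * lat (int a) 0 = of_int (- b) * lat (int a) 0 + of_int (int a) * lat b 1"
    unfolding w_lat lat_comb lat_eq_iff by simp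
  thus "w * lat (int a) 0 \<in> span2 (lat (int a) 0) (lat b 1)" using span2_in by metis
  have "w * lat b 1 = of_int (- c) * lat (int a) 0 + of_int (b + 1) * lat b 1"
    unfolding w_lat lat_comb lat_eq_iff using fb by (simp add: algebra_simps power2_eq_square)
  thus "w * lat b 1 \<in> span2 (lat (int a) 0) (lat b 1)" using span2_in by metis
qed (rule lat_carrier)+

lemma Phi_nonzero:
  assumes "dl v u \<noteq> 0" shows "Phi v u \<in> nonzero_ideals OK"
proof -
  have "ideal (Phi v u) OK" unfolding Phi_smul
    by (rule smul_ideal[OF J0_ideal]) (unfold Phi_smul[symmetric] Phi_def, rule span2_lat_carrier)
  moreover have "dl v u \<in> Phi v u" unfolding Phi_def dl_lat by (rule span2_basis)
  ultimately show ?thesis unfolding nonzero_ideals_def using assms by auto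
qed

lemma idnorm_Phi:
  assumes "dl v u \<noteq> 0" shows "real a * real (idnorm (Phi v u)) = \<bar>dl v u * dl' v u\<bar>"
proof -
  have "real (idnorm (Phi v u)) = of_int (int (idnorm (Phi v u)))" by simp
  also have "int (idnorm (Phi v u)) = \<bar>(int a * u + v * b + v) * u - (u * b + v * c) * (- v)\<bar>"
    using Phi_nonzero[OF assms] unfolding Phi_def by (rule idnorm_span2)
  finally show ?thesis unfolding dl_mult_dl' abs_mult by (simp only: of_int_abs abs_of_nat)
qed

text \<open>The inverse of \<open>J0\<close> as a fractional ideal is its conjugate divided by a,
  and the numbers \<open>dl v u\<close> form that conjugate. The proof compares
  w-coordinates.\<close>

lemma smul_J0_carrier:
  assumes "smul \<gamma> J0 \<subseteq> carrier OK" shows "\<exists>v u. \<gamma> * real a = dl v u"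
proof -
  have "\<gamma> * lat (int a) 0 \<in> carrier OK" "\<gamma> * lat b 1 \<in> carrier OK"
    using assms span2_basis unfolding smul_def J0_def by blast+
  then obtain x y m n where e: "\<gamma> * lat (int a) 0 = lat x y" "\<gamma> * lat b 1 = lat m n" using carrier_lat by metis
  have "lat x y * lat b 1 = lat (int a) 0 * lat m n" unfolding e[symmetric] by simp
  hence "x + y * b + y = int a * n" unfolding lat_mult lat_eq_iff by (simp add: algebra_simps)
  hence "lat x y = dl (- y) n" unfolding dl_lat lat_eq_iff by (simp add: algebra_simps)
  thus ?thesis using e(1) unfolding real_lat by metis
qed

lemma class_eq:
  assumes g: "g > 0" and J: "smul (of_nat g) J0 \<in> nonzero_ideals OK"
  shows "ideal_class_rel OK `` {smul (of_nat g) J0} = {Phi v u | v u. dl v u \<noteq> 0}"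
proof (intro equalityI subsetI)
  fix I assume "I \<in> ideal_class_rel OK `` {smul (of_nat g) J0}"
  then obtain x y where xy: "x \<in> carrier OK" "y \<in> carrier OK" "x \<noteq> 0" "y \<noteq> 0" "smul x (smul (of_nat g) J0) = smul y I"
    "I \<in> nonzero_ideals OK" unfolding Image_singleton_iff class_rel_iff by blast
  define \<gamma> where "\<gamma> = (x * of_nat g) / y"
  have "smul y I = smul (x * of_nat g) J0" using xy by (simp add: smul_smul)
  hence I: "I = smul \<gamma> J0" unfolding \<gamma>_def using smul_cancel[OF xy(4)] by blast
  have "ideal I OK" using xy(6) unfolding nonzero_ideals_def by simp
  hence "smul \<gamma> J0 \<subseteq> carrier OK" unfolding I ideal_OK_iff by blast
  then obtain v u where vu: "\<gamma> * real a = dl v u" using smul_J0_carrier by blast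
  have "\<gamma> = dl v u / real a" using vu a0 by (simp add: field_simps)
  moreover have "dl v u \<noteq> 0" using vu xy g a0 unfolding \<gamma>_def by auto
  ultimately show "I \<in> {Phi v u | v u. dl v u \<noteq> 0}" unfolding I Phi_smul by blast
next
  fix I assume "I \<in> {Phi v u | v u. dl v u \<noteq> 0}"
  then obtain v u where vu: "I = Phi v u" "dl v u \<noteq> 0" by blast
  have e: "smul (dl v u) (smul (of_nat g) J0) = smul (of_nat g * of_nat a) I"
    unfolding vu(1) Phi_smul smul_smul using a0 by (simp add: mult.commute)
  have ga: "of_nat g * of_nat a \<in> carrier OK" "of_nat g * of_nat a \<noteq> (0 :: real)"
    using int_OK[of "int (g * a)"] g a0 by simp_all
  have d: "dl v u \<in> carrier OK" unfolding dl_lat by (rule lat_carrier)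
  have "I \<in> nonzero_ideals OK" unfolding vu(1) by (rule Phi_nonzero[OF vu(2)])
  thus "I \<in> ideal_class_rel OK `` {smul (of_nat g) J0}"
    unfolding Image_singleton_iff class_rel_iff
    by (intro conjI J bexI[OF _ d] bexI[OF _ ga(1)] vu(2) ga(2) e)
qed

text \<open>The choice t^2 = a x turns the bound x on the ideal norm into the hyperbolic bound t^2.
  Two \<delta> with the same ideal differ by a unit, and both lie in an interval whose ends have
  ratio \<epsilon>; conversely a unit with suitable sign and exponent moves any \<delta> into that
  interval without changing the ideal.\<close>

lemma Phi_bij:
  assumes t: "t > 0" "t\<^sup>2 = real a * real x"
  shows "bij_betw (\<lambda>(v, u). Phi v u) (strip_points (real a) (of_int b + w') (of_int b + w) \<epsilon> t)
    {I \<in> {Phi v u | v u. dl v u \<noteq> 0}. idnorm I \<le> x}"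
proof (rule bij_betw_imageI)
  let ?S = "strip_points (real a) (of_int b + w') (of_int b + w) \<epsilon> t"
  have S: "(v, u) \<in> ?S \<longleftrightarrow> t \<le> dl v u \<and> dl v u < \<epsilon> * t \<and> \<bar>dl v u * dl' v u\<bar> \<le> t\<^sup>2" for v u
    unfolding strip_points_def dl_def dl'_def by simp
  have nrm: "\<bar>dl v u * dl' v u\<bar> \<le> t\<^sup>2 \<longleftrightarrow> idnorm (Phi v u) \<le> x" if "dl v u \<noteq> 0" for v u
    unfolding idnorm_Phi[OF that, symmetric] t(2) using a0 by simp
  show "inj_on (\<lambda>(v, u). Phi v u) ?S"
  proof (rule inj_onI, clarify)
    fix v u x y assume h: "(v, u) \<in> ?S" "(x, y) \<in> ?S" "Phi v u = Phi x y"
    have d: "t \<le> dl v u" "dl v u < \<epsilon> * t" "t \<le> dl x y" "dl x y < \<epsilon> * t" using h S by auto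
    define \<eta> where "\<eta> = dl x y / dl v u"
    have nz: "dl v u > 0" "dl x y > 0" using d t by linarith+
    have "dl x y \<in> QF" "dl v u \<in> QF" unfolding dl_lat by (rule lat_QF)+
    hence "\<eta> \<in> QF" unfolding \<eta>_def divide_inverse using QF_mult QF_inverse by blast
    moreover have "smul \<eta> (Phi v u) = Phi v u"
    proof -
      have "smul \<eta> (Phi v u) = Phi x y" unfolding Phi_smul smul_smul \<eta>_def using nz by simp
      thus ?thesis using h by simp
    qed
    ultimately have "\<eta> \<in> Units OK"
      unfolding Phi_def by (intro stabilizer_unit[of _ "lat (int a * u + v * b + v) (- v)" "lat (u * b + v * c) u"])
        (use nz dl_lat[of v u] in \<open>auto simp: \<eta>_def\<close>)
    moreover have "\<eta> < \<epsilon>"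
    proof -
      have "\<epsilon> * t \<le> \<epsilon> * dl v u" using d(1) fund_gt_1 by (intro mult_left_mono) auto
      hence "dl x y < \<epsilon> * dl v u" using d(4) by linarith
      thus ?thesis unfolding \<eta>_def using nz by (simp add: field_simps)
    qed
    moreover have "1 / \<epsilon> < \<eta>"
    proof -
      have "\<epsilon> * t \<le> \<epsilon> * dl x y" using d(3) fund_gt_1 by (intro mult_left_mono) auto
      hence "dl v u < \<epsilon> * dl x y" using d(2) by linarith
      thus ?thesis unfolding \<eta>_def using nz fund_gt_1 by (simp add: field_simps)
    qed
    ultimately have "\<eta> = 1" by (intro unit_between)
    hence "dl v u = dl x y" unfolding \<eta>_def using nz by simp
    thus "v = x \<and> u = y" unfolding dl_eq_iff .
  qed
  show "(\<lambda>(v, u). Phi v u) ` ?S = {I \<in> {Phi v u | v u. dl v u \<noteq> 0}. idnorm I \<le> x}"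
  proof (intro equalityI subsetI)
    fix I assume "I \<in> (\<lambda>(v, u). Phi v u) ` ?S"
    then obtain v u where vu: "(v, u) \<in> ?S" "I = Phi v u" by auto
    have nz: "dl v u \<noteq> 0" using vu S t by force
    thus "I \<in> {I \<in> {Phi v u | v u. dl v u \<noteq> 0}. idnorm I \<le> x}" using vu S nrm[OF nz] by blast
  next
    fix I assume "I \<in> {I \<in> {Phi v u | v u. dl v u \<noteq> 0}. idnorm I \<le> x}"
    then obtain v u where vu: "I = Phi v u" "dl v u \<noteq> 0" "idnorm I \<le> x" by auto
    obtain k where k: "t \<le> \<bar>dl v u\<bar> * \<epsilon> powi k" "\<bar>dl v u\<bar> * \<epsilon> powi k < \<epsilon> * t"
      using ex_unit_scale[of "\<bar>dl v u\<bar>" t] vu t by auto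
    define \<eta> where "\<eta> = (if dl v u > 0 then \<epsilon> powi k else - (\<epsilon> powi k))"
    have \<eta>: "\<eta> \<in> Units OK" unfolding \<eta>_def using Units_powi[OF fund_unit] Units_uminus by simp
    have d: "\<eta> * dl v u = \<bar>dl v u\<bar> * \<epsilon> powi k" unfolding \<eta>_def by auto
    have "ideal (Phi v u) OK" using Phi_nonzero[OF vu(2)] unfolding nonzero_ideals_def by simp
    hence e: "smul (\<eta> * dl v u / real a) J0 = Phi v u"
      using unit_smul[OF _ \<eta>, of "Phi v u"] unfolding Phi_smul smul_smul by simp
    hence "smul (\<eta> * dl v u / real a) J0 \<subseteq> carrier OK" unfolding Phi_def using span2_lat_carrier by simp
    then obtain x' y' where "\<eta> * dl v u / real a * real a = dl x' y'" using smul_J0_carrier by blast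
    hence xy: "\<eta> * dl v u = dl x' y'" using a0 by simp
    have I: "I = Phi x' y'" using e vu(1) unfolding xy Phi_smul[symmetric] by simp
    have nz: "dl x' y' \<noteq> 0" using k(1) t unfolding xy[symmetric] d by linarith
    have "(x', y') \<in> ?S" unfolding S using k nrm[OF nz] vu(3) unfolding I xy[symmetric] d by simp
    thus "I \<in> (\<lambda>(v, u). Phi v u) ` ?S" using I by auto
  qed
qed

text \<open>The linear forms have determinant a sqrt p, and t^2 = a x restores the factor a, so the
  density does not depend on the class.\<close>

lemma Phi_asymp:
  "(\<lambda>x. real (card {I \<in> {Phi v u | v u. dl v u \<noteq> 0}. idnorm I \<le> x}) / real x) \<longlonglongrightarrow> 2 * ln \<epsilon> / rp"
proof -
  let ?S = "\<lambda>t. strip_points (real a) (of_int b + w') (of_int b + w) \<epsilon> t"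
  have ww: "(of_int b + w) - (of_int b + w') = rp" unfolding w_def w'_def by (simp add: field_simps)
  have lt: "of_int b + w' < of_int b + w" using ww rp_pos by linarith
  have "((\<lambda>t. real (card (?S t)) / t\<^sup>2) \<longlongrightarrow> 2 * ln \<epsilon> / (real a * rp)) at_top"
    using strip_points_asymp[OF _ lt fund_gt_1, of "real a"] a0 unfolding ww by simp
  moreover have "filterlim (\<lambda>x. sqrt (real a * real x)) at_top sequentially"
    using a0 by (intro filterlim_compose[OF sqrt_at_top] filterlim_tendsto_pos_mult_at_top[OF tendsto_const] filterlim_real_sequentially) auto
  ultimately have "(\<lambda>x. real (card (?S (sqrt (real a * real x)))) / (sqrt (real a * real x))\<^sup>2) \<longlonglongrightarrow> 2 * ln \<epsilon> / (real a * rp)"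
    by (rule filterlim_compose)
  hence "(\<lambda>x. real a * (real (card (?S (sqrt (real a * real x)))) / (sqrt (real a * real x))\<^sup>2)) \<longlonglongrightarrow> real a * (2 * ln \<epsilon> / (real a * rp))"
    by (rule tendsto_mult_left)
  also have "real a * (2 * ln \<epsilon> / (real a * rp)) = 2 * ln \<epsilon> / rp" using a0 by simp
  finally show ?thesis
  proof (rule Lim_transform_eventually)
    show "\<forall>\<^sub>F x in sequentially. real a * (real (card (?S (sqrt (real a * real x)))) / (sqrt (real a * real x))\<^sup>2) =
      real (card {I \<in> {Phi v u | v u. dl v u \<noteq> 0}. idnorm I \<le> x}) / real x"
      using eventually_gt_at_top[of 0]
    proof eventually_elim
      case (elim x)
      have "card (?S (sqrt (real a * real x))) = card {I \<in> {Phi v u | v u. dl v u \<noteq> 0}. idnorm I \<le> x}"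
        by (rule bij_betw_same_card[OF Phi_bij]) (use a0 elim in auto)
      thus ?case using a0 elim by simp
    qed
  qed
qed

end

lemma class_asymp:
  assumes "C \<in> nonzero_ideals OK // ideal_class_rel OK"
  shows "(\<lambda>x. real (card {I \<in> C. idnorm I \<le> x}) / real x) \<longlonglongrightarrow> 2 * ln \<epsilon> / rp"
proof -
  obtain J where J: "J \<in> nonzero_ideals OK" "C = ideal_class_rel OK `` {J}" using assms by (auto elim: quotientE)
  obtain g a b where t: "(g, a, b) \<in> triples" "J = triple_ideal (g, a, b)" using ex_triple[OF J(1)] by (metis prod_cases3)
  then obtain c where c: "g > 0" "a > 0" "b\<^sup>2 + b - q0 = int a * c" unfolding triples_def by (auto elim: dvdE)
  have "J = smul (of_nat g) (span2 (lat (int a) 0) (lat b 1))"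
    unfolding t(2) triple_ideal_def smul_span2 by (simp add: lat_def algebra_simps)
  hence e: "J = smul (of_nat g) (J0 a b)" unfolding J0_def[OF c(2,3)] .
  have "C = {Phi a b c v u | v u. dl a b v u \<noteq> 0}"
    unfolding J(2) e by (rule class_eq[OF c(2,3,1)]) (use J e in simp)
  thus ?thesis using Phi_asymp[OF c(2,3)] by simp
qed

theorem class_number_formula:
  "real (class_number OK) * (2 * ln \<epsilon>) = rp * L1" "class_number OK > 0"
proof -
  have e: "\<epsilon> > 1" by (rule fund_gt_1)
  have k: "2 * ln \<epsilon> / rp > 0" using e rp_pos by simp
  let ?Q = "nonzero_ideals OK // ideal_class_rel OK"
  have dis: "C \<inter> D = {}" if "C \<in> ?Q" "D \<in> ?Q" "C \<noteq> D" for C D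
    using quotient_disj[OF equiv_class_rel that(1,2)] that(3) by blast
  note pa = partition_asymp[OF Union_quotient[OF equiv_class_rel] dis card_ideals_norm_le(1) class_asymp ideals_asymp k]
  have "real (card ?Q) * (2 * ln \<epsilon> / rp) = L1" by (rule pa(2))
  thus "real (class_number OK) * (2 * ln \<epsilon>) = rp * L1"
    unfolding class_number_def using rp_pos by (simp add: field_simps)
  have "(1, 1, 0) \<in> triples" unfolding triples_def by simp
  hence "triple_ideal (1, 1, 0) \<in> nonzero_ideals OK" by (rule triple_ideal_nonzero)
  hence "?Q \<noteq> {}" by (auto simp: quotient_def)
  thus "class_number OK > 0" unfolding class_number_def using pa(1) by (simp add: card_gt_0_iff)
qed

end
end

section \<open>The determinant as a quotient of Cauchy determinants\<close>

text \<open>Both sides are the derivative of X^p - 1 at a.\<close>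

lemma poly_cofactor_at_root:
  fixes G :: "complex poly"
  assumes "monom 1 p - 1 = [:- a, 1:] * G"
  shows "poly G a = of_nat p * a ^ (p - 1)"
proof -
  have "poly (pderiv ([:- a, 1:] * G)) a = poly G a"
    unfolding pderiv_mult by (simp add: pderiv_pCons)
  moreover have "poly (pderiv (monom 1 p - 1)) a = of_nat p * a ^ (p - 1)"
    by (simp add: pderiv_diff pderiv_monom poly_monom)
  ultimately show ?thesis using assms by metis
qed

text \<open>For i < n this is the Lagrange polynomial of the node x i without its normalization. For
  i = n nothing is omitted, and the full product supplies the last of the n + 1 polynomials of
  degree at most n.\<close>

definition omit_prod :: "nat \<Rightarrow> (nat \<Rightarrow> complex) \<Rightarrow> nat \<Rightarrow> complex poly" where
  "omit_prod n x i = (\<Prod>l\<in>{..<n} - {i}. [:- x l, 1:])"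

lemma degree_omit_prod: "degree (omit_prod n x i) \<le> n"
proof -
  have "degree (omit_prod n x i) \<le> (\<Sum>l\<in>{..<n} - {i}. degree [:- x l, 1:])"
    unfolding omit_prod_def using degree_prod_sum_le[of "{..<n} - {i}" "\<lambda>l. [:- x l, 1:]"] by (simp add: o_def)
  also have "\<dots> \<le> (\<Sum>l\<in>{..<n}. 1)" by (rule order_trans[OF _ sum_mono2]) auto
  finally show ?thesis by simp
qed

lemma omit_prod_full: "omit_prod n x n = (\<Prod>l<n. [:- x l, 1:])"
  unfolding omit_prod_def by simp

lemma omit_prod_mult: "i < n \<Longrightarrow> [:- x i, 1:] * omit_prod n x i = omit_prod n x n"
  unfolding omit_prod_full omit_prod_def by (subst prod.remove[of "{..<n}" i]) auto

lemma poly_omit_prod: "i < n \<Longrightarrow> (a - x i) * poly (omit_prod n x i) a = poly (omit_prod n x n) a"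
  by (subst omit_prod_mult[of i n x, symmetric]) (auto simp: algebra_simps)

lemma poly_omit_prod_0: "l < n \<Longrightarrow> l \<noteq> i \<Longrightarrow> poly (omit_prod n x i) (x l) = 0"
  unfolding omit_prod_def by (auto simp: poly_prod intro!: bexI[of _ l])

lemma poly_sum_le:
  fixes a :: complex
  assumes "degree U \<le> n" shows "(\<Sum>k\<le>n. coeff U k * a ^ k) = poly U a"
  unfolding poly_altdef by (rule sum.mono_neutral_right) (use assms in \<open>auto simp: coeff_eq_0\<close>)

lemma poly_reverse_sum:
  fixes a :: complex
  assumes "degree U \<le> n" "a \<noteq> 0"
  shows "(\<Sum>k<Suc n. coeff U (n - k) * a powi (- int k)) = a powi (- int n) * poly U a"
proof -
  have "(\<Sum>k<Suc n. coeff U (n - k) * a powi (- int k)) = (\<Sum>k<Suc n. coeff U k * a powi (- int (n - k)))"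
    by (rule sum.reindex_bij_witness[of _ "\<lambda>k. n - k" "\<lambda>k. n - k"]) auto
  also have "\<dots> = (\<Sum>k<Suc n. a powi (- int n) * (coeff U k * a ^ k))"
  proof (intro sum.cong refl)
    fix k assume "k \<in> {..<Suc n}"
    hence e: "- int (n - k) = - int n + int k" by auto
    have "a powi (- int (n - k)) = a powi (- int n) * a ^ k"
      unfolding e using assms(2) by (subst power_int_add) (simp_all only: power_int_of_nat simp_thms)
    thus "coeff U k * a powi (- int (n - k)) = a powi (- int n) * (coeff U k * a ^ k)" by (simp only: mult_ac)
  qed
  also have "\<dots> = a powi (- int n) * (\<Sum>k\<le>n. coeff U k * a ^ k)"
    by (simp only: sum_distrib_left lessThan_Suc_atMost)
  also have "(\<Sum>k\<le>n. coeff U k * a ^ k) = poly U a" using assms(1) by (rule poly_sum_le)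
  finally show ?thesis .
qed

lemma poly_sum_Suc:
  fixes a :: complex
  assumes "degree U \<le> n"
  shows "(\<Sum>k<Suc n. coeff U k * a ^ k) = poly U a"
  unfolding lessThan_Suc_atMost using assms by (rule poly_sum_le)

lemma prod_split_last: "(\<Prod>i<Suc n. if i < n then f i else c) = (\<Prod>i<n. f i) * (c :: 'a :: comm_monoid_mult)"
  by simp

lemma double_sum_factor:
  fixes c :: "'a :: comm_semiring_0"
  shows "(\<Sum>l\<in>A. \<Sum>k\<in>B. c * f k * g l) = c * sum f B * sum g A"
proof -
  have "c * sum f B * sum g A = sum g A * (\<Sum>k\<in>B. c * f k)"
    by (simp add: sum_distrib_left[symmetric] mult_ac)
  also have "\<dots> = (\<Sum>l\<in>A. \<Sum>k\<in>B. g l * (c * f k))" by (rule sum_product)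
  finally show ?thesis by (simp add: mult_ac)
qed

text \<open>Up to the factor p this is y G(y^2), where G is X^p - 1 divided by X - 1 and X - y^2.
  The denominator is the odd cubic y^3 - y, which makes sums and differences of values
  factor.\<close>

definition phi :: "complex \<Rightarrow> complex" where "phi y = 1 / (y * (y\<^sup>2 - 1))"

text \<open>The sum of the cubics y^3 - y and z^3 - z is divisible by y + z, so only y - z survives
  in the denominator.\<close>

lemma phi_add:
  assumes "y \<noteq> 0" "z \<noteq> 0" "y\<^sup>2 \<noteq> 1" "z\<^sup>2 \<noteq> 1" "y\<^sup>2 \<noteq> z\<^sup>2"
  shows "(phi y + phi z) / (y\<^sup>2 - z\<^sup>2) = phi y * phi z * ((y\<^sup>2 - y * z + z\<^sup>2 - 1) / (y - z))"
proof -
  define a b where "a = y * (y\<^sup>2 - 1)" and "b = z * (z\<^sup>2 - 1)"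
  have ab: "a \<noteq> 0" "b \<noteq> 0" unfolding a_def b_def using assms by auto
  have yz: "y + z \<noteq> 0" "y - z \<noteq> 0" using assms(5) by (auto simp: add_eq_0_iff2)
  have f: "a + b = (y + z) * (y\<^sup>2 - y * z + z\<^sup>2 - 1)" "y\<^sup>2 - z\<^sup>2 = (y + z) * (y - z)"
    unfolding a_def b_def by (simp_all add: power2_eq_square algebra_simps)
  have "phi y + phi z = phi y * phi z * (a + b)"
    unfolding phi_def a_def[symmetric] b_def[symmetric] using ab by (simp add: field_simps)
  thus ?thesis unfolding f using yz by simp
qed

text \<open>Here y - z cancels and y + z survives. The extra summand is the contribution of the root
  1, equal to the product of \<open>phi y * y\<close> and \<open>phi z * z\<close>.\<close>

lemma phi_diff:
  assumes "y \<noteq> 0" "z \<noteq> 0" "y\<^sup>2 \<noteq> 1" "z\<^sup>2 \<noteq> 1" "y\<^sup>2 \<noteq> z\<^sup>2"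
  shows "(phi y - phi z) / (y\<^sup>2 - z\<^sup>2) + 1 / ((1 - y\<^sup>2) * (1 - z\<^sup>2)) =
    phi y * phi z * (y * z - (y\<^sup>2 + y * z + z\<^sup>2 - 1) / (y + z))"
proof -
  define a b where "a = y * (y\<^sup>2 - 1)" and "b = z * (z\<^sup>2 - 1)"
  have ab: "a \<noteq> 0" "b \<noteq> 0" unfolding a_def b_def using assms by auto
  have yz: "y + z \<noteq> 0" "y - z \<noteq> 0" using assms(5) by (auto simp: add_eq_0_iff2)
  have f: "b - a = - (y - z) * (y\<^sup>2 + y * z + z\<^sup>2 - 1)" "y\<^sup>2 - z\<^sup>2 = (y - z) * (y + z)"
    unfolding a_def b_def by (simp_all add: power2_eq_square algebra_simps)
  have "phi y - phi z = phi y * phi z * (b - a)"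
    unfolding phi_def a_def[symmetric] b_def[symmetric] using ab by (simp add: field_simps)
  moreover have "P * (- A * Q) / (A * B) = P * (- (Q / B))" if "A \<noteq> 0" "B \<noteq> 0" for A B P Q :: complex
    using that by (simp add: field_simps)
  ultimately have 1: "(phi y - phi z) / (y\<^sup>2 - z\<^sup>2) = phi y * phi z * (- ((y\<^sup>2 + y * z + z\<^sup>2 - 1) / (y + z)))"
    unfolding f using yz by metis
  have nz: "1 - y\<^sup>2 \<noteq> 0" "1 - z\<^sup>2 \<noteq> 0" using assms by auto
  have "phi y * y = - (1 / (1 - y\<^sup>2))" "phi z * z = - (1 / (1 - z\<^sup>2))"
    unfolding phi_def using assms nz by (auto simp: divide_simps)
  hence "1 / ((1 - y\<^sup>2) * (1 - z\<^sup>2)) = (phi y * y) * (phi z * z)" by simp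
  thus ?thesis unfolding 1 by (simp add: algebra_simps)
qed

lemma phi_border:
  assumes "y \<noteq> 0" "y\<^sup>2 \<noteq> 1"
  shows "phi y + 1 / (1 - y\<^sup>2) = phi y * (1 - y)"
proof -
  have "1 - y\<^sup>2 \<noteq> 0" using assms by auto
  hence "phi y * y = - (1 / (1 - y\<^sup>2))" unfolding phi_def using assms by (auto simp: divide_simps)
  thus ?thesis by (simp add: algebra_simps)
qed

section \<open>Products over residue classes of p-th roots of unity\<close>

context prime_1_mod_4
begin

definition hp :: nat where "hp = (p - 1) div 2"

lemma hp: "p = 2 * hp + 1" "even hp" "hp > 0"
proof -
  have 2: "hp = 2 * ((p - 1) div 4)" unfolding hp_def by (subst (1) p_eq) simp
  thus e: "even hp" by simp
  show 1: "p = 2 * hp + 1" unfolding 2 using p_eq by simp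
  thus "hp > 0" using p_ge_5 by linarith
qed

definition res_class :: "int \<Rightarrow> int set" where "res_class e = {k \<in> {0..<int p}. chi k = e}"

lemma Res_class: "Res = res_class 1" and Non_class: "Non = res_class (-1)"
  unfolding Res_def Non_def res_class_def by simp_all

lemma prod_class_reindex:
  fixes F :: "int \<Rightarrow> 'a :: comm_monoid_mult"
  assumes t: "chi t \<noteq> 0" and per: "\<And>k. F (k mod int p) = F k"
  shows "(\<Prod>k\<in>res_class e. F (t * k)) = (\<Prod>k\<in>res_class (chi t * e). F k)"
proof -
  have tt: "chi t * chi t = 1" using t chi_values[of t] by auto
  have bij: "bij_betw (\<lambda>k. (t * k + 0) mod int p) {0..<int p} {0..<int p}"
    by (rule residues_bij) (use t chi_eq_0_iff in simp)
  have "bij_betw (\<lambda>k. (t * k + 0) mod int p) (res_class e) (res_class (chi t * e))"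
  proof (rule bij_betw_subset[OF bij])
    show "res_class e \<subseteq> {0..<int p}" unfolding res_class_def by auto
    have "chi ((t * k + 0) mod int p) = chi t * chi k" for k by (simp add: chi_mult)
    hence c: "chi ((t * k + 0) mod int p) = chi t * e \<longleftrightarrow> chi k = e" for k using t by simp
    have im: "(\<lambda>k. (t * k + 0) mod int p) ` {0..<int p} = {0..<int p}" using bij unfolding bij_betw_def by blast
    show "(\<lambda>k. (t * k + 0) mod int p) ` res_class e = res_class (chi t * e)"
    proof (intro equalityI subsetI)
      fix x assume "x \<in> (\<lambda>k. (t * k + 0) mod int p) ` res_class e"
      then obtain k where k: "k \<in> {0..<int p}" "chi k = e" "x = (t * k + 0) mod int p" unfolding res_class_def by blast
      thus "x \<in> res_class (chi t * e)" unfolding res_class_def using c[of k] im by blast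
    next
      fix x assume x: "x \<in> res_class (chi t * e)"
      hence "x \<in> {0..<int p}" unfolding res_class_def by blast
      then obtain k where k: "k \<in> {0..<int p}" "x = (t * k + 0) mod int p" using im by blast
      moreover have "chi k = e" using x c[of k] unfolding res_class_def k(2) by blast
      ultimately show "x \<in> (\<lambda>k. (t * k + 0) mod int p) ` res_class e" unfolding res_class_def by blast
    qed
  qed
  from prod.reindex_bij_betw[OF this, of F] show ?thesis by (simp add: per)
qed

text \<open>Pair k with p - k: the class is stable because -1 is a residue, no index is its own
  partner because p is odd, and e \<noteq> 0 excludes k = 0. Each pair contributes a squared
  norm.\<close>

lemma prod_conj_symmetric:
  fixes F :: "int \<Rightarrow> complex"
  assumes sym: "\<And>k. F (int p - k) = cnj (F k)" and e: "e \<noteq> 0"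
  shows "(\<Prod>k\<in>res_class e. F k) = of_real (\<Prod>k\<in>res_class e. norm (F k))"
proof -
  define S1 S2 where "S1 = {k \<in> res_class e. 2 * k < int p}" and "S2 = {k \<in> res_class e. int p < 2 * k}"
  have fin: "finite (res_class e)" unfolding res_class_def by (rule finite_subset[of _ "{0..<int p}"]) auto
  have S: "res_class e = S1 \<union> S2" "S1 \<inter> S2 = {}" "finite S1" "finite S2"
  proof -
    have "2 * k \<noteq> int p" for k using odd_p by (metis dvd_triv_left even_of_nat)
    thus "res_class e = S1 \<union> S2" unfolding S1_def S2_def by (auto simp: linorder_neq_iff)
  qed (use fin in \<open>auto simp: S1_def S2_def\<close>)
  have cm: "chi (int p - k) = chi k" for k
  proof -
    have "chi (int p - k) = chi (- k)" by (rule chi_cong) (simp add: cong_iff_mod_eq)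
    thus ?thesis by (simp add: chi_minus)
  qed
  have re: "(\<Prod>k\<in>S2. G k) = (\<Prod>k\<in>S1. G (int p - k))" for G :: "int \<Rightarrow> 'a :: comm_monoid_mult"
  proof (rule prod.reindex_bij_witness[of _ "\<lambda>k. int p - k" "\<lambda>k. int p - k"])
    fix k assume "k \<in> S1"
    moreover from this have "k \<noteq> 0" using e unfolding S1_def res_class_def by auto
    ultimately show "int p - k \<in> S2" unfolding S1_def S2_def res_class_def by (auto simp: cm)
  qed (auto simp: S1_def S2_def res_class_def cm)
  have "(\<Prod>k\<in>res_class e. F k) = (\<Prod>k\<in>S1. F k * cnj (F k))"
    unfolding S(1) by (simp add: prod.union_disjoint S re sym prod.distrib)
  also have "\<dots> = of_real (\<Prod>k\<in>S1. norm (F k) * norm (F k))"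
    by (simp add: complex_norm_square[symmetric] power2_eq_square)
  also have "(\<Prod>k\<in>S1. norm (F k) * norm (F k)) = (\<Prod>k\<in>res_class e. norm (F k))"
    unfolding S(1) by (simp add: prod.union_disjoint S re sym prod.distrib)
  finally show ?thesis .
qed

lemma card_class: "e = 1 \<or> e = -1 \<Longrightarrow> card (res_class e) = hp"
  using card_Res card_Non unfolding Res_class Non_class hp_def by auto

lemma finite_class: "finite (res_class e)"
  unfolding res_class_def by (rule finite_subset[of _ "{0..<int p}"]) auto

context
  fixes \<eta> :: complex
  assumes root: "\<eta> ^ p = 1" "\<eta> \<noteq> 1"
begin

lemma root_poly: "monom 1 p - 1 = [:- 1, 1:] * ((\<Prod>k\<in>Res. [:- (\<eta> powi k), 1:]) * (\<Prod>k\<in>Non. [:- (\<eta> powi k), 1:]))"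
proof -
  let ?S = "{0..<int p}"
  have "[:- 1, 1:] * ((\<Prod>k\<in>Res. [:- (\<eta> powi k), 1:]) * (\<Prod>k\<in>Non. [:- (\<eta> powi k), 1:])) = (\<Prod>k\<in>?S. [:- (\<eta> powi k), 1:])"
    using residues_split by (simp add: prod.union_disjoint)
  moreover have "monom 1 p - 1 = (\<Prod>k\<in>?S. [:- (\<eta> powi k), 1:])"
  proof (rule poly_eqI_degree_lead_coeff[where n = p and A = "(\<lambda>k. \<eta> powi k) ` ?S"])
    have inj: "inj_on (\<lambda>k. \<eta> powi k) ?S"
    proof (rule inj_onI)
      fix x y assume h: "x \<in> ?S" "y \<in> ?S" "\<eta> powi x = \<eta> powi y"
      hence "int p dvd x - y" using powi_eq_iff[OF root] by simp
      hence "x mod int p = y mod int p" by (simp add: mod_eq_dvd_iff)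
      thus "x = y" using h by simp
    qed
    show "card ((\<lambda>k. \<eta> powi k) ` ?S) \<ge> p" by (simp add: card_image[OF inj])
    have deg: "degree (\<Prod>k\<in>?S. [:- (\<eta> powi k), 1:]) = p"
      by (subst degree_prod_eq_sum_degree) auto
    thus "degree (\<Prod>k\<in>?S. [:- (\<eta> powi k), 1:]) \<le> p" by simp
    show "degree (monom 1 p - 1 :: complex poly) \<le> p"
      by (rule degree_diff_le) (auto simp: degree_monom_le)
    have "lead_coeff (\<Prod>k\<in>?S. [:- (\<eta> powi k), 1:]) = 1" by (simp add: lead_coeff_prod)
    hence "coeff (\<Prod>k\<in>?S. [:- (\<eta> powi k), 1:]) p = 1" using deg by simp
    thus "coeff (monom 1 p - 1) p = coeff (\<Prod>k\<in>?S. [:- (\<eta> powi k), 1:]) p"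
      using p_ge_5 by (simp add: coeff_1 )
    fix z assume "z \<in> (\<lambda>k. \<eta> powi k) ` ?S"
    then obtain k where k: "k \<in> ?S" "z = \<eta> powi k" by auto
    have "z ^ p = 1" unfolding k(2) using powi_p_mult[OF root, of k] by (metis mult.commute power_int_mult power_int_of_nat)
    moreover have "poly (\<Prod>k\<in>?S. [:- (\<eta> powi k), 1:]) z = 0"
      using k by (auto simp: poly_prod intro!: bexI[of _ k])
    ultimately show "poly (monom 1 p - 1) z = poly (\<Prod>k\<in>?S. [:- (\<eta> powi k), 1:]) z"
      by (simp add: poly_monom)
  qed
  ultimately show ?thesis by simp
qed

definition "val e = (\<Prod>k\<in>res_class e. 1 - \<eta> powi k)"

lemma val_prod: "val 1 * val (- 1) = of_nat p"
proof -
  have "poly ((\<Prod>k\<in>Res. [:- (\<eta> powi k), 1:]) * (\<Prod>k\<in>Non. [:- (\<eta> powi k), 1:])) 1 = of_nat p * 1 ^ (p - 1)"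
    by (rule poly_cofactor_at_root) (use root_poly in simp)
  thus ?thesis unfolding val_def Res_class Non_class by (simp add: poly_prod)
qed

lemma cnj_root: "cnj \<eta> powi k = \<eta> powi (- k)"
proof -
  have "\<eta> * cnj \<eta> = 1" using complex_norm_square[of \<eta>] norm_root[OF root] by simp
  hence "cnj \<eta> = inverse \<eta>" by (metis inverse_unique)
  thus ?thesis by (simp add: power_int_inverse power_int_minus)
qed

lemma powi_p_minus: "\<eta> powi (int p - k) = \<eta> powi (- k)"
  using powi_eq_iff[OF root, of "int p - k" "- k"] by simp

lemma val_real: "e \<noteq> 0 \<Longrightarrow> val e = of_real (\<Prod>k\<in>res_class e. norm (1 - \<eta> powi k))"
  unfolding val_def by (rule prod_conj_symmetric) (simp_all add: powi_p_minus cnj_root)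

lemma norm_val_prod: "(\<Prod>k\<in>res_class 1. norm (1 - \<eta> powi k)) * (\<Prod>k\<in>res_class (-1). norm (1 - \<eta> powi k)) = real p"
proof -
  have "of_real ((\<Prod>k\<in>res_class 1. norm (1 - \<eta> powi k)) * (\<Prod>k\<in>res_class (-1). norm (1 - \<eta> powi k))) = (of_real (real p) :: complex)"
    using val_prod val_real[of 1] val_real[of "-1"] by simp
  thus ?thesis by (simp only: of_real_eq_iff)
qed

text \<open>The resultant of the two factors of (X^p - 1)/(X - 1) with roots at residue and
  nonresidue powers.\<close>

definition "rdiff = (\<Prod>k\<in>res_class 1. \<Prod>l\<in>res_class (- 1). \<eta> powi k - \<eta> powi l)"

lemma rdiff_real: "rdiff = of_real (\<Prod>k\<in>res_class 1. \<Prod>l\<in>res_class (- 1). norm (\<eta> powi k - \<eta> powi l))"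
proof -
  have "rdiff = of_real (\<Prod>k\<in>res_class 1. norm (\<Prod>l\<in>res_class (- 1). \<eta> powi k - \<eta> powi l))"
    unfolding rdiff_def
  proof (rule prod_conj_symmetric)
    fix k
    have "(\<Prod>l\<in>res_class (- 1). \<eta> powi (- k) - \<eta> powi ((-1) * l)) = (\<Prod>l\<in>res_class (chi (-1) * (- 1)). \<eta> powi (- k) - \<eta> powi l)"
      by (rule prod_class_reindex) (simp_all add: chi_minus_1 powi_mod[OF root])
    thus "(\<Prod>l\<in>res_class (- 1). \<eta> powi (int p - k) - \<eta> powi l) = cnj (\<Prod>l\<in>res_class (- 1). \<eta> powi k - \<eta> powi l)"
      by (simp add: powi_p_minus cnj_root chi_minus_1)
  qed simp
  thus ?thesis by (simp add: prod_norm)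
qed

lemma norm_class_prod_scaled:
  assumes "chi m \<noteq> 0"
  shows "(\<Prod>t\<in>res_class 1. norm (1 - \<eta> powi (m * t))) * (\<Prod>t\<in>res_class (-1). norm (1 - \<eta> powi (m * t))) = real p"
proof -
  have "(\<Prod>t\<in>res_class e. norm (1 - \<eta> powi (m * t))) = (\<Prod>t\<in>res_class (chi m * e). norm (1 - \<eta> powi t))" for e
    by (rule prod_class_reindex[OF assms]) (simp add: powi_mod[OF root])
  moreover have "chi m = 1 \<or> chi m = -1" using assms chi_values[of m] by auto
  ultimately show ?thesis using norm_val_prod by (auto simp: mult.commute)
qed

text \<open>
  The absolute value does not change when the root is replaced by a power; multiply over all powers.
\<close>
lemma rdiff_eq: "rdiff = of_real (sqrt (real p) ^ hp)"
proof -
  define T where "T t = (\<Prod>k\<in>res_class 1. \<Prod>l\<in>res_class (- 1). norm (\<eta> powi (t * k) - \<eta> powi (t * l)))" for t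
  have T: "T t = T 1" if t: "chi t \<noteq> 0" for t
  proof -
    have 1: "T t = (\<Prod>k\<in>res_class (chi t * 1). \<Prod>l\<in>res_class (chi t * - 1). norm (\<eta> powi k - \<eta> powi l))"
    proof -
      have "T t = (\<Prod>k\<in>res_class 1. \<Prod>l\<in>res_class (chi t * - 1). norm (\<eta> powi (t * k) - \<eta> powi l))"
        unfolding T_def by (intro prod.cong refl prod_class_reindex t) (simp add: powi_mod[OF root])
      also have "\<dots> = (\<Prod>k\<in>res_class (chi t * 1). \<Prod>l\<in>res_class (chi t * - 1). norm (\<eta> powi k - \<eta> powi l))"
        by (rule prod_class_reindex[OF t]) (simp add: powi_mod[OF root])
      finally show ?thesis .
    qed
    show ?thesis
    proof (cases "chi t = 1")
      case True
      thus ?thesis using 1 unfolding T_def by simp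
    next
      case False
      hence "chi t = -1" using t chi_values[of t] by auto
      hence "T t = (\<Prod>k\<in>res_class (- 1). \<Prod>l\<in>res_class 1. norm (\<eta> powi k - \<eta> powi l))" using 1 by simp
      also have "\<dots> = (\<Prod>l\<in>res_class 1. \<Prod>k\<in>res_class (- 1). norm (\<eta> powi k - \<eta> powi l))" by (rule prod.swap)
      also have "\<dots> = T 1" unfolding T_def by (simp add: norm_minus_commute)
      finally show ?thesis .
    qed
  qed
  have ct: "chi t \<noteq> 0" if "t \<in> res_class 1 \<or> t \<in> res_class (-1)" for t using that unfolding res_class_def by auto
  have T0: "T 1 \<ge> 0" unfolding T_def by (intro prod_nonneg) auto
  have Tc: "(\<Prod>t\<in>res_class e. T t) = T 1 ^ hp" if e: "e = 1 \<or> e = -1" for e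
  proof -
    have "(\<Prod>t\<in>res_class e. T t) = (\<Prod>t\<in>res_class e. T 1)"
    proof (rule prod.cong[OF refl])
      fix t assume "t \<in> res_class e"
      hence "chi t \<noteq> 0" using e ct by blast
      thus "T t = T 1" by (rule T)
    qed
    thus ?thesis using card_class[OF e] by (simp only: prod_constant)
  qed
  have "(\<Prod>t\<in>res_class 1. T t) * (\<Prod>t\<in>res_class (-1). T t) = T 1 ^ hp * T 1 ^ hp"
    using Tc[of 1] Tc[of "-1"] by (simp only: simp_thms)
  hence 1: "(T 1 ^ 2) ^ hp = (\<Prod>t\<in>res_class 1. T t) * (\<Prod>t\<in>res_class (-1). T t)"
    by (simp only: power2_eq_square power_mult_distrib)
  \<comment> \<open>Up to a root of unity each difference is 1 - \<eta>^((l-k)t). With k and l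
    fixed, the product over all t is then p, whatever the nonzero residue l - k.\<close>
  have n1: "norm (\<eta> powi (t * k) - \<eta> powi (t * l)) = norm (1 - \<eta> powi ((l - k) * t))" for t k l
  proof -
    have "\<eta> powi (t * k) - \<eta> powi (t * l) = \<eta> powi (t * k) * (1 - \<eta> powi ((l - k) * t))"
      using root_nz[OF root] by (simp add: algebra_simps power_int_add[symmetric])
    thus ?thesis using norm_root[OF root] by (simp add: norm_mult norm_power_int)
  qed
  have sw: "(\<Prod>t\<in>res_class e. T t) = (\<Prod>k\<in>res_class 1. \<Prod>l\<in>res_class (- 1). \<Prod>t\<in>res_class e. norm (1 - \<eta> powi ((l - k) * t)))" for e
  proof -
    have "(\<Prod>t\<in>res_class e. T t) = (\<Prod>k\<in>res_class 1. \<Prod>t\<in>res_class e. \<Prod>l\<in>res_class (- 1). norm (1 - \<eta> powi ((l - k) * t)))"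
      unfolding T_def n1 by (rule prod.swap)
    also have "\<dots> = (\<Prod>k\<in>res_class 1. \<Prod>l\<in>res_class (- 1). \<Prod>t\<in>res_class e. norm (1 - \<eta> powi ((l - k) * t)))"
      by (intro prod.cong refl prod.swap)
    finally show ?thesis .
  qed
  have "(\<Prod>t\<in>res_class 1. T t) * (\<Prod>t\<in>res_class (-1). T t) =
     (\<Prod>k\<in>res_class 1. \<Prod>l\<in>res_class (- 1). (\<Prod>t\<in>res_class 1. norm (1 - \<eta> powi ((l - k) * t))) * (\<Prod>t\<in>res_class (-1). norm (1 - \<eta> powi ((l - k) * t))))"
    unfolding sw by (simp add: prod.distrib)
  also have "\<dots> = (\<Prod>k\<in>res_class 1. \<Prod>l\<in>res_class (- 1). real p)"
  proof (intro prod.cong refl norm_class_prod_scaled)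
    fix k l assume kl: "k \<in> res_class 1" "l \<in> res_class (- 1)"
    show "chi (l - k) \<noteq> 0"
    proof
      assume "chi (l - k) = 0"
      hence "chi l = chi k" unfolding chi_eq_0_iff by (intro chi_cong) (simp add: cong_iff_dvd_diff)
      thus False using kl unfolding res_class_def by simp
    qed
  qed
  also have "\<dots> = (real p ^ hp) ^ hp" by (simp add: card_class)
  finally have "(T 1 ^ 2) ^ hp = (real p ^ hp) ^ hp" using 1 by simp
  hence "T 1 ^ 2 = real p ^ hp" by (rule power_eq_imp_eq_base) (use hp(3) in auto)
  also have "\<dots> = (sqrt (real p) ^ hp) ^ 2" 
    by (simp only: power_mult[symmetric] mult.commute[of hp]) (simp add: power_mult)
  finally have "T 1 ^ 2 = (sqrt (real p) ^ hp) ^ 2" .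
  hence "T 1 = sqrt (real p) ^ hp" by (rule power2_eq_imp_eq[OF _ T0]) simp
  thus ?thesis unfolding rdiff_real T_def by simp
qed

end

section \<open>The bilinear form in Lagrange bases at residues and nonresidues\<close>

context
  fixes \<xi> :: complex
  assumes root: "\<xi> ^ p = 1" "\<xi> \<noteq> 1" and gs: "gauss (\<xi>\<^sup>2) = of_real (sqrt (real p))"
begin

lemma root2: "(\<xi>\<^sup>2) ^ p = 1" "\<xi>\<^sup>2 \<noteq> 1"
proof -
  show "(\<xi>\<^sup>2) ^ p = 1" using root(1) by (metis power_mult mult.commute power_one)
  have "\<not> int p dvd 2" using p_ge_5 zdvd_imp_le[of "int p" 2] by auto
  thus "\<xi>\<^sup>2 \<noteq> 1" using powi_eq_1_iff[OF root, of 2] by simp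
qed

lemma powi_sq2: "(\<xi>\<^sup>2) powi k = \<xi> powi (2 * k)"
  by (simp add: power_int_mult)

lemma powi_sq: "(\<xi>\<^sup>2) powi k = (\<xi> powi k)\<^sup>2"
proof -
  have "\<xi> powi (2 * k) = (\<xi> powi k)\<^sup>2" by (simp add: mult.commute[of 2] power_int_mult)
  thus ?thesis unfolding powi_sq2 .
qed

text \<open>From p = 2 \<open>hp\<close> + 1 one has -2 \<open>hp\<close> = 1 modulo p. This is
  where the weight \<xi>^t of the bilinear form comes from.\<close>

lemma powi_minus_hp: "(\<xi>\<^sup>2 powi t) powi (- int hp) = \<xi> powi t"
proof -
  have "(\<xi>\<^sup>2 powi t) powi (- int hp) = \<xi> powi (2 * t * (- int hp))"
    unfolding powi_sq2 by (simp only: power_int_mult)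
  also have "\<dots> = \<xi> powi t"
  proof -
    have "2 * t * (- int hp) - t = int p * (- t)" using arg_cong[OF hp(1), of int] by (simp add: algebra_simps)
    thus ?thesis by (subst powi_eq_iff[OF root]) simp
  qed
  finally show ?thesis .
qed

text \<open>The Toeplitz matrix of the Fourier transform of h. It contains both matrices to be
  compared: h = \<chi>/sqrt p gives the Legendre matrix and h = 1/p the identity, as index
  differences stay below p.\<close>

definition toep :: "(int \<Rightarrow> complex) \<Rightarrow> complex mat" where
  "toep h = mat (Suc hp) (Suc hp) (\<lambda>(k, l). \<Sum>t\<in>{0..<int p}. h t * (\<xi>\<^sup>2) powi (t * (int l - int k)))"

lemma toep_chi: "toep (\<lambda>t. of_int (chi t) / of_real (sqrt (real p))) =
    mat (Suc hp) (Suc hp) (\<lambda>(k, l). of_int (chi (int l - int k)))"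
proof -
  have "(\<Sum>t\<in>{0..<int p}. of_int (chi t) / of_real (sqrt (real p)) * (\<xi>\<^sup>2) powi (t * m)) = of_int (chi m)" for m
  proof -
    have "(\<Sum>t\<in>{0..<int p}. of_int (chi t) / of_real (sqrt (real p)) * (\<xi>\<^sup>2) powi (t * m)) =
      (\<Sum>t\<in>{0..<int p}. of_int (chi t) * (\<xi>\<^sup>2) powi (t * m)) / of_real (sqrt (real p))"
      by (simp add: sum_divide_distrib)
    thus ?thesis unfolding gauss_twist[OF root2] gs using p_ge_5 by simp
  qed
  thus ?thesis unfolding toep_def by simp
qed

lemma toep_1: "toep (\<lambda>t. 1 / of_nat p) = 1\<^sub>m (Suc hp)"
proof (rule eq_matI)
  fix k l assume "k < dim_row (1\<^sub>m (Suc hp) :: complex mat)" "l < dim_col (1\<^sub>m (Suc hp) :: complex mat)"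
  hence kl: "k < Suc hp" "l < Suc hp" by auto
  have "int p dvd int l - int k \<longleftrightarrow> k = l"
  proof
    assume d: "int p dvd int l - int k"
    show "k = l"
    proof (rule ccontr)
      assume "k \<noteq> l"
      hence "int p \<le> \<bar>int l - int k\<bar>" using d by (intro zdvd_imp_le) auto
      thus False using kl hp(1) by linarith
    qed
  qed simp
  moreover have "(\<Sum>t\<in>{0..<int p}. 1 / of_nat p * (\<xi>\<^sup>2) powi (t * (int l - int k))) =
     (\<Sum>t\<in>{0..<int p}. (\<xi>\<^sup>2) powi (t * (int l - int k))) / of_nat p" by (simp add: sum_divide_distrib)
  ultimately show "toep (\<lambda>t. 1 / of_nat p) $$ (k, l) = 1\<^sub>m (Suc hp) $$ (k, l)"
    unfolding toep_def using kl sum_powi[OF root2] p_ge_5 by auto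
qed (auto simp: toep_def)

context
  fixes r s :: "nat \<Rightarrow> int"
  assumes r: "bij_betw r {..<hp} Res" and s: "bij_betw s {..<hp} Non"
begin

definition "yy i = \<xi> powi (r i)"
definition "zz j = \<xi> powi (s j)"
text \<open>Rows of \<open>Amat\<close> are reversed because the form pairs \<open>U(\<zeta>\<^bsup>-k\<^esup>)\<close> with \<open>V(\<zeta>\<^sup>k)\<close>.\<close>
definition "UU = omit_prod hp (\<lambda>i. (yy i)\<^sup>2)"
definition "VV = omit_prod hp (\<lambda>j. (zz j)\<^sup>2)"
definition "Amat = mat (Suc hp) (Suc hp) (\<lambda>(i, k). coeff (UU i) (hp - k))"
definition "Bmat = mat (Suc hp) (Suc hp) (\<lambda>(l, j). coeff (VV j) l)"

lemma prod_Res: "(\<Prod>k\<in>Res. F k) = (\<Prod>i<hp. F (r i))" and prod_Non: "(\<Prod>k\<in>Non. F k) = (\<Prod>i<hp. F (s i))"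
  using prod.reindex_bij_betw[OF r, of F] prod.reindex_bij_betw[OF s, of F] by simp_all

lemma sum_Res: "(\<Sum>k\<in>Res. F k) = (\<Sum>i<hp. F (r i))" and sum_Non: "(\<Sum>k\<in>Non. F k) = (\<Sum>i<hp. F (s i))"
  using sum.reindex_bij_betw[OF r, of F] sum.reindex_bij_betw[OF s, of F] by simp_all

text \<open>Each entry of \<open>toep h\<close> splits into powers of \<zeta>^t for row and column.
  Summing the reversed row coefficients gives \<zeta>^(-t \<open>hp\<close>) times the value of
  \<open>UU i\<close> at \<zeta>^t, and \<open>powi_minus_hp\<close> evaluates the power.\<close>

lemma bilinear_entry:
  assumes "i < Suc hp" "j < Suc hp"
  shows "(Amat * toep h * Bmat) $$ (i, j) =
    (\<Sum>t\<in>{0..<int p}. h t * \<xi> powi t * poly (UU i) ((\<xi> powi t)\<^sup>2) * poly (VV j) ((\<xi> powi t)\<^sup>2))"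
proof -
  have c: "Amat \<in> carrier_mat (Suc hp) (Suc hp)" "Bmat \<in> carrier_mat (Suc hp) (Suc hp)" "toep h \<in> carrier_mat (Suc hp) (Suc hp)"
    unfolding Amat_def Bmat_def toep_def by auto
  have "(Amat * toep h * Bmat) $$ (i, j) = (\<Sum>l<Suc hp. (Amat * toep h) $$ (i, l) * Bmat $$ (l, j))"
    using assms c by (simp add: scalar_prod_def lessThan_atLeast0 del: assoc_mult_mat)
  also have "\<dots> = (\<Sum>l<Suc hp. (\<Sum>k<Suc hp. Amat $$ (i, k) * toep h $$ (k, l)) * Bmat $$ (l, j))"
    using assms c by (intro sum.cong refl) (simp add: scalar_prod_def lessThan_atLeast0)
  also have "\<dots> = (\<Sum>l<Suc hp. \<Sum>k<Suc hp. \<Sum>t\<in>{0..<int p}.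
      h t * (coeff (UU i) (hp - k) * ((\<xi>\<^sup>2) powi t) powi (- int k)) * (coeff (VV j) l * ((\<xi>\<^sup>2) powi t) ^ l))"
  proof -
    have e: "(\<xi>\<^sup>2) powi (t * (int l - int k)) = ((\<xi>\<^sup>2) powi t) powi (- int k) * ((\<xi>\<^sup>2) powi t) ^ l" for t k l
    proof -
      have e: "t * (int l - int k) = t * (- int k) + t * int l" by (simp add: algebra_simps)
      have "(\<xi>\<^sup>2) powi (t * (- int k) + t * int l) = (\<xi>\<^sup>2) powi (t * (- int k)) * (\<xi>\<^sup>2) powi (t * int l)"
        by (rule power_int_add) (use root_nz[OF root2] in blast)
      thus ?thesis unfolding e power_int_mult power_int_of_nat .
    qed
    show ?thesis unfolding sum_distrib_right[of _ "{..<Suc hp}"]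
    proof (intro sum.cong refl)
      fix k l assume "k \<in> {..<Suc hp}" "l \<in> {..<Suc hp}"
      thus "Amat $$ (i, k) * toep h $$ (k, l) * Bmat $$ (l, j) = (\<Sum>t\<in>{0..<int p}.
          h t * (coeff (UU i) (hp - k) * ((\<xi>\<^sup>2) powi t) powi (- int k)) * (coeff (VV j) l * ((\<xi>\<^sup>2) powi t) ^ l))"
        using assms by (simp add: Amat_def Bmat_def toep_def e sum_distrib_left sum_distrib_right mult_ac)
    qed
  qed
  also have "\<dots> = (\<Sum>t\<in>{0..<int p}. \<Sum>l<Suc hp. \<Sum>k<Suc hp.
      h t * (coeff (UU i) (hp - k) * ((\<xi>\<^sup>2) powi t) powi (- int k)) * (coeff (VV j) l * ((\<xi>\<^sup>2) powi t) ^ l))"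
  proof -
    have "(\<Sum>l\<in>X. \<Sum>k\<in>Y. \<Sum>t\<in>Z. G l k t) = (\<Sum>t\<in>Z. \<Sum>l\<in>X. \<Sum>k\<in>Y. G l k t)" for X Y :: "nat set" and Z :: "int set"
       and G :: "nat \<Rightarrow> nat \<Rightarrow> int \<Rightarrow> complex"
    proof -
      have "(\<Sum>l\<in>X. \<Sum>k\<in>Y. \<Sum>t\<in>Z. G l k t) = (\<Sum>l\<in>X. \<Sum>t\<in>Z. \<Sum>k\<in>Y. G l k t)"
        by (intro sum.cong refl sum.swap)
      also have "\<dots> = (\<Sum>t\<in>Z. \<Sum>l\<in>X. \<Sum>k\<in>Y. G l k t)" by (rule sum.swap)
      finally show ?thesis .
    qed
    thus ?thesis .
  qed
  also have "\<dots> = (\<Sum>t\<in>{0..<int p}. h t * \<xi> powi t * poly (UU i) ((\<xi> powi t)\<^sup>2) * poly (VV j) ((\<xi> powi t)\<^sup>2))"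
  proof (intro sum.cong refl)
    fix t :: int
    let ?a = "(\<xi>\<^sup>2) powi t"
    have a: "?a \<noteq> 0" using root_nz[OF root2] by simp
    have "(\<Sum>l<Suc hp. \<Sum>k<Suc hp. h t * (coeff (UU i) (hp - k) * ?a powi (- int k)) * (coeff (VV j) l * ?a ^ l)) =
      h t * (\<Sum>k<Suc hp. coeff (UU i) (hp - k) * ?a powi (- int k)) * (\<Sum>l<Suc hp. coeff (VV j) l * ?a ^ l)"
      by (rule double_sum_factor)
    also have "(\<Sum>k<Suc hp. coeff (UU i) (hp - k) * ?a powi (- int k)) = \<xi> powi t * poly (UU i) ?a"
      unfolding UU_def poly_reverse_sum[OF degree_omit_prod a] powi_minus_hp ..
    also have "(\<Sum>l<Suc hp. coeff (VV j) l * ?a ^ l) = poly (VV j) ?a"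
      unfolding VV_def by (rule poly_sum_Suc[OF degree_omit_prod])
    finally show "(\<Sum>l<Suc hp. \<Sum>k<Suc hp. h t * (coeff (UU i) (hp - k) * ?a powi (- int k)) * (coeff (VV j) l * ?a ^ l)) =
       h t * \<xi> powi t * poly (UU i) ((\<xi> powi t)\<^sup>2) * poly (VV j) ((\<xi> powi t)\<^sup>2)"
      unfolding powi_sq by (simp only: mult.assoc)
  qed
  finally show ?thesis .
qed

lemma r_Res: "i < hp \<Longrightarrow> r i \<in> Res" and s_Non: "i < hp \<Longrightarrow> s i \<in> Non"
  using r s unfolding bij_betw_def by auto

lemma chi_r: "i < hp \<Longrightarrow> chi (r i) = 1" and chi_s: "i < hp \<Longrightarrow> chi (s i) = -1"
  using r_Res s_Non unfolding Res_def Non_def by auto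

lemma sq_eq_imp:
  assumes "(\<xi> powi k)\<^sup>2 = (\<xi> powi l)\<^sup>2" shows "[k = l] (mod int p)"
  using assms powi_eq_iff[OF root2, of k l] unfolding powi_sq[symmetric] by (simp add: cong_iff_dvd_diff)

lemma sq_ne: "i < hp \<Longrightarrow> j < hp \<Longrightarrow> (yy i)\<^sup>2 \<noteq> (zz j)\<^sup>2"
  using sq_eq_imp[of "r i" "s j"] chi_cong[of "r i" "s j"] chi_r[of i] chi_s[of j] unfolding yy_def zz_def by auto

lemma yz_ne: "i < hp \<Longrightarrow> j < hp \<Longrightarrow> yy i \<noteq> zz j" "i < hp \<Longrightarrow> j < hp \<Longrightarrow> yy i \<noteq> - zz j"
  using sq_ne[of i j] by auto

lemma yz_nz: "yy i \<noteq> 0" "zz i \<noteq> 0"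
  unfolding yy_def zz_def using root_nz[OF root] by auto

lemma sq_ne_1: "i < hp \<Longrightarrow> (yy i)\<^sup>2 \<noteq> 1" "i < hp \<Longrightarrow> (zz i)\<^sup>2 \<noteq> 1"
  using sq_eq_imp[of "r i" 0] sq_eq_imp[of "s i" 0] chi_cong[of "r i" 0] chi_cong[of "s i" 0] chi_r[of i] chi_s[of i]
  unfolding yy_def zz_def by auto

lemma yy_inj: "i < hp \<Longrightarrow> j < hp \<Longrightarrow> yy i = yy j \<Longrightarrow> i = j"
  and zz_inj: "i < hp \<Longrightarrow> j < hp \<Longrightarrow> zz i = zz j \<Longrightarrow> i = j"
proof -
  have eq: "k = l" if "k \<in> {0..<int p}" "l \<in> {0..<int p}" "\<xi> powi k = \<xi> powi l" for k l
  proof -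
    have "k mod int p = l mod int p" using that(3) powi_eq_iff[OF root] by (simp add: mod_eq_dvd_iff)
    thus ?thesis using that(1,2) by simp
  qed
  show "i = j" if "i < hp" "j < hp" "yy i = yy j"
  proof -
    have "r i = r j" using eq[of "r i" "r j"] that r_Res unfolding yy_def Res_def by auto
    thus ?thesis using r that unfolding bij_betw_def by (auto dest: inj_onD)
  qed
  show "i = j" if "i < hp" "j < hp" "zz i = zz j"
  proof -
    have "s i = s j" using eq[of "s i" "s j"] that s_Non unfolding zz_def Non_def by auto
    thus ?thesis using s that unfolding bij_betw_def by (auto dest: inj_onD)
  qed
qed

lemma full_poly: "monom 1 p - 1 = [:- 1, 1:] * (UU hp * VV hp)"
  unfolding root_poly[OF root2] prod_Res prod_Non UU_def VV_def omit_prod_full powi_sq yy_def zz_def ..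

lemma full_at_1: "poly (UU hp) 1 * poly (VV hp) 1 = of_nat p"
  using poly_cofactor_at_root[of p 1 "UU hp * VV hp"] full_poly by simp

lemma phi_cofactor:
  assumes y: "y ^ p = 1" "y \<noteq> 0" "y\<^sup>2 \<noteq> 1" and G: "monom 1 p - 1 = [:- (y\<^sup>2), 1:] * ([:- 1, 1:] * G)"
  shows "y * poly G (y\<^sup>2) = of_nat p * phi y"
proof -
  have "(y\<^sup>2) ^ (p - 1) * y\<^sup>2 = (y\<^sup>2) ^ Suc (p - 1)" by simp
  also have "\<dots> = (y ^ p)\<^sup>2" using p_ge_5 by (simp add: power_mult[symmetric] mult.commute)
  finally have e: "(y\<^sup>2) ^ (p - 1) = 1 / y\<^sup>2" using y by (simp add: field_simps)
  have "(y\<^sup>2 - 1) * poly G (y\<^sup>2) = of_nat p * (y\<^sup>2) ^ (p - 1)"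
    using poly_cofactor_at_root[OF G] by (simp add: algebra_simps)
  hence "(y\<^sup>2 - 1) * poly G (y\<^sup>2) = of_nat p * (1 / y\<^sup>2)" unfolding e .
  moreover have "poly G (y\<^sup>2) = (y\<^sup>2 - 1) * poly G (y\<^sup>2) / (y\<^sup>2 - 1)" using y(3) by simp
  ultimately have "poly G (y\<^sup>2) = of_nat p * (1 / y\<^sup>2) / (y\<^sup>2 - 1)" by simp
  thus ?thesis unfolding phi_def using y by (simp add: power2_eq_square)
qed

lemma yz_pow: "yy i ^ p = 1" "zz i ^ p = 1"
  unfolding yy_def zz_def using powi_p_mult[OF root] by (metis mult.commute power_int_mult power_int_of_nat)+

lemma U_val: assumes "i < hp" shows "yy i * (poly (UU i) ((yy i)\<^sup>2) * poly (VV hp) ((yy i)\<^sup>2)) = of_nat p * phi (yy i)"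
proof -
  have "monom 1 p - 1 = [:- ((yy i)\<^sup>2), 1:] * ([:- 1, 1:] * (UU i * VV hp))"
    unfolding full_poly omit_prod_mult[OF assms, of "\<lambda>i. (yy i)\<^sup>2", folded UU_def, symmetric]
    by (simp only: mult_ac)
  from phi_cofactor[OF yz_pow(1) yz_nz(1) sq_ne_1(1)[OF assms] this] show ?thesis by simp
qed

lemma V_val: assumes "j < hp" shows "zz j * (poly (UU hp) ((zz j)\<^sup>2) * poly (VV j) ((zz j)\<^sup>2)) = of_nat p * phi (zz j)"
proof -
  have "monom 1 p - 1 = [:- ((zz j)\<^sup>2), 1:] * ([:- 1, 1:] * (UU hp * VV j))"
    unfolding full_poly omit_prod_mult[OF assms, of "\<lambda>i. (zz i)\<^sup>2", folded VV_def, symmetric]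
    by (simp only: mult_ac)
  from phi_cofactor[OF yz_pow(2) yz_nz(2) sq_ne_1(2)[OF assms] this] show ?thesis by simp
qed

definition "bil h i j = (\<Sum>t\<in>{0..<int p}. h t * \<xi> powi t * poly (UU i) ((\<xi> powi t)\<^sup>2) * poly (VV j) ((\<xi> powi t)\<^sup>2))"

lemma bil_split:
  "bil h i j = h 0 * (poly (UU i) 1 * poly (VV j) 1) +
     ((\<Sum>l<hp. h (r l) * (yy l * (poly (UU i) ((yy l)\<^sup>2) * poly (VV j) ((yy l)\<^sup>2)))) +
      (\<Sum>l<hp. h (s l) * (zz l * (poly (UU i) ((zz l)\<^sup>2) * poly (VV j) ((zz l)\<^sup>2)))))"
  unfolding bil_def sum_residues_split sum_Res sum_Non yy_def zz_def by (simp add: mult.assoc)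

lemma sum_single:
  fixes f :: "nat \<Rightarrow> complex"
  assumes "\<And>l. l < hp \<Longrightarrow> l \<noteq> i \<Longrightarrow> f l = 0"
  shows "(\<Sum>l<hp. f l) = (if i < hp then f i else 0)"
proof -
  have "(\<Sum>l<hp. f l) = (\<Sum>l<hp. if l = i then f l else 0)" by (rule sum.cong) (use assms in auto)
  thus ?thesis by simp
qed

lemma UU_0: "l < hp \<Longrightarrow> l \<noteq> i \<Longrightarrow> poly (UU i) ((yy l)\<^sup>2) = 0"
  and VV_0: "l < hp \<Longrightarrow> l \<noteq> i \<Longrightarrow> poly (VV i) ((zz l)\<^sup>2) = 0"
  unfolding UU_def VV_def using poly_omit_prod_0[of l hp i "\<lambda>i. (yy i)\<^sup>2"] poly_omit_prod_0[of l hp i "\<lambda>i. (zz i)\<^sup>2"] by auto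

lemma UU_div: "i < hp \<Longrightarrow> x \<noteq> (yy i)\<^sup>2 \<Longrightarrow> poly (UU i) x = poly (UU hp) x / (x - (yy i)\<^sup>2)"
  and VV_div: "i < hp \<Longrightarrow> x \<noteq> (zz i)\<^sup>2 \<Longrightarrow> poly (VV i) x = poly (VV hp) x / (x - (zz i)\<^sup>2)"
  unfolding UU_def VV_def using poly_omit_prod[of i hp x "\<lambda>i. (yy i)\<^sup>2"] poly_omit_prod[of i hp x "\<lambda>i. (zz i)\<^sup>2"]
  by (simp_all add: field_simps)

text \<open>\<open>UU i\<close> vanishes at all residue nodes except its own, \<open>VV j\<close> at
  all nonresidue nodes except its own, and the full products of index \<open>hp\<close> vanish at
  all of theirs.\<close>

lemma bil_eval:
  "bil h i j = h 0 * (poly (UU i) 1 * poly (VV j) 1) +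
     ((if i < hp then h (r i) * (yy i * (poly (UU i) ((yy i)\<^sup>2) * poly (VV j) ((yy i)\<^sup>2))) else 0) +
      (if j < hp then h (s j) * (zz j * (poly (UU i) ((zz j)\<^sup>2) * poly (VV j) ((zz j)\<^sup>2))) else 0))"
  unfolding bil_split
  by (rule arg_cong2[where f = "(+)", OF refl], rule arg_cong2[where f = "(+)"]; rule sum_single) (simp_all add: UU_0 VV_0)

lemma bil_inner:
  assumes "i < hp" "j < hp"
  shows "bil h i j = h 0 * (of_nat p / ((1 - (yy i)\<^sup>2) * (1 - (zz j)\<^sup>2))) +
    (h (r i) * (of_nat p * phi (yy i)) - h (s j) * (of_nat p * phi (zz j))) / ((yy i)\<^sup>2 - (zz j)\<^sup>2)"
proof -
  have ne: "(yy i)\<^sup>2 \<noteq> (zz j)\<^sup>2" "(zz j)\<^sup>2 \<noteq> (yy i)\<^sup>2" "1 \<noteq> (yy i)\<^sup>2" "1 \<noteq> (zz j)\<^sup>2"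
    using sq_ne[OF assms] sq_ne_1(1)[OF assms(1)] sq_ne_1(2)[OF assms(2)] by auto
  have 1: "yy i * (poly (UU i) ((yy i)\<^sup>2) * poly (VV j) ((yy i)\<^sup>2)) = of_nat p * phi (yy i) / ((yy i)\<^sup>2 - (zz j)\<^sup>2)"
    unfolding U_val[OF assms(1), symmetric] VV_div[OF assms(2) ne(1)] by simp
  have "zz j * (poly (UU i) ((zz j)\<^sup>2) * poly (VV j) ((zz j)\<^sup>2)) = of_nat p * phi (zz j) / ((zz j)\<^sup>2 - (yy i)\<^sup>2)"
    unfolding V_val[OF assms(2), symmetric] UU_div[OF assms(1) ne(2)] by simp
  also have "\<dots> = - (of_nat p * phi (zz j) / ((yy i)\<^sup>2 - (zz j)\<^sup>2))"
    by (metis minus_diff_eq minus_divide_right)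
  finally have 2: "zz j * (poly (UU i) ((zz j)\<^sup>2) * poly (VV j) ((zz j)\<^sup>2)) = - (of_nat p * phi (zz j) / ((yy i)\<^sup>2 - (zz j)\<^sup>2))" .
  have 3: "poly (UU i) 1 * poly (VV j) 1 = of_nat p / ((1 - (yy i)\<^sup>2) * (1 - (zz j)\<^sup>2))"
    unfolding UU_div[OF assms(1) ne(3)] VV_div[OF assms(2) ne(4)] full_at_1[symmetric] by simp
  show ?thesis unfolding bil_eval 1 2 3 using assms by (simp add: diff_divide_distrib)
qed

lemma bil_right: "i < hp \<Longrightarrow> bil h i hp = h 0 * (of_nat p / (1 - (yy i)\<^sup>2)) + h (r i) * (of_nat p * phi (yy i))"
  unfolding bil_eval U_val using UU_div[of i 1] sq_ne_1(1)[of i] by (simp add: full_at_1[symmetric])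

lemma bil_bottom: "j < hp \<Longrightarrow> bil h hp j = h 0 * (of_nat p / (1 - (zz j)\<^sup>2)) + h (s j) * (of_nat p * phi (zz j))"
  unfolding bil_eval V_val using VV_div[of j 1] sq_ne_1(2)[of j] by (simp add: full_at_1[symmetric])

lemma bil_corner: "bil h hp hp = h 0 * of_nat p"
  unfolding bil_eval full_at_1 by simp

lemma entry_bil: "i < Suc hp \<Longrightarrow> j < Suc hp \<Longrightarrow> (Amat * toep h * Bmat) $$ (i, j) = bil h i j"
  using bilinear_entry[of i j h] unfolding bil_def .

text \<open>Since \<open>chi 0 = 0\<close>, the root 1 contributes nothing and the corner is 0. The
  signs 1 at residues and -1 at nonresidues turn the difference of the two weights into the sum of
  \<open>phi_add\<close>; sqrt p in each row is p divided by the Gauss sum.\<close>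

lemma chi_form:
  "Amat * toep (\<lambda>t. of_int (chi t) / of_real (sqrt (real p))) * Bmat =
    mat (Suc hp) (Suc hp) (\<lambda>(i, j). (if i < hp then of_real (sqrt (real p)) * phi (yy i) else of_real (sqrt (real p))) * (if j < hp then phi (zz j) else 1) *
      (if i < hp then (if j < hp then ((yy i)\<^sup>2 - yy i * zz j + (zz j)\<^sup>2 - 1) / (yy i - zz j) else 1)
            else (if j < hp then -1 else 0)))" (is "?L = ?R")
proof (rule eq_matI)
  fix i j assume "i < dim_row ?R" "j < dim_col ?R"
  hence ij: "i < Suc hp" "j < Suc hp" by auto
  define g :: complex where "g = of_real (sqrt (real p))"
  have g0: "g \<noteq> 0" unfolding g_def using p_ge_5 by simp
  have gg: "of_nat p = g * g"
  proof -
    have "g * g = of_real (sqrt (real p) * sqrt (real p))" unfolding g_def by (simp only: of_real_mult)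
    also have "sqrt (real p) * sqrt (real p) = real p" by simp
    finally show ?thesis by simp
  qed
  let ?h = "\<lambda>t. of_int (chi t) / g"
  have "bil ?h i j = ?R $$ (i, j)"
  proof (cases "i < hp"; cases "j < hp")
    assume h: "i < hp" "j < hp"
    have "bil ?h i j = g * ((phi (yy i) + phi (zz j)) / ((yy i)\<^sup>2 - (zz j)\<^sup>2))"
      unfolding bil_inner[OF h] gg using g0 by (simp add: chi_r[OF h(1)] chi_s[OF h(2)] distrib_left)
    also have "\<dots> = g * (phi (yy i) * phi (zz j) * (((yy i)\<^sup>2 - yy i * zz j + (zz j)\<^sup>2 - 1) / (yy i - zz j)))"
      by (subst phi_add) (use yz_nz sq_ne_1 sq_ne h in auto)
    finally show ?thesis using h ij by (simp add: g_def)
  next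
    assume h: "i < hp" "\<not> j < hp"
    hence j: "j = hp" using ij by simp
    have "bil ?h i hp = g * phi (yy i)" unfolding bil_right[OF h(1)] gg using g0 by (simp add: chi_r[OF h(1)])
    thus ?thesis unfolding j using h(1) by (simp add: g_def)
  next
    assume h: "\<not> i < hp" "j < hp"
    hence i: "i = hp" using ij by simp
    have "bil ?h hp j = - (g * phi (zz j))" unfolding bil_bottom[OF h(2)] gg using g0 by (simp add: chi_s[OF h(2)])
    thus ?thesis unfolding i using h(2) by (simp add: g_def)
  next
    assume h: "\<not> i < hp" "\<not> j < hp"
    hence i: "i = hp" and j: "j = hp" using ij by auto
    show ?thesis unfolding i j by (simp add: bil_corner)
  qed
  thus "?L $$ (i, j) = ?R $$ (i, j)" unfolding g_def[symmetric] entry_bil[OF ij] .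
qed (auto simp: Amat_def Bmat_def toep_def)

text \<open>Now the root 1 does contribute: it gives the corner 1 and the corrections absorbed by
  \<open>phi_diff\<close> and \<open>phi_border\<close>.\<close>

lemma id_form:
  "Amat * toep (\<lambda>t. 1 / of_nat p) * Bmat =
    mat (Suc hp) (Suc hp) (\<lambda>(i, j). (if i < hp then phi (yy i) else 1) * (if j < hp then phi (zz j) else 1) *
      (if i < hp then (if j < hp then yy i * zz j - ((yy i)\<^sup>2 + yy i * zz j + (zz j)\<^sup>2 - 1) / (yy i + zz j) else 1 - yy i)
            else (if j < hp then 1 - zz j else 1)))" (is "?L = ?R")
proof (rule eq_matI)
  fix i j assume "i < dim_row ?R" "j < dim_col ?R"
  hence ij: "i < Suc hp" "j < Suc hp" by auto
  have p0: "of_nat p \<noteq> (0 :: complex)" using p_ge_5 by simp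
  let ?h = "\<lambda>t::int. 1 / of_nat p :: complex"
  have "bil ?h i j = ?R $$ (i, j)"
  proof (cases "i < hp"; cases "j < hp")
    assume h: "i < hp" "j < hp"
    have "bil ?h i j = (phi (yy i) - phi (zz j)) / ((yy i)\<^sup>2 - (zz j)\<^sup>2) + 1 / ((1 - (yy i)\<^sup>2) * (1 - (zz j)\<^sup>2))"
      unfolding bil_inner[OF h] using p0 by simp
    also have "\<dots> = phi (yy i) * phi (zz j) * (yy i * zz j - ((yy i)\<^sup>2 + yy i * zz j + (zz j)\<^sup>2 - 1) / (yy i + zz j))"
      by (rule phi_diff) (use yz_nz sq_ne_1 sq_ne h in auto)
    finally show ?thesis using h ij by simp
  next
    assume h: "i < hp" "\<not> j < hp"
    hence j: "j = hp" using ij by simp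
    have "bil ?h i hp = phi (yy i) * (1 - yy i)"
      unfolding bil_right[OF h(1)] phi_border[OF yz_nz(1) sq_ne_1(1)[OF h(1)], symmetric] using p0 by simp
    thus ?thesis unfolding j using h(1) by simp
  next
    assume h: "\<not> i < hp" "j < hp"
    hence i: "i = hp" using ij by simp
    have "bil ?h hp j = phi (zz j) * (1 - zz j)"
      unfolding bil_bottom[OF h(2)] phi_border[OF yz_nz(2) sq_ne_1(2)[OF h(2)], symmetric] using p0 by simp
    thus ?thesis unfolding i using h(2) by simp
  next
    assume h: "\<not> i < hp" "\<not> j < hp"
    hence i: "i = hp" and j: "j = hp" using ij by auto
    show ?thesis unfolding i j using p0 by (simp add: bil_corner)
  qed
  thus "?L $$ (i, j) = ?R $$ (i, j)" unfolding entry_bil[OF ij] .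
qed (auto simp: Amat_def Bmat_def toep_def)

definition "cdet = det (mat (Suc hp) (Suc hp) (\<lambda>(k, l). of_int (chi (int l - int k)) :: complex))"

text \<open>The same \<open>Amat\<close>, \<open>Bmat\<close> and factors \<open>phi\<close> occur
  in both forms, so they cancel in the quotient. The identity form accounts for the product of
  \<open>det Amat\<close> and \<open>det Bmat\<close>, which is never evaluated on its own.\<close>

lemma cdet_cauchy:
  "cdet * ((\<Prod>i<hp. 1 - yy i) * (\<Prod>j<hp. 1 - zz j) * cauchy_det hp yy (\<lambda>j. - zz j)) =
    of_real (sqrt (real p)) ^ Suc hp *
     (cauchy_det hp yy zz * ((\<Prod>i<hp. 1 - yy i) * (\<Prod>j<hp. 1 + zz j) - (\<Prod>i<hp. 1 + yy i) * (\<Prod>j<hp. 1 - zz j)) / 2)"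
proof -
  define g :: complex where "g = of_real (sqrt (real p))"
  define M where "M = (\<lambda>i j. if i < hp then (if j < hp then ((yy i)\<^sup>2 - yy i * zz j + (zz j)\<^sup>2 - 1) / (yy i - zz j) else 1)
            else (if j < hp then -1 else 0))"
  define M0 where "M0 = (\<lambda>i j. if i < hp then (if j < hp then yy i * zz j - ((yy i)\<^sup>2 + yy i * zz j + (zz j)\<^sup>2 - 1) / (yy i + zz j) else 1 - yy i)
            else (if j < hp then 1 - zz j else 1))"
  have c: "Amat \<in> carrier_mat (Suc hp) (Suc hp)" "Bmat \<in> carrier_mat (Suc hp) (Suc hp)" "toep h \<in> carrier_mat (Suc hp) (Suc hp)" for h
    unfolding Amat_def Bmat_def toep_def by auto
  have dm: "det (Amat * toep h * Bmat) = det Amat * det (toep h) * det Bmat" for h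
    using det_mult[OF mult_carrier_mat[OF c(1) c(3)] c(2)] det_mult[OF c(1) c(3)] by simp
  define F where "F = (\<Prod>i<hp. phi (yy i)) * (\<Prod>j<hp. phi (zz j))"
  have "phi (yy i) \<noteq> 0" "phi (zz i) \<noteq> 0" if "i < hp" for i
    unfolding phi_def using yz_nz sq_ne_1 that by auto
  hence F0: "F \<noteq> 0" unfolding F_def by auto
  have 1: "det Amat * cdet * det Bmat = g ^ Suc hp * F * det (mat (Suc hp) (Suc hp) (\<lambda>(i, j). M i j))"
  proof -
    have "det Amat * cdet * det Bmat = det (Amat * toep (\<lambda>t. of_int (chi t) / of_real (sqrt (real p))) * Bmat)"
      using dm[of "\<lambda>t. of_int (chi t) / of_real (sqrt (real p))"] unfolding toep_chi cdet_def by (rule sym)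
    also have "\<dots> = (\<Prod>i<Suc hp. if i < hp then g * phi (yy i) else g) * (\<Prod>j<Suc hp. if j < hp then phi (zz j) else 1)
       * det (mat (Suc hp) (Suc hp) (\<lambda>(i, j). M i j))"
      unfolding chi_form unfolding g_def[symmetric] M_def by (rule det_scale)
    also have "\<dots> = g ^ Suc hp * F * det (mat (Suc hp) (Suc hp) (\<lambda>(i, j). M i j))"
      unfolding prod_split_last F_def by (simp add: prod.distrib)
    finally show ?thesis .
  qed
  have 2: "det Amat * det Bmat = F * det (mat (Suc hp) (Suc hp) (\<lambda>(i, j). M0 i j))"
  proof -
    have "det Amat * det Bmat = det (Amat * toep (\<lambda>t. 1 / of_nat p) * Bmat)"
      unfolding toep_1 right_mult_one_mat[OF c(1)] by (rule det_mult[OF c(1,2), symmetric])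
    also have "\<dots> = (\<Prod>i<Suc hp. if i < hp then phi (yy i) else 1) * (\<Prod>j<Suc hp. if j < hp then phi (zz j) else 1)
       * det (mat (Suc hp) (Suc hp) (\<lambda>(i, j). M0 i j))"
      unfolding id_form M0_def by (rule det_scale)
    also have "\<dots> = F * det (mat (Suc hp) (Suc hp) (\<lambda>(i, j). M0 i j))"
      unfolding prod_split_last F_def by simp
    finally show ?thesis .
  qed
  have "cdet * (F * det (mat (Suc hp) (Suc hp) (\<lambda>(i, j). M0 i j))) = g ^ Suc hp * F * det (mat (Suc hp) (Suc hp) (\<lambda>(i, j). M i j))"
    unfolding 1[symmetric] 2[symmetric] by (simp only: mult_ac)
  hence "F * (cdet * det (mat (Suc hp) (Suc hp) (\<lambda>(i, j). M0 i j))) = F * (g ^ Suc hp * det (mat (Suc hp) (Suc hp) (\<lambda>(i, j). M i j)))"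
    by (simp only: mult_ac)
  hence 3: "cdet * det (mat (Suc hp) (Suc hp) (\<lambda>(i, j). M0 i j)) = g ^ Suc hp * det (mat (Suc hp) (Suc hp) (\<lambda>(i, j). M i j))"
    using F0 mult_left_cancel by blast
  have 4: "det (mat (Suc hp) (Suc hp) (\<lambda>(i, j). M0 i j)) = (\<Prod>i<hp. 1 - yy i) * (\<Prod>j<hp. 1 - zz j) * cauchy_det hp yy (\<lambda>j. - zz j)"
    unfolding M0_def by (rule det_bordered_plus) (rule yz_ne(2))
  have 5: "det (mat (Suc hp) (Suc hp) (\<lambda>(i, j). M i j)) =
     cauchy_det hp yy zz * ((\<Prod>i<hp. 1 - yy i) * (\<Prod>j<hp. 1 + zz j) - (\<Prod>i<hp. 1 + yy i) * (\<Prod>j<hp. 1 - zz j)) / 2"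
    unfolding M_def
  proof (rule det_bordered_minus[OF yz_ne(1) _ _ hp(2)])
    fix j assume "j < hp"
    from sq_ne_1(2)[OF this] show "zz j \<noteq> 1" "zz j \<noteq> -1" by auto
  qed
  show ?thesis using 3 unfolding 4 5 g_def .
qed

lemma val_yy: "val \<xi> 1 = (\<Prod>i<hp. 1 - yy i)" "val \<xi> (-1) = (\<Prod>j<hp. 1 - zz j)"
  unfolding val_def[OF root] Res_class[symmetric] Non_class[symmetric] prod_Res prod_Non yy_def zz_def by simp_all

lemma val_yy2: "val (\<xi>\<^sup>2) 1 = (\<Prod>i<hp. 1 - yy i) * (\<Prod>i<hp. 1 + yy i)"
    "val (\<xi>\<^sup>2) (-1) = (\<Prod>j<hp. 1 - zz j) * (\<Prod>j<hp. 1 + zz j)"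
  unfolding val_def[OF root2] Res_class[symmetric] Non_class[symmetric] prod_Res prod_Non prod.distrib[symmetric] powi_sq yy_def zz_def
  by (simp_all add: power2_eq_square algebra_simps)

text \<open>\<open>rdiff\<close> has the same value for \<xi> and for \<xi>^2. Since the latter is
  the product of all (y - z)(y + z), the factors y + z multiply to 1.\<close>

lemma rdiff_yz: "(\<Prod>i<hp. \<Prod>j<hp. yy i - zz j) = of_real (sqrt (real p)) ^ hp"
    "(\<Prod>i<hp. \<Prod>j<hp. yy i + zz j) = 1"
proof -
  have 1: "rdiff \<xi> = (\<Prod>i<hp. \<Prod>j<hp. yy i - zz j)"
    unfolding rdiff_def[OF root] Res_class[symmetric] Non_class[symmetric] prod_Res prod_Non yy_def zz_def ..
  show e: "(\<Prod>i<hp. \<Prod>j<hp. yy i - zz j) = of_real (sqrt (real p)) ^ hp"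
    unfolding 1[symmetric] rdiff_eq[OF root] by simp
  have "rdiff (\<xi>\<^sup>2) = (\<Prod>i<hp. \<Prod>j<hp. (yy i - zz j) * (yy i + zz j))"
    unfolding rdiff_def[OF root2] Res_class[symmetric] Non_class[symmetric] prod_Res prod_Non yy_def zz_def powi_sq
    by (simp add: power2_eq_square algebra_simps)
  also have "\<dots> = of_real (sqrt (real p)) ^ hp * (\<Prod>i<hp. \<Prod>j<hp. yy i + zz j)"
    unfolding e[symmetric] by (simp only: prod.distrib)
  finally have "of_real (sqrt (real p)) ^ hp * (\<Prod>i<hp. \<Prod>j<hp. yy i + zz j) = of_real (sqrt (real p)) ^ hp * 1"
    unfolding rdiff_eq[OF root2] by simp
  thus "(\<Prod>i<hp. \<Prod>j<hp. yy i + zz j) = 1" using p_ge_5 by simp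
qed

lemma cauchy_nz: "cauchy_det hp yy (\<lambda>j. - zz j) \<noteq> 0"
proof
  assume 0: "cauchy_det hp yy (\<lambda>j. - zz j) = 0"
  have "cauchy_det hp yy (\<lambda>j. - zz j) * (\<Prod>i<hp. \<Prod>j<hp. yy i - (- zz j)) =
    (\<Prod>j<hp. \<Prod>i<j. (yy j - yy i) * (- zz i - (- zz j)))"
    by (rule cauchy_det_formula) (rule yz_ne(2))
  hence "(\<Prod>j<hp. \<Prod>i<j. (yy j - yy i) * (- zz i - (- zz j))) = 0" unfolding 0 by simp
  then obtain i j where ij: "j < hp" "i < j" "(yy j - yy i) * (- zz i - (- zz j)) = 0" by (auto simp: prod_zero_iff)
  hence "i < hp" by simp
  hence "yy j \<noteq> yy i" "zz j \<noteq> zz i" using yy_inj zz_inj ij(1,2) by blast+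
  thus False using ij(3) by simp
qed

text \<open>A product of 1 + y over a class is the product of 1 - y^2 divided by that of 1 - y,
  hence a quotient of \<open>val\<close> at \<xi>^2 and at \<xi>.\<close>

lemma cdet_val:
  "cdet * of_nat p = of_real (sqrt (real p)) / 2 * (-1) ^ (hp * (hp - 1) div 2) *
     (val \<xi> 1 * (val (\<xi>\<^sup>2) (-1) / val \<xi> (-1)) - val (\<xi>\<^sup>2) 1 / val \<xi> 1 * val \<xi> (-1))"
proof -
  define g :: complex where "g = of_real (sqrt (real p))"
  define sg :: complex where "sg = (-1) ^ (hp * (hp - 1) div 2)"
  define P1 Q1 P2 Q2 where "P1 = (\<Prod>i<hp. 1 - yy i)" and "Q1 = (\<Prod>j<hp. 1 - zz j)" and
    "P2 = (\<Prod>i<hp. 1 + yy i)" and "Q2 = (\<Prod>j<hp. 1 + zz j)"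
  define K K' where "K = cauchy_det hp yy (\<lambda>j. - zz j)" and "K' = cauchy_det hp yy zz"
  have g0: "g ^ hp \<noteq> 0" unfolding g_def using p_ge_5 by simp
  have K0: "K \<noteq> 0" unfolding K_def by (rule cauchy_nz)
  have PQ: "P1 * Q1 = of_nat p" unfolding P1_def Q1_def val_yy[symmetric] by (rule val_prod[OF root])
  hence nz: "P1 \<noteq> 0" "Q1 \<noteq> 0" using p_ge_5 by auto
  have 1: "K' * g ^ hp = sg * K"
    using cauchy_det_minus[of hp yy zz, OF yz_ne(1) yz_ne(2)] unfolding rdiff_yz K_def K'_def sg_def g_def by simp
  have "cdet * (P1 * Q1 * K) = g ^ Suc hp * (K' * (P1 * Q2 - P2 * Q1) / 2)"
    unfolding P1_def Q1_def P2_def Q2_def K_def K'_def g_def by (rule cdet_cauchy)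
  also have "\<dots> = g / 2 * (K' * g ^ hp) * (P1 * Q2 - P2 * Q1)" by (simp add: mult_ac)
  also have "\<dots> = (g / 2 * sg * (P1 * Q2 - P2 * Q1)) * K" unfolding 1 by (simp only: mult_ac)
  finally have "(cdet * (P1 * Q1)) * K = (g / 2 * sg * (P1 * Q2 - P2 * Q1)) * K" by (simp only: mult_ac)
  hence 2: "cdet * (P1 * Q1) = g / 2 * sg * (P1 * Q2 - P2 * Q1)"
    using mult_right_cancel[OF K0] by blast
  have "val (\<xi>\<^sup>2) (-1) / val \<xi> (-1) = Q2" "val (\<xi>\<^sup>2) 1 / val \<xi> 1 = P2"
    unfolding val_yy2 val_yy using nz unfolding P1_def Q1_def P2_def Q2_def by simp_all
  thus ?thesis using 2 unfolding PQ val_yy P1_def[symmetric] Q1_def[symmetric] g_def sg_def by simp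
qed

end
end
end

section \<open>The theorem\<close>

context prime_1_mod_4
begin

text \<open>Squaring the root multiplies the exponents by 2, which fixes or swaps the classes; this
  separates p = 1 from p = 5 modulo 8.\<close>

lemma val_square:
  assumes root: "\<xi> ^ p = 1" "\<xi> \<noteq> 1"
  shows "val (\<xi>\<^sup>2) e = val \<xi> (chi 2 * e)"
proof -
  have "chi 2 \<noteq> 0" unfolding chi_eq_0_iff using p_ge_5 zdvd_imp_le[of "int p" 2] by auto
  hence "(\<Prod>k\<in>res_class e. 1 - \<xi> powi (2 * k)) = (\<Prod>k\<in>res_class (chi 2 * e). 1 - \<xi> powi k)"
    by (rule prod_class_reindex) (simp add: powi_mod[OF root])
  moreover have "(\<xi>\<^sup>2) powi k = \<xi> powi (2 * k)" for k by (simp add: power_int_mult)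
  moreover have "(\<xi>\<^sup>2) ^ p = 1" using root(1) by (metis power_mult mult.commute power_one)
  moreover have "\<xi>\<^sup>2 \<noteq> 1" using powi_eq_1_iff[OF root, of 2] p_ge_5 zdvd_imp_le[of "int p" 2] by auto
  ultimately show ?thesis using val_def[OF root] val_def[of "\<xi>\<^sup>2"] by simp
qed

section \<open>Evaluation by the class number formula\<close>

context
  fixes \<epsilon> :: real
  assumes fund: "is_fundamental_unit OK \<epsilon>"
begin

text \<open>The logarithms of the two products have sum ln p, by evaluating the cyclotomic
  polynomial at 1, and difference sqrt p L(1, \<chi>) = 2 h ln \<epsilon>.\<close>

lemma val_class_number:
  assumes root: "\<zeta> ^ p = 1" "\<zeta> \<noteq> 1" and gs: "gauss \<zeta> = of_real rp"
  shows "val \<zeta> (-1) = of_real (rp * \<epsilon> ^ class_number OK)" "val \<zeta> 1 = of_real (rp / \<epsilon> ^ class_number OK)"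
proof -
  define h where "h = class_number OK"
  define N R where "N = (\<Prod>k\<in>res_class (-1). norm (1 - \<zeta> powi k))" and "R = (\<Prod>k\<in>res_class 1. norm (1 - \<zeta> powi k))"
  have e: "\<epsilon> > 1" by (rule fund_gt_1[OF fund])
  have nz: "norm (1 - \<zeta> powi k) > 0" if "chi k \<noteq> 0" for k
    using powi_eq_1_iff[OF root, of k] chi_eq_0_iff[of k] that by auto
  have pos: "N > 0" "R > 0" unfolding N_def R_def by (intro prod_pos ballI nz; simp add: res_class_def)+
  have NR: "R * N = real p" unfolding N_def R_def by (rule norm_val_prod[OF root])
  have "ln (\<Prod>k\<in>res_class e. norm (1 - \<zeta> powi k)) = (\<Sum>k\<in>res_class e. ln (norm (1 - \<zeta> powi k)))"
    if "e \<noteq> 0" for e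
  proof (rule ln_prod[OF finite_class])
    fix k assume "k \<in> res_class e"
    hence "norm (1 - \<zeta> powi k) > 0" using that by (intro nz) (simp add: res_class_def)
    thus "norm (1 - \<zeta> powi k) \<noteq> 0" by linarith
  qed
  hence "ln N = (\<Sum>k\<in>res_class (-1). ln (norm (1 - \<zeta> powi k)))" "ln R = (\<Sum>k\<in>res_class 1. ln (norm (1 - \<zeta> powi k)))"
    unfolding N_def R_def by simp_all
  hence "ln N - ln R = rp * L1" unfolding L1_eq_sum_ln[OF root gs] Res_class Non_class by simp
  also have "\<dots> = real h * (2 * ln \<epsilon>)" unfolding h_def by (rule class_number_formula(1)[OF fund, symmetric])
  finally have 1: "ln N - ln R = real h * (2 * ln \<epsilon>)" .
  have "ln R + ln N = ln (R * N)" using pos by (simp add: ln_mult)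
  also have "R * N = rp * rp" using NR by simp
  also have "ln (rp * rp) = 2 * ln rp" by (subst ln_mult) (use rp_pos in auto)
  finally have "ln N = ln rp + real h * ln \<epsilon>" using 1 by simp
  also have "\<dots> = ln (rp * \<epsilon> ^ h)" using rp_pos e by (simp add: ln_mult ln_realpow)
  finally have N: "N = rp * \<epsilon> ^ h" using pos rp_pos e by simp
  have "R * (rp * \<epsilon> ^ h) = rp * rp" using NR unfolding N by simp
  hence "rp * (R * \<epsilon> ^ h) = rp * rp" by (simp only: mult_ac)
  moreover have "rp \<noteq> 0" using rp_pos by linarith
  ultimately have "R * \<epsilon> ^ h = rp" using mult_left_cancel[of rp "R * \<epsilon> ^ h" rp] by blast
  hence R: "R = rp / \<epsilon> ^ h" using e by (simp add: field_simps)
  show "val \<zeta> (-1) = of_real (rp * \<epsilon> ^ class_number OK)"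
    using val_real[OF root, of "-1"] N unfolding N_def h_def by simp
  show "val \<zeta> 1 = of_real (rp / \<epsilon> ^ class_number OK)"
    using val_real[OF root, of 1] R unfolding R_def h_def by simp
qed

text \<open>If \<chi>(2) = 1, both products of 1 + y are 1 and a single power E remains. If
  \<chi>(2) = -1, the values for \<xi> are swapped against those for \<zeta>, the products of 1 + y
  become E^2 and E^(-2), and E^3 results; the sign of the Cauchy quotient compensates the
  exchange.\<close>

lemma chapman_det:
  defines "F \<equiv> (if p mod 8 = 1 then \<epsilon> ^ class_number OK else \<epsilon> ^ (3 * class_number OK))"
  shows "of_int (det (mat (Suc hp) (Suc hp) (\<lambda>(k, l). chi (int l - int k)))) = - (F - 1 / F) / (2 :: real)"
proof -
  define E where "E = \<epsilon> ^ class_number OK"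
  have E: "E > 0" unfolding E_def using fund_gt_1[OF fund] by simp
  obtain \<zeta> where \<zeta>: "\<zeta> ^ p = 1" "\<zeta> \<noteq> 1" "gauss \<zeta> = of_real rp" using ex_root_gauss by blast
  \<comment> \<open>The square root of \<zeta> among the p-th roots of unity.\<close>
  define \<xi> where "\<xi> = \<zeta> ^ ((p + 1) div 2)"
  have "\<xi>\<^sup>2 = \<zeta> ^ ((p + 1) div 2 * 2)" unfolding \<xi>_def by (simp only: power_mult)
  also have "(p + 1) div 2 * 2 = p + 1" using odd_p by presburger
  finally have sq: "\<xi>\<^sup>2 = \<zeta>" using \<zeta>(1) by simp
  have root: "\<xi> ^ p = 1" "\<xi> \<noteq> 1"
  proof -
    have "\<xi> ^ p = (\<zeta> ^ p) ^ ((p + 1) div 2)" unfolding \<xi>_def by (simp only: power_mult[symmetric] mult.commute)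
    thus "\<xi> ^ p = 1" using \<zeta>(1) by simp
    show "\<xi> \<noteq> 1" using sq \<zeta>(2) by auto
  qed
  obtain r where r: "bij_betw r {..<hp} Res"
    using ex_bij_betw_nat_finite[OF finite_Res] card_Res unfolding hp_def by (auto simp: atLeast0LessThan)
  obtain s where s: "bij_betw s {..<hp} Non"
    using ex_bij_betw_nat_finite[OF finite_Non] card_Non unfolding hp_def by (auto simp: atLeast0LessThan)
  let ?cd = "det (mat (Suc hp) (Suc hp) (\<lambda>(k, l). of_int (chi (int l - int k)) :: complex))"
  have gs: "gauss (\<xi>\<^sup>2) = of_real rp" using \<zeta>(3) sq by simp
  have main: "?cd * of_nat p = of_real rp / 2 * (-1) ^ (hp * (hp - 1) div 2) *
     (val \<xi> 1 * (val \<zeta> (-1) / val \<xi> (-1)) - val \<zeta> 1 / val \<xi> 1 * val \<xi> (-1))"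
    using cdet_val[OF root gs r s] unfolding cdet_def[OF root gs r s] sq .
  have v: "val \<zeta> (-1) = of_real (rp * E)" "val \<zeta> 1 = of_real (rp / E)"
    unfolding E_def by (rule val_class_number[OF \<zeta>])+
  have vs: "val \<zeta> e = val \<xi> (chi 2 * e)" for e using val_square[OF root, of e] sq by simp
  have "?cd * of_nat p = of_real (- (F - 1 / F) / 2 * real p)"
  proof (cases "p mod 8 = 1")
    case True
    define k where "k = p div 8"
    have k: "p = 8 * k + 1" using True unfolding k_def by presburger
    have "hp = 4 * k" using hp(1) k by linarith
    hence "hp * (hp - 1) div 2 = 2 * k * (4 * k - 1)" by simp
    hence sg: "(-1 :: complex) ^ (hp * (hp - 1) div 2) = 1" by simp
    have "(p - 1) div 4 = 2 * k" using k by simp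
    hence c2: "chi 2 = 1" using chi_2 by simp
    have x: "val \<xi> 1 = of_real (rp / E)" "val \<xi> (-1) = of_real (rp * E)" using vs[of 1] vs[of "-1"] v c2 by auto
    have "?cd * of_nat p = of_real (rp / 2 * (rp / E * (rp * E / (rp * E)) - rp / E / (rp / E) * (rp * E)))"
      unfolding main v x sg by simp
    also have "rp / 2 * (rp / E * (rp * E / (rp * E)) - rp / E / (rp / E) * (rp * E)) = - (E - 1 / E) / 2 * (rp * rp)"
      using rp_pos E by (simp add: field_simps)
    also have "E = F" unfolding F_def E_def using True by simp
    finally show ?thesis unfolding rp_square .
  next
    case False
    define k where "k = p div 8"
    have "p mod 8 = 5" using False p_mod_8 by blast
    hence k: "p = 8 * k + 5" unfolding k_def by presburger
    have "hp = 4 * k + 2" using hp(1) k by linarith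
    hence "hp * (hp - 1) div 2 = (2 * k + 1) * (4 * k + 1)" by simp
    hence sg: "(-1 :: complex) ^ (hp * (hp - 1) div 2) = -1" by simp
    have "(p - 1) div 4 = 2 * k + 1" using k by simp
    hence c2: "chi 2 = -1" using chi_2 by simp
    have x: "val \<xi> (-1) = of_real (rp / E)" "val \<xi> 1 = of_real (rp * E)" using vs[of 1] vs[of "-1"] v c2 by auto
    have "?cd * of_nat p = of_real (- (rp / 2) * (rp * E * (rp * E / (rp / E)) - rp / E / (rp * E) * (rp / E)))"
      unfolding main v x sg by simp
    also have "- (rp / 2) * (rp * E * (rp * E / (rp / E)) - rp / E / (rp * E) * (rp / E)) = - (E ^ 3 - 1 / E ^ 3) / 2 * (rp * rp)"
      using rp_pos E by (simp add: field_simps power3_eq_cube)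
    also have "E ^ 3 = F" unfolding F_def E_def using False by (simp add: power_mult[symmetric] mult.commute)
    finally show ?thesis unfolding rp_square .
  qed
  also have "\<dots> = of_real (- (F - 1 / F) / 2) * of_nat p" by simp
  finally have cd: "?cd = of_real (- (F - 1 / F) / 2)" using p_ge_5 mult_right_cancel[of "of_nat p :: complex"] by simp
  have "mat (Suc hp) (Suc hp) (\<lambda>(k, l). of_int (chi (int l - int k)) :: complex) =
     map_mat of_int (mat (Suc hp) (Suc hp) (\<lambda>(k, l). chi (int l - int k)))" by (rule eq_matI) auto
  hence "?cd = of_int (det (mat (Suc hp) (Suc hp) (\<lambda>(k, l). chi (int l - int k))))" by (simp only: of_int_hom.hom_det)
  hence "of_real (of_int (det (mat (Suc hp) (Suc hp) (\<lambda>(k, l). chi (int l - int k))))) = (of_real (- (F - 1 / F) / 2) :: complex)"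
    using cd by simp
  thus ?thesis by (simp only: of_real_eq_iff)
qed

end

lemma unit_norm:
  assumes "F \<in> Units OK"
  shows "\<exists>u v. F = lat u v \<and> (u * u + u * v - q0 * (v * v) = 1 \<or> u * u + u * v - q0 * (v * v) = -1)"
proof -
  have F: "F \<noteq> 0" "F \<in> carrier OK" "inverse F \<in> carrier OK" using assms unfolding Units_iff by auto
  obtain u v x y where e: "F = lat u v" "inverse F = lat x y" using F carrier_lat by metis
  have "lat u v * lat x y = lat 1 0" unfolding e[symmetric] using F(1) by (simp add: lat_def)
  hence 1: "u * x + v * y * q0 = 1" "u * y + v * x + v * y = 0" unfolding lat_mult lat_eq_iff by auto
  \<comment> \<open>Norms multiply, and the right side is the norm form at the coordinates of the
    product, which are 1 and 0.\<close>
  have "(u * u + u * v - q0 * (v * v)) * (x * x + x * y - q0 * (y * y)) =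
    (u * x + v * y * q0) * (u * x + v * y * q0) + (u * x + v * y * q0) * (u * y + v * x + v * y) -
      q0 * ((u * y + v * x + v * y) * (u * y + v * x + v * y))"
    by (simp add: algebra_simps)
  also have "\<dots> = 1" unfolding 1 by simp
  finally have "u * u + u * v - q0 * (v * v) = 1 \<or> u * u + u * v - q0 * (v * v) = -1"
    by (auto simp: zmult_eq_1_iff)
  thus ?thesis using e(1) by blast
qed

text \<open>If \<open>F\<close> had norm 1, then \<open>d\<close> would be a nonzero rational multiple of \<open>\<surd>p\<close>.\<close>
lemma rational_part_of_unit:
  assumes F: "F \<in> Units OK" "F > 1" and ab: "a \<in> \<rat>" "b \<in> \<rat>" "F = a + b * rp"
    and d: "d \<in> \<rat>" "d = - (F - 1 / F) / 2"
  shows "d = - a"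
proof -
  obtain u v where uv: "F = lat u v" "u * u + u * v - q0 * (v * v) = 1 \<or> u * u + u * v - q0 * (v * v) = -1"
    using unit_norm[OF F(1)] by blast
  have "a + b * rp = (of_int u + of_int v / 2) + (of_int v / 2) * rp"
    using uv(1) ab(3) unfolding lat_def w_def by (simp add: field_simps)
  hence e: "a = of_int u + of_int v / 2" "b = of_int v / 2"
    using rat_indep_eq[of a b "of_int u + of_int v / 2" "of_int v / 2"] ab by auto
  have "(a + b * rp) * (a - b * rp) = a * a - b * b * (rp * rp)" by (simp add: algebra_simps)
  also have "\<dots> = of_int (u * u + u * v - q0 * (v * v))"
    unfolding e rp_square unfolding p_q0_real by (simp add: field_simps)
  finally have N: "F * (a - b * rp) = of_int (u * u + u * v - q0 * (v * v))" unfolding ab(3) .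
  show ?thesis
  proof (cases "u * u + u * v - q0 * (v * v) = -1")
    case True
    have "F * (a - b * rp) = -1" using N unfolding True by simp
    hence "1 / F = - (a - b * rp)" using F(2) by (simp add: field_simps)
    thus ?thesis unfolding d(2) ab(3) by simp
  next
    case False
    hence "u * u + u * v - q0 * (v * v) = 1" using uv(2) by blast
    hence "F * (a - b * rp) = 1" using N by (simp only: of_int_1)
    hence "1 / F = a - b * rp" using F(2) by (simp add: field_simps)
    hence "d + b * rp = 0" unfolding d(2) ab(3) by simp
    hence "b = 0" using rat_indep(2)[OF d(1) ab(2)] by blast
    hence "F = 1 / F" using \<open>1 / F = a - b * rp\<close> ab(3) by simp
    hence "F * F = 1" using F(2) by (simp add: field_simps)
    moreover have "F * F > 1 * 1" using F(2) by (intro mult_strict_mono) auto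
    ultimately show ?thesis by simp
  qed
qed

end

theorem theorem1:
  fixes p n h :: nat and C :: "int mat" and \<epsilon> :: real and a b :: rat
  assumes "prime p" and "[p = 1] (mod 4)"
    and "n = (p - 1) div 2"
    and "C = mat (n + 1) (n + 1) (\<lambda>(i, j). Legendre (int j - int i) (int p))"
    and "is_fundamental_unit (ring_of_integers (real_quadratic_field p)) \<epsilon>"
    and "h = class_number (ring_of_integers (real_quadratic_field p))"
    and "[p = 1] (mod 8) \<Longrightarrow> of_rat a + of_rat b * sqrt (real p) = \<epsilon> ^ h"
    and "[p = 5] (mod 8) \<Longrightarrow> of_rat a + of_rat b * sqrt (real p) = \<epsilon> ^ (3 * h)"
  shows "of_int (det C) = - a"
proof -
  interpret prime_1_mod_4 p
    by unfold_locales (use assms(1,2) in \<open>auto simp: cong_iff_mod_eq\<close>)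
  note fund = assms(5)
  define F where "F = (if p mod 8 = 1 then \<epsilon> ^ h else \<epsilon> ^ (3 * h))"
  have Fab: "F = of_rat a + of_rat b * sqrt (real p)"
    using assms(7,8) p_mod_8 unfolding F_def by (auto simp: cong_iff_mod_eq)
  have C: "C = mat (Suc hp) (Suc hp) (\<lambda>(k, l). chi (int l - int k))"
    unfolding assms(3,4) hp_def chi_def by simp
  \<comment> \<open>A positive class number makes F a proper unit above 1, so F differs from
    1/F.\<close>
  have h: "h > 0" unfolding assms(6) by (rule class_number_formula(2)[OF fund])
  have e: "\<epsilon> > 1" by (rule fund_gt_1[OF fund])
  have "\<epsilon> powi int k \<in> Units (ring_of_integers (real_quadratic_field p))" for k
    by (rule Units_powi[OF fund_unit[OF fund]])
  hence FU: "F \<in> Units (ring_of_integers (real_quadratic_field p))" unfolding F_def by (simp add: power_int_of_nat)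
  have F1: "F > 1" unfolding F_def using e h by (simp add: one_less_power)
  have d: "of_int (det C) = - (F - 1 / F) / (2 :: real)"
    unfolding C F_def assms(6) by (rule chapman_det[OF fund])
  have "of_int (det C) = - (of_rat a :: real)"
    by (rule rational_part_of_unit[OF FU F1 _ _ Fab _ d]) auto
  hence "of_rat (of_int (det C)) = (of_rat (- a) :: real)" by (simp add: of_rat_minus)
  thus ?thesis by (simp only: of_rat_eq_iff)
qed

end
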